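(* Suppose that the regularizers $r_t\equiv r$ are identical for all $t$ and that there exist constants $\bar\Delta,\sigma>0$ such that for all $0\le i<t$: (i) $\mathbb{E}[\exp(\lambda\bar G_{i,t}^2)]\le\exp(\lambda(\hat\mu\bar\Delta|i-t|)^2)$ for all $0\le\lambda\le(\hat\mu\bar\Delta|i-t|)^{-2}$; (ii) with $\mathcal{F}_{i,t}:=\sigma(\mathcal{F}_i,\bar x_t)$, $\mathbb{E}[z_i\mid\mathcal{F}_{i,t}]=0$ and $\mathbb{P}\{\|z_i\|\ge\tau\mid\mathcal{F}_{i,t}\}\le2\exp(-2\tau^2/\sigma^2)$ for all $\tau>0$. Suppose $\bar\Delta/\sigma<\sqrt{\hat\mu/(16L^3)}$. Set $\hat\eta_\star=(2\bar\Delta^2/(\hat\mu\sigma^2))^{1/3}$ and $\widehat{\mathcal{G}}=\hat\mu(\bar\Delta\sigma^2/\hat\mu^2)^{2/3}$, and let $D>0$ satisfy $D\ge\psi_0(x_0)-\psi_0^\star$. Fix $\delta\in(0,1)$ and run the averaged decision-dependent proximal stochastic gradient method in epochs $k=0,\dots,K-1$: set $X_0=x_0$ and let $X_{k+1}$ be the output (final average iterate) of the method started at $X_k$ and run for $T_k$ steps with constant step size $\eta_k$, where $$K=1+\left\lceil\log_2\left(\frac1L\left(\frac{\sigma^2\hat\mu}{\bar\Delta^2}\right)^{1/3}\right)\right\rceil,\qquad \eta_0=\frac1{2L},\qquad T_0=\left\lceil\frac{4L}{\hat\mu}\log\left(\frac{LD}{\sigma^2}\right)^+\right\rceil,$$ and,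 for all $k\ge1$, $$\eta_k=\frac{\eta_{k-1}+\hat\eta_\star}{2},\qquad T_k=\left\lceil\frac{2\log\left(4c\log(e/\delta)\right)^+}{\hat\mu\eta_k}\right\rceil,$$ where $c>0$ is the absolute constant of the constant-step high-probability bound recalled in the context. Then the time horizon $T=T_0+\cdots+T_{K-1}$ satisfies $$T\lesssim\frac{L}{\hat\mu}\log\left(\frac{LD}{\sigma^2}\right)^++\frac{\sigma^2}{\hat\mu\widehat{\mathcal{G}}}\left(1\vee\log\log\frac e\delta\right)\le\frac{L}{\hat\mu}\log\left(\frac{D}{\widehat{\mathcal{G}}}\right)^++\frac{\sigma^2}{\hat\mu\widehat{\mathcal{G}}}\left(1\vee\log\log\frac e\delta\right),$$ and the tracking error satisfies $$\psi_T(X_K)-\psi_T^\star\lesssim\widehat{\mathcal{G}}\log\left(\frac e\delta\right)$$ with probability at least $1-K\delta$.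
   Context: Notation: $\mathbb{N}=\{0,1,2,\dots\}$; $\mathbb{R}^d$ carries the Euclidean inner product $\langle\cdot,\cdot\rangle$ and norm $\|\cdot\|$; $a\vee b=\max\{a,b\}$, $a^+=a\vee0$, and $\log(s)^+$ means $(\log s)^+$; $A\lesssim B$ means $A\le CB$ for an absolute numerical constant $C>0$ independent of all problem parameters. Problem family. For each $t\in\mathbb{N}$ and $x\in\mathbb{R}^d$, $f_{t,x}\colon\mathbb{R}^d\to\mathbb{R}$ is $\mu$-strongly convex and $C^1$-smooth with $L$-Lipschitz gradient, for common constants $\mu,L>0$; $\nabla f_{t,x}(u)$ denotes the gradient of $f_{t,x}(\cdot)$ at $u$. For each $t$, $r_t\colon\mathbb{R}^d\to\mathbb{R}\cup\{\infty\}$ is proper, closed, convex. Set $$\gamma:=\sup_{t\in\mathbb{N},\,u,x,y\in\mathbb{R}^d,\,x\ne y}\frac{\|\nabla f_{t,x}(u)-\nabla f_{t,y}(u)\|}{\|x-y\|},$$ and assume $\gamma<\mu/2$. Set $\bar\mu:=\mu-\gamma$ and $\hat\mu:=\mu-2\gamma>0$. The functions may be random (the problem may evolve stochastically), with these conditions holding for every outcome with deterministic $\mu,L,\gamma$. The temporal gradient drift is the random variable $\bar G_{i,t}:=\sup_{u,x\in\mathbb{R}^d}\|\nabla f_{i,x}(u)-\nabla f_{t,x}(u)\|$. Equilibria. For each $t$ there is a unique point $\bar x_t$ with $\bar x_t\in\operatorname{argmin}_{u\in\mathbb{R}^d}\{f_{t,\bar x_t}(u)+r_t(u)\}$. Set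 $\psi_t:=f_{t,\bar x_t}+r_t$ and $\psi_t^\star:=\min\psi_t=\psi_t(\bar x_t)$. Algorithm (averaged decision-dependent proximal stochastic gradient method). At time $t$, with current iterate $x_t$, current average $\hat x_t$ and step size $\eta\in(0,1/\bar\mu)$, a stochastic gradient $g_t$ (estimator of $\nabla f_{t,x_t}(x_t)$) is obtained and $$x_{t+1}=\operatorname{prox}_{\eta r_t}(x_t-\eta g_t)=\operatorname{argmin}_{u}\left\{r_t(u)+\tfrac{1}{2\eta}\|u-(x_t-\eta g_t)\|^2\right\},\qquad \hat x_{t+1}=\left(1-\tfrac{\hat\mu\eta}{2-\mu\eta}\right)\hat x_t+\tfrac{\hat\mu\eta}{2-\mu\eta}x_{t+1}.$$ The gradient noise is $z_t:=\nabla f_{t,x_t}(x_t)-g_t$. When run in epochs, time continues across epochs: with $t_k=T_0+\cdots+T_{k-1}$ (and $t_0=0$), epoch $k$ uses the times $t=t_k,\dots,t_k+T_k-1$ with constant step size $\eta_k$, is initialized by resetting both the iterate and the average to $x_{t_k}=\hat x_{t_k}=X_k$, and outputs as $X_{k+1}$ the average iterate obtained after its $T_k$ steps. Stochastic framework. There is a probability space $(\Omega,\mathcal{F},\mathbb{P})$ with filtration $(\mathcal{F}_t)_{t\ge0}$, $\mathcal{F}_0=\{\emptyset,\Omega\}$, such that for all $t\ge0$: $x_t,\bar x_t\colon\Omega\to\mathbb{R}^d$ are $\mathcal{F}_t$-measurable, and $z_t\colon\Omega\to\mathbb{R}^d$ is $\mathcal{F}_{t+1}$-measurable with $\mathbb{E}[z_t\mid\mathcal{F}_t]=0$.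 Consistently with $\mathcal{F}_0$ being trivial, the initial gap $\psi_0(x_0)-\psi_0^\star$ is deterministic. All quantities whose probabilities or expectations are considered are understood to be random variables. The constant $c$. In this setting, under (i) and (ii) of the claim, there is an absolute constant $c>0$ such that if the averaged method is run from $x_0=\hat x_0$ with a single constant step size $0<\eta\le1/(2L)$ then for each $t\in\mathbb{N}$ and $\delta\in(0,1)$, with probability at least $1-\delta$, $$\psi_t(\hat x_t)-\psi_t^\star\le c\left(\left(1-\tfrac{\hat\mu\eta}{2}\right)^t\left(\psi_0(x_0)-\psi_0^\star\right)+\eta\sigma^2+\frac{\bar\Delta^2}{\hat\mu\eta^2}\right)\log\left(\frac e\delta\right).$$ This is the $c$ used in the definition of $T_k$. *)

theory Defs
  imports "HOL-Probability.Probability"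
begin

definition gradient :: "('a::euclidean_space \<Rightarrow> real) \<Rightarrow> 'a \<Rightarrow> 'a" where
  "gradient h u = (THE v. GDERIV h u :> v)"

definition strongly_convex :: "real \<Rightarrow> ('a::euclidean_space \<Rightarrow> real) \<Rightarrow> bool" where
  "strongly_convex \<mu> h \<longleftrightarrow>
    (\<forall>u v. \<forall>\<theta>\<in>{0..1}. h ((1 - \<theta>) *\<^sub>R u + \<theta> *\<^sub>R v)
        \<le> (1 - \<theta>) * h u + \<theta> * h v - \<mu> / 2 * \<theta> * (1 - \<theta>) * (norm (u - v))\<^sup>2)"

definition smooth_with :: "real \<Rightarrow> ('a::euclidean_space \<Rightarrow> real) \<Rightarrow> bool" where
  "smooth_with L h \<longleftrightarrow> (\<forall>u. h differentiable (at u)) \<and> L-lipschitz_on UNIV (gradient h)"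

text \<open>Closedness and convexity of an extended-valued function are those of its epigraph, a subset
  of the product of the space with the real line.\<close>

definition proper_closed_convex :: "('a::euclidean_space \<Rightarrow> ereal) \<Rightarrow> bool" where
  "proper_closed_convex h \<longleftrightarrow>
    (\<forall>u. h u \<noteq> -\<infinity>) \<and> (\<exists>u. h u \<noteq> \<infinity>) \<and>
    closed {(u, s). h u \<le> ereal s} \<and> convex {(u, s). h u \<le> ereal s}"

definition prox :: "real \<Rightarrow> ('a::euclidean_space \<Rightarrow> ereal) \<Rightarrow> 'a \<Rightarrow> 'a" where
  "prox \<eta> h v = arg_min (\<lambda>u. h u + ereal (1 / (2 * \<eta>) * (norm (u - v))\<^sup>2)) (\<lambda>_. True)"

text \<open>Conventions: \<open>f t \<omega> x u\<close> is the value at \<open>u\<close> of the (random) loss at time \<open>t\<close> with decision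
  parameter \<open>x\<close>, \<open>r t \<omega>\<close> the regularizer, \<open>xbar t \<omega>\<close> the equilibrium, \<open>x t \<omega>\<close> the iterate and
  \<open>g t \<omega>\<close> the stochastic gradient. The regularizers are allowed to be random as well.\<close>

definition param_lipschitz ::
  "'w set \<Rightarrow> (nat \<Rightarrow> 'w \<Rightarrow> 'a::euclidean_space \<Rightarrow> 'a \<Rightarrow> real) \<Rightarrow> ereal" where
  "param_lipschitz \<Omega> f =
    (SUP (\<omega>, t, u, x, y) \<in> {(\<omega>, t, u, x, y). \<omega> \<in> \<Omega> \<and> x \<noteq> y}.
       ereal (norm (gradient (f t \<omega> x) u - gradient (f t \<omega> y) u) / norm (x - y)))"

definition gradient_drift ::
  "(nat \<Rightarrow> 'w \<Rightarrow> 'a::euclidean_space \<Rightarrow> 'a \<Rightarrow> real) \<Rightarrow> nat \<Rightarrow> nat \<Rightarrow> 'w \<Rightarrow> ereal" where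
  "gradient_drift f i t \<omega> =
    (SUP (u, x) \<in> UNIV. ereal (norm (gradient (f i \<omega> x) u - gradient (f t \<omega> x) u)))"

definition psi ::
  "(nat \<Rightarrow> 'w \<Rightarrow> 'a::euclidean_space \<Rightarrow> 'a \<Rightarrow> real) \<Rightarrow> (nat \<Rightarrow> 'w \<Rightarrow> 'a \<Rightarrow> ereal) \<Rightarrow>
    (nat \<Rightarrow> 'w \<Rightarrow> 'a) \<Rightarrow> nat \<Rightarrow> 'w \<Rightarrow> 'a \<Rightarrow> ereal" where
  "psi f r xbar t \<omega> u = ereal (f t \<omega> (xbar t \<omega>) u) + r t \<omega> u"

text \<open>The gap of \<open>psi\<close> above its minimum, which is attained at the equilibrium.\<close>

definition psi_gap ::
  "(nat \<Rightarrow> 'w \<Rightarrow> 'a::euclidean_space \<Rightarrow> 'a \<Rightarrow> real) \<Rightarrow> (nat \<Rightarrow> 'w \<Rightarrow> 'a \<Rightarrow> ereal) \<Rightarrow>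
    (nat \<Rightarrow> 'w \<Rightarrow> 'a) \<Rightarrow> nat \<Rightarrow> 'w \<Rightarrow> 'a \<Rightarrow> ereal" where
  "psi_gap f r xbar t \<omega> u = psi f r xbar t \<omega> u - psi f r xbar t \<omega> (xbar t \<omega>)"

definition gradient_noise ::
  "(nat \<Rightarrow> 'w \<Rightarrow> 'a::euclidean_space \<Rightarrow> 'a \<Rightarrow> real) \<Rightarrow> (nat \<Rightarrow> 'w \<Rightarrow> 'a) \<Rightarrow>
    (nat \<Rightarrow> 'w \<Rightarrow> 'a) \<Rightarrow> nat \<Rightarrow> 'w \<Rightarrow> 'a" where
  "gradient_noise f x g t \<omega> = gradient (f t \<omega> (x t \<omega>)) (x t \<omega>) - g t \<omega>"

text \<open>The pair (iterate, average) after \<open>j\<close> steps of the averaged proximal stochastic gradient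
  method started at time \<open>s\<close> from \<open>X\<close>, for one outcome: \<open>r\<close> and \<open>g\<close> are the sequences of
  regularizers and stochastic gradients in absolute time.\<close>

primrec avg_prox_run ::
  "real \<Rightarrow> real \<Rightarrow> real \<Rightarrow> (nat \<Rightarrow> 'a::euclidean_space \<Rightarrow> ereal) \<Rightarrow> (nat \<Rightarrow> 'a) \<Rightarrow>
    nat \<Rightarrow> 'a \<Rightarrow> nat \<Rightarrow> 'a \<times> 'a" where
  "avg_prox_run \<mu> \<gamma> \<eta> r g s X 0 = (X, X)"
| "avg_prox_run \<mu> \<gamma> \<eta> r g s X (Suc j) =
    (let (y, yhat) = avg_prox_run \<mu> \<gamma> \<eta> r g s X j;
         w = (\<mu> - 2 * \<gamma>) * \<eta> / (2 - \<mu> * \<eta>);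
         y' = prox \<eta> (r (s + j)) (y - \<eta> *\<^sub>R g (s + j))
     in (y', (1 - w) *\<^sub>R yhat + w *\<^sub>R y'))"

text \<open>Conditional expectation of a vector is componentwise.\<close>

definition cond_mean_zero :: "'w measure \<Rightarrow> 'w measure \<Rightarrow> ('w \<Rightarrow> 'a::euclidean_space) \<Rightarrow> bool" where
  "cond_mean_zero M G z \<longleftrightarrow>
    integrable M z \<and> (\<forall>b\<in>Basis. AE \<omega> in M. real_cond_exp M G (\<lambda>\<omega>. z \<omega> \<bullet> b) \<omega> = 0)"

definition cond_probability :: "'w measure \<Rightarrow> 'w measure \<Rightarrow> 'w set \<Rightarrow> 'w \<Rightarrow> real" where
  "cond_probability M G A = real_cond_exp M G (indicat_real A)"

definition joined_algebra :: "'w measure \<Rightarrow> ('w \<Rightarrow> 'a::euclidean_space) \<Rightarrow> 'w measure" where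
  "joined_algebra G y =
    sigma (space G) (sets G \<union> {y -` A \<inter> space G | A. A \<in> sets borel})"

locale decision_dependent_problem = prob_space M
  for M :: "'w measure" +
  fixes \<mu> L \<gamma> :: real
    and f :: "nat \<Rightarrow> 'w \<Rightarrow> 'a::euclidean_space \<Rightarrow> 'a \<Rightarrow> real"
    and r :: "nat \<Rightarrow> 'w \<Rightarrow> 'a \<Rightarrow> ereal"
    and xbar :: "nat \<Rightarrow> 'w \<Rightarrow> 'a"
  assumes mu_pos: "0 < \<mu>" and L_pos: "0 < L"
    and f_strongly_convex: "\<And>t \<omega> x. \<omega> \<in> space M \<Longrightarrow> strongly_convex \<mu> (f t \<omega> x)"
    and f_smooth: "\<And>t \<omega> x. \<omega> \<in> space M \<Longrightarrow> smooth_with L (f t \<omega> x)"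
    and r_pcc: "\<And>t \<omega>. \<omega> \<in> space M \<Longrightarrow> proper_closed_convex (r t \<omega>)"
    and gamma_eq: "ereal \<gamma> = param_lipschitz (space M) f"
    and gamma_less: "\<gamma> < \<mu> / 2"
    and equilibrium: "\<And>t \<omega>. \<omega> \<in> space M \<Longrightarrow>
          is_arg_min (psi f r xbar t \<omega>) (\<lambda>_. True) (xbar t \<omega>)"

locale stochastic_framework = decision_dependent_problem M \<mu> L \<gamma> f r xbar
  for M :: "'w measure" and \<mu> L \<gamma> :: real
    and f :: "nat \<Rightarrow> 'w \<Rightarrow> 'a::euclidean_space \<Rightarrow> 'a \<Rightarrow> real"
    and r :: "nat \<Rightarrow> 'w \<Rightarrow> 'a \<Rightarrow> ereal"
    and xbar :: "nat \<Rightarrow> 'w \<Rightarrow> 'a" +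
  fixes F :: "nat \<Rightarrow> 'w measure"
    and x g :: "nat \<Rightarrow> 'w \<Rightarrow> 'a"
  assumes F_filtration: "filtration (space M) F"
    and F_subalgebra: "\<And>t. subalgebra M (F t)"
    and F_0: "sets (F 0) = {{}, space M}"
    and x_measurable: "\<And>t. x t \<in> borel_measurable (F t)"
    and xbar_measurable: "\<And>t. xbar t \<in> borel_measurable (F t)"
    and noise_measurable: "\<And>t. gradient_noise f x g t \<in> borel_measurable (F (Suc t))"
    and noise_unbiased: "\<And>t. cond_mean_zero M (F t) (gradient_noise f x g t)"
    and initial_gap_deterministic: "\<And>\<omega> \<omega>'. \<omega> \<in> space M \<Longrightarrow> \<omega>' \<in> space M \<Longrightarrow>
          psi_gap f r xbar 0 \<omega> (x 0 \<omega>) = psi_gap f r xbar 0 \<omega>' (x 0 \<omega>')"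

text \<open>The bound on the exponential moment of the drift is stated with the nonnegative integral,
  because the Bochner integral of a non-integrable function is \<open>0\<close>. The drift is a priori
  extended-valued; that it is almost surely finite is implicit in the bound for positive \<open>l\<close>.\<close>

locale light_tailed_framework = stochastic_framework M \<mu> L \<gamma> f r xbar F x g
  for M :: "'w measure" and \<mu> L \<gamma> :: real
    and f :: "nat \<Rightarrow> 'w \<Rightarrow> 'a::euclidean_space \<Rightarrow> 'a \<Rightarrow> real"
    and r :: "nat \<Rightarrow> 'w \<Rightarrow> 'a \<Rightarrow> ereal"
    and xbar :: "nat \<Rightarrow> 'w \<Rightarrow> 'a"
    and F :: "nat \<Rightarrow> 'w measure"
    and x g :: "nat \<Rightarrow> 'w \<Rightarrow> 'a" +
  fixes \<Delta> \<sigma> :: real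
  assumes Delta_pos: "0 < \<Delta>" and sigma_pos: "0 < \<sigma>"
    and r_constant: "\<And>s t \<omega>. \<omega> \<in> space M \<Longrightarrow> r s \<omega> = r t \<omega>"
    and drift_measurable: "\<And>i t. i < t \<Longrightarrow> gradient_drift f i t \<in> borel_measurable M"
    and drift_finite: "\<And>i t. i < t \<Longrightarrow> AE \<omega> in M. gradient_drift f i t \<omega> < \<infinity>"
    and drift_exp_moment: "\<And>i t l. i < t \<Longrightarrow> 0 \<le> l \<Longrightarrow>
          l \<le> 1 / ((\<mu> - 2 * \<gamma>) * \<Delta> * \<bar>real i - real t\<bar>)\<^sup>2 \<Longrightarrow>
          (\<integral>\<^sup>+ \<omega>. ennreal (exp (l * (real_of_ereal (gradient_drift f i t \<omega>))\<^sup>2)) \<partial>M)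
            \<le> ennreal (exp (l * ((\<mu> - 2 * \<gamma>) * \<Delta> * \<bar>real i - real t\<bar>)\<^sup>2))"
    and noise_joint_unbiased: "\<And>i t. i < t \<Longrightarrow>
          cond_mean_zero M (joined_algebra (F i) (xbar t)) (gradient_noise f x g i)"
    and noise_light_tail: "\<And>i t \<tau>. i < t \<Longrightarrow> 0 < \<tau> \<Longrightarrow>
          AE \<omega> in M. cond_probability M (joined_algebra (F i) (xbar t))
              {\<omega> \<in> space M. norm (gradient_noise f x g i \<omega>) \<ge> \<tau>} \<omega>
            \<le> 2 * exp (- 2 * \<tau>\<^sup>2 / \<sigma>\<^sup>2)"

text \<open>The constant-step high-probability bound with constant \<open>c\<close>, for all problems over the given
  sample type and decision space. Products and sums are extended-valued, as the initial gap is
  infinite when the starting point lies outside the domain of the regularizer.\<close>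

definition constant_step_bound :: "'w itself \<Rightarrow> 'a::euclidean_space itself \<Rightarrow> real \<Rightarrow> bool" where
  "constant_step_bound _ _ c \<longleftrightarrow>
    (\<forall>(M :: 'w measure) \<mu> L \<gamma> (f :: nat \<Rightarrow> 'w \<Rightarrow> 'a \<Rightarrow> 'a \<Rightarrow> real) r xbar F x g \<Delta> \<sigma> \<eta> xhat.
      light_tailed_framework M \<mu> L \<gamma> f r xbar F x g \<Delta> \<sigma> \<longrightarrow>
      0 < \<eta> \<longrightarrow> \<eta> \<le> 1 / (2 * L) \<longrightarrow>
      (\<forall>\<omega>\<in>space M. \<forall>t. (x t \<omega>, xhat t \<omega>) =
          avg_prox_run \<mu> \<gamma> \<eta> (\<lambda>t. r t \<omega>) (\<lambda>t. g t \<omega>) 0 (x 0 \<omega>) t) \<longrightarrow>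
      (\<forall>t. (\<lambda>\<omega>. psi_gap f r xbar t \<omega> (xhat t \<omega>)) \<in> borel_measurable M) \<longrightarrow>
      (\<forall>t. \<forall>\<delta>\<in>{0<..<1}.
        measure M {\<omega> \<in> space M. psi_gap f r xbar t \<omega> (xhat t \<omega>) \<le>
            ereal c *
            (ereal ((1 - (\<mu> - 2 * \<gamma>) * \<eta> / 2) ^ t) * psi_gap f r xbar 0 \<omega> (x 0 \<omega>)
              + ereal (\<eta> * \<sigma>\<^sup>2 + \<Delta>\<^sup>2 / ((\<mu> - 2 * \<gamma>) * \<eta>\<^sup>2))) *
            ereal (ln (exp 1 / \<delta>))}
          \<ge> 1 - \<delta>))"

text \<open>The factor hidden in the relations up to an absolute constant; it may depend on the absolute
  constant \<open>c\<close> above and on nothing else. An existential quantifier over it would range inside the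
  implicit quantification over types, so that it could depend on the dimension; a closed term
  cannot.\<close>

definition absolute_factor :: "real \<Rightarrow> real" where
  "absolute_factor c = 10 ^ 6 * (1 + c)"

end

theory Submission
  imports Defs
begin

text \<open>
  Fix the final time \<open>N\<close> and its equilibrium, and measure all iterates, in every epoch, by the gap of
  \<open>psi\<close> at time \<open>N\<close>. With \<open>w = mh * \<eta> / (2 - \<mu> * \<eta>)\<close> and \<open>mh = \<mu> - 2 * \<gamma>\<close>, the potential
  \<open>\<Phi> = gap (average) + mh / 4 * (norm (iterate - equilibrium))\<^sup>2\<close> satisfies
  \<open>\<Phi>' \<le> (1 - w) * \<Phi> + w * (z \<bullet> (iterate - equilibrium) + \<eta> * (norm z)\<^sup>2 + G\<^sup>2 / mh)\<close>,
  where \<open>G\<close> is the gradient drift between the current time and \<open>N\<close>; resetting the iterate to the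
  average costs a factor \<open>3 / 2\<close>. Unrolling over all epochs leaves three contributions. The initial
  gap decays deterministically. The noise, minus a compensator that the contraction absorbs, is the
  logarithm of a supermartingale for the sigma-algebras generated by the past and the final
  equilibrium. The drift is a weighted sum of squares, whose exponential moment is bounded by
  convexity although its terms are dependent and not adapted.

  The high-probability bound that defines \<open>c\<close> requires a deterministic initial gap, so it cannot be
  restarted at the random points \<open>X k\<close>. It is used only to see that \<open>c\<close> is not small, which makes the
  epochs long enough to contract the gap by more than the factor that the step size loses.
\<close>

section \<open>Proximal gradient steps\<close>

text \<open>The final gap is exponentiated with a factor \<open>lam\<close> of order
  \<open>1 / (\<eta> (K - 1) * \<sigma>\<^sup>2)\<close>, so it is controlled at scale
  \<open>1 / lam\<close>. This is of order \<open>Ghat\<close>, since the last step size is at most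
  four times the cube root that balances \<open>\<eta> * \<sigma>\<^sup>2\<close> against
  \<open>\<Delta>\<^sup>2 / (mh * \<eta>\<^sup>2)\<close>. The noise argument needs the product of
  weight and step size to stay below a fixed constant in every epoch. Going back one epoch the step
  size may double. The weight gains 33 / 20 (3 / 2 for the reset, 11 / 10 for the compensator) times
  the contraction of the epoch, which is at most 5 / 18. The product thus shrinks by 2 * 33 / 20 * 5
  / 18 = 11 / 12, a geometric series. The value 5 / 18 rests on the numerical lower bound for
  \<open>c\<close>. The squared drift grows quadratically with the distance to the final time. It is
  summed against the geometric weights at half of their rate; the other half pays for the resets.
  One exponential inequality for the noise and one for the drift cover all epochs together. Only two
  events of probability \<delta> are discarded, within the allowance of K of them.\<close>

lemma gderiv_gradient:
  fixes h :: "'a::euclidean_space \<Rightarrow> real"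
  assumes "h differentiable (at u)"
  shows "GDERIV h u :> gradient h u"
proof -
  obtain D where D: "(h has_derivative D) (at u)"
    using assms by (auto simp: differentiable_def)
  interpret D: bounded_linear D
    by (rule has_derivative_bounded_linear[OF D])
  \<comment> \<open>The vector of partial derivatives represents the derivative; together with
    uniqueness it makes the description in \<open>gradient\<close> meaningful.\<close>
  have D_eq: "D v = v \<bullet> (\<Sum>b\<in>Basis. D b *\<^sub>R b)" for v
  proof -
    have "D v = D (\<Sum>b\<in>Basis. (v \<bullet> b) *\<^sub>R b)"
      by (simp add: euclidean_representation)
    also have "\<dots> = (\<Sum>b\<in>Basis. (v \<bullet> b) * D b)"
      by (simp add: D.sum D.scaleR)
    finally show ?thesis
      by (simp add: inner_sum_right mult.commute)
  qed
  have "GDERIV h u :> (\<Sum>b\<in>Basis. D b *\<^sub>R b)"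
    unfolding gderiv_def using D D_eq[THEN ext] by (rule has_derivative_eq_rhs)
  moreover from this have "v = (\<Sum>b\<in>Basis. D b *\<^sub>R b)" if "GDERIV h u :> v" for v
  proof -
    have "(\<lambda>h. h \<bullet> v) = (\<lambda>h. h \<bullet> (\<Sum>b\<in>Basis. D b *\<^sub>R b))"
      using that \<open>GDERIV h u :> (\<Sum>b\<in>Basis. D b *\<^sub>R b)\<close> unfolding gderiv_def
      by (rule has_derivative_unique)
    then have "\<forall>x. x \<bullet> v = x \<bullet> (\<Sum>b\<in>Basis. D b *\<^sub>R b)"
      by (intro allI) (rule fun_cong)
    then show ?thesis
      by (rule vector_eq_ldot[THEN iffD1])
  qed
  ultimately show ?thesis
    unfolding gradient_def by (rule theI)
qed

lemma gradient_eqI: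
  fixes h :: "'a::euclidean_space \<Rightarrow> real"
  assumes "GDERIV h u :> v"
  shows "gradient h u = v"
proof -
  have "h differentiable (at u)"
    using assms unfolding gderiv_def differentiable_def by blast
  then have "GDERIV h u :> gradient h u"
    by (rule gderiv_gradient)
  then have "(\<lambda>h. h \<bullet> v) = (\<lambda>x. x \<bullet> gradient h u)"
    using assms unfolding gderiv_def by (intro has_derivative_unique)
  then have "\<forall>x. x \<bullet> v = x \<bullet> gradient h u"
    by (intro allI) (rule fun_cong)
  then have "v = gradient h u"
    by (rule vector_eq_ldot[THEN iffD1])
  then show ?thesis ..
qed

lemma DERIV_along_line:
  fixes h :: "'a::euclidean_space \<Rightarrow> real"
  assumes "h differentiable (at (u + s *\<^sub>R d))"
  shows "((\<lambda>s. h (u + s *\<^sub>R d)) has_field_derivative (gradient h (u + s *\<^sub>R d) \<bullet> d)) (at s)"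
proof -
  have "(h has_derivative (\<lambda>k. k \<bullet> gradient h (u + s *\<^sub>R d))) (at (u + s *\<^sub>R d))"
    using gderiv_gradient[OF assms] unfolding gderiv_def .
  moreover have "((\<lambda>s. u + s *\<^sub>R d) has_derivative (\<lambda>k. k *\<^sub>R d)) (at s)"
    by (auto intro!: derivative_eq_intros)
  ultimately have "((\<lambda>s. h (u + s *\<^sub>R d)) has_derivative (\<lambda>k. (k *\<^sub>R d) \<bullet> gradient h (u + s *\<^sub>R d))) (at s)"
    by (rule has_derivative_compose[rotated])
  then show ?thesis
    unfolding has_field_derivative_def
    by (rule has_derivative_eq_rhs) (auto simp: inner_commute mult.commute)
qed

text \<open>Subtracting the claimed bound along the segment leaves a function whose derivative is
  nonpositive, by Cauchy-Schwarz and the Lipschitz gradient.\<close>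

lemma smooth_with_upper:
  fixes h :: "'a::euclidean_space \<Rightarrow> real"
  assumes "smooth_with L h"
  shows "h v \<le> h u + gradient h u \<bullet> (v - u) + L / 2 * (norm (v - u))\<^sup>2"
proof -
  define d where "d = v - u"
  define \<phi> where "\<phi> s = h (u + s *\<^sub>R d) - s * (gradient h u \<bullet> d) - L / 2 * s\<^sup>2 * (norm d)\<^sup>2" for s
  define \<phi>' where "\<phi>' s = gradient h (u + s *\<^sub>R d) \<bullet> d - gradient h u \<bullet> d - L * s * (norm d)\<^sup>2" for s
  have diff: "h differentiable (at w)" for w
    using assms by (auto simp: smooth_with_def)
  have lip: "L-lipschitz_on UNIV (gradient h)"
    using assms by (auto simp: smooth_with_def)
  have "\<phi> 1 \<le> \<phi> 0"
  proof (rule DERIV_nonpos_imp_nonincreasing[of 0 1 \<phi>])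
    fix s :: real assume s: "0 \<le> s" "s \<le> 1"
    have "(\<phi> has_field_derivative \<phi>' s) (at s)"
      unfolding \<phi>_def \<phi>'_def
      by (auto intro!: derivative_eq_intros DERIV_along_line diff)
    moreover have "\<phi>' s \<le> 0"
    proof -
      have "gradient h (u + s *\<^sub>R d) \<bullet> d - gradient h u \<bullet> d
          = (gradient h (u + s *\<^sub>R d) - gradient h u) \<bullet> d"
        by (simp add: inner_diff_left)
      also have "\<dots> \<le> norm (gradient h (u + s *\<^sub>R d) - gradient h u) * norm d"
        by (rule norm_cauchy_schwarz)
      also have "\<dots> \<le> (L * norm (s *\<^sub>R d)) * norm d"
        using lipschitz_onD[OF lip, of "u + s *\<^sub>R d" u]
        by (intro mult_right_mono) (auto simp: dist_norm)
      finally show ?thesis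
        using s by (simp add: \<phi>'_def power2_eq_square mult.assoc)
    qed
    ultimately show "\<exists>y. (\<phi> has_real_derivative y) (at s) \<and> y \<le> 0" by blast
  qed simp
  then show ?thesis
    by (simp add: \<phi>_def d_def)
qed

text \<open>Strong convexity on the segment is divided by its parameter, which then tends to 0 from
  the right.\<close>

lemma strongly_convex_lower:
  fixes h :: "'a::euclidean_space \<Rightarrow> real"
  assumes sc: "strongly_convex \<mu> h" and diff: "h differentiable (at u)"
  shows "h u + gradient h u \<bullet> (v - u) + \<mu> / 2 * (norm (v - u))\<^sup>2 \<le> h v"
proof -
  define d where "d = v - u"
  have "((\<lambda>s. h (u + s *\<^sub>R d)) has_field_derivative (gradient h u \<bullet> d)) (at 0)"
    using DERIV_along_line[of h u 0 d] diff by simp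
  then have lim: "((\<lambda>s. (h (u + s *\<^sub>R d) - h u) / s) \<longlongrightarrow> gradient h u \<bullet> d) (at_right 0)"
    by (auto simp: DERIV_def intro: tendsto_mono[OF at_le])
  have lim2: "((\<lambda>s. h v - h u - \<mu> / 2 * (1 - s) * (norm d)\<^sup>2) \<longlongrightarrow> h v - h u - \<mu> / 2 * (1 - 0) * (norm d)\<^sup>2) (at_right 0)"
    by (intro tendsto_intros)
  have "gradient h u \<bullet> d \<le> h v - h u - \<mu> / 2 * (1 - 0) * (norm d)\<^sup>2"
  proof (rule tendsto_le[OF _ lim2 lim])
    have "\<forall>\<^sub>F s in at_right 0. s \<in> {0<..<1::real}"
      by (rule eventually_at_right_real) simp
    then show "\<forall>\<^sub>F s in at_right 0. (h (u + s *\<^sub>R d) - h u) / s \<le> h v - h u - \<mu> / 2 * (1 - s) * (norm d)\<^sup>2"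
    proof eventually_elim
      fix s :: real assume s: "s \<in> {0<..<1}"
      have "h ((1 - s) *\<^sub>R u + s *\<^sub>R v) \<le> (1 - s) * h u + s * h v - \<mu> / 2 * s * (1 - s) * (norm (u - v))\<^sup>2"
        using sc s unfolding strongly_convex_def by auto
      moreover have "(1 - s) *\<^sub>R u + s *\<^sub>R v = u + s *\<^sub>R d"
        by (simp add: d_def algebra_simps)
      ultimately have "h (u + s *\<^sub>R d) - h u \<le> s * (h v - h u - \<mu> / 2 * (1 - s) * (norm d)\<^sup>2)"
        by (simp add: d_def norm_minus_commute algebra_simps)
      then show "(h (u + s *\<^sub>R d) - h u) / s \<le> h v - h u - \<mu> / 2 * (1 - s) * (norm d)\<^sup>2"
        using s by (simp add: divide_le_eq mult.commute)
    qed
  qed simp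
  then show ?thesis
    by (simp add: d_def)
qed

text \<open>The quadratic lower and upper bounds are compared at a unit vector. With step sizes
  below \<open>1 / (2 * L)\<close> this gives \<open>\<mu> * \<eta> \<le> 1 / 2\<close>.\<close>

lemma strong_convexity_le_smoothness:
  fixes h :: "'a::euclidean_space \<Rightarrow> real"
  assumes "strongly_convex \<mu> h" "smooth_with L h"
  shows "\<mu> \<le> L"
proof -
  obtain b :: 'a where b: "norm b = 1"
    using vector_choose_size[of 1] by auto
  have "h 0 + gradient h 0 \<bullet> (b - 0) + \<mu> / 2 * (norm (b - 0))\<^sup>2 \<le> h b"
    using assms by (intro strongly_convex_lower) (auto simp: smooth_with_def)
  moreover have "h b \<le> h 0 + gradient h 0 \<bullet> (b - 0) + L / 2 * (norm (b - 0))\<^sup>2"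
    using assms by (intro smooth_with_upper) auto
  ultimately show ?thesis
    by (simp add: b)
qed

text \<open>The regularizer is real-valued only on its effective domain, so the notion is relative
  to a set; \<open>m = 0\<close> is plain convexity.\<close>

definition strongly_convex_on :: "'a::euclidean_space set \<Rightarrow> real \<Rightarrow> ('a \<Rightarrow> real) \<Rightarrow> bool" where
  "strongly_convex_on S m h \<longleftrightarrow>
    (\<forall>u\<in>S. \<forall>v\<in>S. \<forall>\<theta>\<in>{0..1}. h ((1 - \<theta>) *\<^sub>R u + \<theta> *\<^sub>R v)
        \<le> (1 - \<theta>) * h u + \<theta> * h v - m / 2 * \<theta> * (1 - \<theta>) * (norm (u - v))\<^sup>2)"

text \<open>The minimizer is compared with points of the segment towards \<open>u\<close>, and the
  segment shrinks to the minimizer. This takes the place of first-order optimality conditions, so no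
  subdifferential appears.\<close>

lemma strongly_convex_on_minimizer_growth:
  assumes S: "convex S" and sc: "strongly_convex_on S m h"
    and p: "p \<in> S" "\<And>v. v \<in> S \<Longrightarrow> h p \<le> h v" and u: "u \<in> S"
  shows "h p + m / 2 * (norm (u - p))\<^sup>2 \<le> h u"
proof -
  have lim: "((\<lambda>s. h u - h p - m / 2 * (1 - s) * (norm (u - p))\<^sup>2)
      \<longlongrightarrow> h u - h p - m / 2 * (1 - 0) * (norm (u - p))\<^sup>2) (at_right 0)"
    by (intro tendsto_intros)
  have "0 \<le> h u - h p - m / 2 * (1 - 0) * (norm (u - p))\<^sup>2"
  proof (rule tendsto_lowerbound[OF lim])
    have "\<forall>\<^sub>F s in at_right 0. s \<in> {0<..<1::real}"
      by (rule eventually_at_right_real) simp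
    then show "\<forall>\<^sub>F s in at_right 0. 0 \<le> h u - h p - m / 2 * (1 - s) * (norm (u - p))\<^sup>2"
    proof eventually_elim
      fix s :: real assume s: "s \<in> {0<..<1}"
      have "h p \<le> h ((1 - s) *\<^sub>R p + s *\<^sub>R u)"
        using s u p S by (intro p convexD) auto
      also have "\<dots> \<le> (1 - s) * h p + s * h u - m / 2 * s * (1 - s) * (norm (p - u))\<^sup>2"
        using sc p u s unfolding strongly_convex_on_def by auto
      finally have "0 \<le> s * (h u - h p - m / 2 * (1 - s) * (norm (u - p))\<^sup>2)"
        by (simp add: norm_minus_commute algebra_simps)
      then show "0 \<le> h u - h p - m / 2 * (1 - s) * (norm (u - p))\<^sup>2"
        using s by (simp add: zero_le_mult_iff)
    qed
  qed simp
  then show ?thesis by simp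
qed

section \<open>Extended-valued convex functions and existence of the proximal point\<close>

definition effective_domain :: "('a \<Rightarrow> ereal) \<Rightarrow> 'a set" where
  "effective_domain h = {u. h u \<noteq> \<infinity>}"

lemma proper_closed_convexD:
  assumes "proper_closed_convex h"
  shows "\<And>u. u \<in> effective_domain h \<Longrightarrow> h u = ereal (real_of_ereal (h u))"
    and "effective_domain h \<noteq> {}" and "convex (effective_domain h)"
    and "strongly_convex_on (effective_domain h) 0 (\<lambda>u. real_of_ereal (h u))"
    and "closed {(u, s). u \<in> effective_domain h \<and> real_of_ereal (h u) \<le> s}"
proof -
  show real: "h u = ereal (real_of_ereal (h u))" if "u \<in> effective_domain h" for u
    using that assms by (cases "h u") (auto simp: proper_closed_convex_def effective_domain_def)
  show "effective_domain h \<noteq> {}"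
    using assms by (auto simp: proper_closed_convex_def effective_domain_def)
  have epi: "{(u, s). h u \<le> ereal s} = {(u, s). u \<in> effective_domain h \<and> real_of_ereal (h u) \<le> s}"
  proof -
    have "h u \<le> ereal s \<longleftrightarrow> u \<in> effective_domain h \<and> real_of_ereal (h u) \<le> s" for u s
    proof (cases "u \<in> effective_domain h")
      case True
      then show ?thesis using real[OF True] by (metis ereal_less_eq(3))
    next
      case False
      then show ?thesis by (simp add: effective_domain_def)
    qed
    then show ?thesis by auto
  qed
  then show "closed {(u, s). u \<in> effective_domain h \<and> real_of_ereal (h u) \<le> s}"
    using assms by (simp add: proper_closed_convex_def)
  have conv: "convex {(u, s). u \<in> effective_domain h \<and> real_of_ereal (h u) \<le> s}"
    using assms epi by (simp add: proper_closed_convex_def)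
  \<comment> \<open>A convex combination of two points of the graph lies in the epigraph; this gives
    convexity of the domain and of the function at once.\<close>
  have comb: "(1 - \<theta>) *\<^sub>R u + \<theta> *\<^sub>R v \<in> effective_domain h \<and> real_of_ereal (h ((1 - \<theta>) *\<^sub>R u + \<theta> *\<^sub>R v))
      \<le> (1 - \<theta>) * real_of_ereal (h u) + \<theta> * real_of_ereal (h v)"
    if "u \<in> effective_domain h" "v \<in> effective_domain h" "\<theta> \<in> {0..1}" for u v \<theta>
  proof -
    have "(1 - \<theta>) *\<^sub>R (u, real_of_ereal (h u)) + \<theta> *\<^sub>R (v, real_of_ereal (h v))
        \<in> {(u, s). u \<in> effective_domain h \<and> real_of_ereal (h u) \<le> s}"
      using that by (intro convexD[OF conv]) auto
    then show ?thesis by simp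
  qed
  show "convex (effective_domain h)"
    unfolding convex_alt using comb by auto
  show "strongly_convex_on (effective_domain h) 0 (\<lambda>u. real_of_ereal (h u))"
    unfolding strongly_convex_on_def using comb by auto
qed

lemma strongly_convex_on_add:
  assumes "strongly_convex_on S m h" "strongly_convex_on S m' h'"
  shows "strongly_convex_on S (m + m') (\<lambda>u. h u + h' u)"
  unfolding strongly_convex_on_def
proof (intro ballI)
  fix u v \<theta> assume A: "u \<in> S" "v \<in> S" "\<theta> \<in> {0..1::real}"
  let ?w = "(1 - \<theta>) *\<^sub>R u + \<theta> *\<^sub>R v"
  have "h ?w \<le> (1 - \<theta>) * h u + \<theta> * h v - m / 2 * \<theta> * (1 - \<theta>) * (norm (u - v))\<^sup>2"
    using assms(1) A unfolding strongly_convex_on_def by blast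
  moreover have "h' ?w \<le> (1 - \<theta>) * h' u + \<theta> * h' v - m' / 2 * \<theta> * (1 - \<theta>) * (norm (u - v))\<^sup>2"
    using assms(2) A unfolding strongly_convex_on_def by blast
  ultimately show "h ?w + h' ?w \<le> (1 - \<theta>) * (h u + h' u) + \<theta> * (h v + h' v)
      - (m + m') / 2 * \<theta> * (1 - \<theta>) * (norm (u - v))\<^sup>2"
    by (simp add: algebra_simps add_divide_distrib)
qed

lemma strongly_convex_imp_on: "strongly_convex m h \<Longrightarrow> strongly_convex_on S m h"
  by (simp add: strongly_convex_def strongly_convex_on_def)

text \<open>The defining inequality is an identity here, so \<open>m\<close> may have any
  sign.\<close>

lemma strongly_convex_norm_square:
  fixes v :: "'a::euclidean_space"
  shows "strongly_convex m (\<lambda>u. m / 2 * (norm (u - v))\<^sup>2)"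
proof -
  have "(norm ((1 - \<theta>) *\<^sub>R u + \<theta> *\<^sub>R w - v))\<^sup>2
     = (1 - \<theta>) * (norm (u - v))\<^sup>2 + \<theta> * (norm (w - v))\<^sup>2 - \<theta> * (1 - \<theta>) * (norm (u - w))\<^sup>2"
    for u w :: 'a and \<theta> :: real
  proof -
    define a where "a = u - v"
    define b where "b = w - v"
    have e: "(1 - \<theta>) *\<^sub>R u + \<theta> *\<^sub>R w - v = (1 - \<theta>) *\<^sub>R a + \<theta> *\<^sub>R b" "u - w = a - b"
      by (simp_all add: a_def b_def algebra_simps)
    have "b \<bullet> a = a \<bullet> b" by (rule inner_commute)
    then show ?thesis
      unfolding e a_def[symmetric] b_def[symmetric] power2_norm_eq_inner
      by (simp add: inner_diff_left inner_diff_right inner_add_left inner_add_right algebra_simps)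
  qed
  note identity = this
  have "m / 2 * (norm ((1 - \<theta>) *\<^sub>R u + \<theta> *\<^sub>R w - v))\<^sup>2 =
      (1 - \<theta>) * (m / 2 * (norm (u - v))\<^sup>2) + \<theta> * (m / 2 * (norm (w - v))\<^sup>2)
        - m / 2 * \<theta> * (1 - \<theta>) * (norm (u - w))\<^sup>2" for u w :: 'a and \<theta> :: real
    unfolding identity by (simp add: field_simps)
  note identity_scaled = this
  show ?thesis
    unfolding strongly_convex_def by (intro allI ballI eq_refl) (rule identity_scaled)
qed

text \<open>Optimality of \<open>p\<close> makes the negative gradient of the smooth part a
  subgradient of \<rho>: along the segment to \<open>u\<close> the smoothness error is quadratic in
  the parameter and disappears in the limit. The minorant supplies the coercivity behind the
  existence of proximal points.\<close>

lemma convex_affine_minorant: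
  assumes S: "convex S" and cv: "strongly_convex_on S 0 \<rho>"
    and sm: "smooth_with L h" and p: "p \<in> S" "\<And>v. v \<in> S \<Longrightarrow> h p + \<rho> p \<le> h v + \<rho> v"
    and u: "u \<in> S"
  shows "\<rho> p - gradient h p \<bullet> (u - p) \<le> \<rho> u"
proof -
  let ?R = "\<lambda>s. \<rho> u - \<rho> p + gradient h p \<bullet> (u - p) + L / 2 * s * (norm (u - p))\<^sup>2"
  have lim: "(?R \<longlongrightarrow> \<rho> u - \<rho> p + gradient h p \<bullet> (u - p) + L / 2 * 0 * (norm (u - p))\<^sup>2) (at_right 0)"
    by (intro tendsto_intros)
  have "0 \<le> \<rho> u - \<rho> p + gradient h p \<bullet> (u - p) + L / 2 * 0 * (norm (u - p))\<^sup>2"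
  proof (rule tendsto_lowerbound[OF lim])
    have "\<forall>\<^sub>F s in at_right 0. s \<in> {0<..<1::real}"
      by (rule eventually_at_right_real) simp
    then show "\<forall>\<^sub>F s in at_right 0. 0 \<le> ?R s"
    proof eventually_elim
      fix s :: real assume s: "s \<in> {0<..<1}"
      let ?v = "(1 - s) *\<^sub>R p + s *\<^sub>R u"
      have v: "?v - p = s *\<^sub>R (u - p)" by (simp add: algebra_simps)
      have "h p + \<rho> p \<le> h ?v + \<rho> ?v"
        using s u p S by (intro p convexD) auto
      also have "h ?v \<le> h p + gradient h p \<bullet> (?v - p) + L / 2 * (norm (?v - p))\<^sup>2"
        by (rule smooth_with_upper[OF sm])
      also have "\<rho> ?v \<le> (1 - s) * \<rho> p + s * \<rho> u"
        using cv p u s unfolding strongly_convex_on_def by force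
      finally have "0 \<le> s * ?R s"
        unfolding v norm_scaleR inner_scaleR_right power_mult_distrib power2_abs power2_eq_square[of s]
        by (simp add: algebra_simps)
      then show "0 \<le> ?R s"
        using s by (simp add: zero_le_mult_iff)
    qed
  qed simp
  then show ?thesis by simp
qed

text \<open>The affine minorant bounds sublevel sets, and compactness yields a minimizer; the last
  summand on the left is quadratic growth with modulus \<open>1 / \<eta>\<close>.\<close>

lemma prox_minimizer:
  fixes h :: "'a::euclidean_space \<Rightarrow> ereal"
  assumes h: "proper_closed_convex h" and \<eta>: "0 < \<eta>"
    and minorant: "\<And>u. u \<in> effective_domain h \<Longrightarrow> \<alpha> + a \<bullet> u \<le> real_of_ereal (h u)"
  shows "prox \<eta> h v \<in> effective_domain h"
    and "\<And>u. u \<in> effective_domain h \<Longrightarrow> real_of_ereal (h (prox \<eta> h v)) + 1 / (2 * \<eta>) * (norm (prox \<eta> h v - v))\<^sup>2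
          + 1 / (2 * \<eta>) * (norm (u - prox \<eta> h v))\<^sup>2
        \<le> real_of_ereal (h u) + 1 / (2 * \<eta>) * (norm (u - v))\<^sup>2"
proof -
  let ?\<rho> = "\<lambda>u. real_of_ereal (h u)"
  let ?q = "\<lambda>u. 1 / (2 * \<eta>) * (norm (u - v))\<^sup>2"
  obtain u0 where u0: "u0 \<in> effective_domain h"
    using proper_closed_convexD(2)[OF h] by auto
  define c where "c = ?\<rho> u0 + ?q u0"
  \<comment> \<open>The minimization runs over a piece of the epigraph, because \<open>h\<close> is
    merely lower semicontinuous: there the objective \<open>s + ?q u\<close> is continuous and
    closedness of the epigraph does the rest.\<close>
  define E where "E = {(u, s). u \<in> effective_domain h \<and> ?\<rho> u \<le> s} \<inter> {(u, s). s + ?q u \<le> c}"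
  have "closed {(u, s). s + ?q u \<le> c}"
    unfolding case_prod_unfold by (intro closed_Collect_le continuous_intros)
  then have "closed E"
    unfolding E_def using proper_closed_convexD(5)[OF h] by auto
  moreover have "bounded E"
  proof -
    define R where "R = sqrt (4 * \<eta> * (c - \<alpha> - a \<bullet> v + \<eta> * (norm a)\<^sup>2))"
    have "norm (u - v) \<le> R \<and> \<bar>s\<bar> \<le> \<bar>c\<bar> + \<bar>\<alpha>\<bar> + norm a * (norm v + R)" if "(u, s) \<in> E" for u s
    proof -
      from that have us: "u \<in> effective_domain h" "?\<rho> u \<le> s" "s + ?q u \<le> c" by (auto simp: E_def)
      have s: "\<alpha> + a \<bullet> u \<le> s" using minorant[OF us(1)] us(2) by linarith
      have "- (norm a * norm (u - v)) \<le> a \<bullet> (u - v)"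
        using Cauchy_Schwarz_ineq2[of a "u - v"] by linarith
      then have 1: "\<alpha> + a \<bullet> v - norm a * norm (u - v) + ?q u \<le> c"
        using us s by (simp add: inner_diff_right)
      \<comment> \<open>Completing the square spends half of the proximal quadratic on the linear
        minorant; the other half bounds \<open>norm (u - v)\<close>.\<close>
      have "0 \<le> (norm (u - v) - 2 * \<eta> * norm a)\<^sup>2" by simp
      then have 2: "norm a * norm (u - v) \<le> (norm (u - v))\<^sup>2 / (4 * \<eta>) + \<eta> * (norm a)\<^sup>2"
        using \<eta> by (simp add: power2_diff power_mult_distrib field_simps power2_eq_square[of \<eta>])
      have "?q u = (norm (u - v))\<^sup>2 / (4 * \<eta>) + (norm (u - v))\<^sup>2 / (4 * \<eta>)" by simp
      then have "(norm (u - v))\<^sup>2 / (4 * \<eta>) \<le> c - \<alpha> - a \<bullet> v + \<eta> * (norm a)\<^sup>2"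
        using 1 2 by linarith
      then have "(norm (u - v))\<^sup>2 \<le> 4 * \<eta> * (c - \<alpha> - a \<bullet> v + \<eta> * (norm a)\<^sup>2)"
        using \<eta> by (simp add: field_simps)
      then have R: "norm (u - v) \<le> R"
        unfolding R_def by (rule real_le_rsqrt)
      have "norm u \<le> norm v + R"
        using R norm_triangle_ineq[of v "u - v"] by simp
      then have "\<bar>a \<bullet> u\<bar> \<le> norm a * (norm v + R)"
        using Cauchy_Schwarz_ineq2[of a u] mult_left_mono[of "norm u" "norm v + R" "norm a"] by simp
      moreover have "0 \<le> ?q u" using \<eta> by simp
      ultimately have "\<bar>s\<bar> \<le> \<bar>c\<bar> + \<bar>\<alpha>\<bar> + norm a * (norm v + R)"
        using us(3) s by linarith
      then show ?thesis using R by simp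
    qed
    note bounds = this
    have "E \<subseteq> cball v R \<times> {- (\<bar>c\<bar> + \<bar>\<alpha>\<bar> + norm a * (norm v + R))..\<bar>c\<bar> + \<bar>\<alpha>\<bar> + norm a * (norm v + R)}"
    proof
      fix y assume "y \<in> E"
      then have "norm (fst y - v) \<le> R \<and> \<bar>snd y\<bar> \<le> \<bar>c\<bar> + \<bar>\<alpha>\<bar> + norm a * (norm v + R)"
        by (intro bounds) simp
      then show "y \<in> cball v R \<times> {- (\<bar>c\<bar> + \<bar>\<alpha>\<bar> + norm a * (norm v + R))..\<bar>c\<bar> + \<bar>\<alpha>\<bar> + norm a * (norm v + R)}"
        by (cases y) (simp only: fst_conv snd_conv mem_Times_iff mem_cball dist_norm norm_minus_commute
          atLeastAtMost_iff abs_le_iff minus_le_iff)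
    qed
    then show ?thesis
      by (rule bounded_subset[rotated]) (intro bounded_Times bounded_cball bounded_closed_interval)
  qed
  ultimately have "compact E" by (simp add: compact_eq_bounded_closed)
  moreover have "(u0, ?\<rho> u0) \<in> E" using u0 by (simp add: E_def c_def)
  ultimately obtain p s where ps: "(p, s) \<in> E" "\<And>u s'. (u, s') \<in> E \<Longrightarrow> s + ?q p \<le> s' + ?q u"
  proof -
    have "\<exists>y\<in>E. \<forall>z\<in>E. snd y + ?q (fst y) \<le> snd z + ?q (fst z)"
      using \<open>compact E\<close> \<open>(u0, ?\<rho> u0) \<in> E\<close>
      by (intro continuous_attains_inf continuous_intros) auto
    then obtain y where "y \<in> E" "\<And>z. z \<in> E \<Longrightarrow> snd y + ?q (fst y) \<le> snd z + ?q (fst z)"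
      by blast
    then show ?thesis
      using that[of "fst y" "snd y"] by (metis fst_conv snd_conv prod.collapse)
  qed
  have pd: "p \<in> effective_domain h" and ps2: "?\<rho> p \<le> s" using ps(1) by (auto simp: E_def)
  have pmin: "?\<rho> p + ?q p \<le> ?\<rho> u + ?q u" if "u \<in> effective_domain h" for u
  proof (cases "?\<rho> u + ?q u \<le> c")
    case True
    then have "(u, ?\<rho> u) \<in> E" using that by (simp add: E_def)
    then show ?thesis using ps(2)[of u "?\<rho> u"] ps2 by linarith
  next
    case False
    then show ?thesis using ps(1) ps2 by (auto simp: E_def)
  qed
  have val: "h u + ereal (?q u) = ereal (?\<rho> u + ?q u)" if "u \<in> effective_domain h" for u
    using proper_closed_convexD(1)[OF h that] by (metis plus_ereal.simps(1))
  have "is_arg_min (\<lambda>u. h u + ereal (?q u)) (\<lambda>_. True) p"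
    unfolding is_arg_min_linorder
  proof (intro conjI allI impI TrueI)
    fix u
    show "h p + ereal (?q p) \<le> h u + ereal (?q u)"
    proof (cases "u \<in> effective_domain h")
      case True
      then show ?thesis using pmin[OF True] by (simp only: val[OF True] val[OF pd] ereal_less_eq)
    next
      case False
      then show ?thesis by (simp add: effective_domain_def)
    qed
  qed
  \<comment> \<open>\<open>arg_min\<close> chooses some minimizer if there is one, so existence
    suffices for \<open>prox\<close> to be a minimizer.\<close>
  then have "is_arg_min (\<lambda>u. h u + ereal (?q u)) (\<lambda>_. True) (prox \<eta> h v)"
    unfolding prox_def arg_min_def by (rule someI)
  then have pr: "h (prox \<eta> h v) + ereal (?q (prox \<eta> h v)) \<le> h u + ereal (?q u)" for u
    by (auto simp: is_arg_min_linorder)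
  show pdom: "prox \<eta> h v \<in> effective_domain h"
    using pr[of p] unfolding val[OF pd] by (auto simp: effective_domain_def)
  have "?\<rho> (prox \<eta> h v) + ?q (prox \<eta> h v) \<le> ?\<rho> u + ?q u" if "u \<in> effective_domain h" for u
    using pr[of u] unfolding val[OF that] val[OF pdom] by simp
  moreover have "strongly_convex_on (effective_domain h) (0 + 1 / \<eta>) (\<lambda>u. ?\<rho> u + (1 / \<eta>) / 2 * (norm (u - v))\<^sup>2)"
    by (intro strongly_convex_on_add proper_closed_convexD(4)[OF h]
        strongly_convex_imp_on strongly_convex_norm_square)
  then have "strongly_convex_on (effective_domain h) (1 / \<eta>) (\<lambda>u. ?\<rho> u + ?q u)"
    by (simp add: mult.commute)
  ultimately have "?\<rho> (prox \<eta> h v) + ?q (prox \<eta> h v) + (1 / \<eta>) / 2 * (norm (u - prox \<eta> h v))\<^sup>2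
        \<le> ?\<rho> u + ?q u" if "u \<in> effective_domain h" for u
    using that pdom by (intro strongly_convex_on_minimizer_growth[OF proper_closed_convexD(3)[OF h]]) auto
  then show "?\<rho> (prox \<eta> h v) + ?q (prox \<eta> h v) + 1 / (2 * \<eta>) * (norm (u - prox \<eta> h v))\<^sup>2
        \<le> ?\<rho> u + ?q u" if "u \<in> effective_domain h" for u
    using that by (simp add: mult.commute)
qed

text \<open>The optimality inequality of the proximal point is added to the smoothness bound between
  \<open>x\<close> and \<open>p\<close> and the strong convexity bound between \<open>x\<close> and
  \<open>xb\<close>. Young's inequality then handles the noise correlated with the step and the
  gradient bias \<open>b\<close>.\<close>

lemma prox_gradient_step:
  fixes \<phi> \<rho> :: "'a::euclidean_space \<Rightarrow> real"
  assumes sc: "strongly_convex \<mu> \<phi>" and sm: "smooth_with L \<phi>"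
    and xb: "xb \<in> S"
    and p: "\<And>u. u \<in> S \<Longrightarrow> \<rho> p + 1 / (2 * \<eta>) * (norm (p - (x - \<eta> *\<^sub>R g)))\<^sup>2
          + 1 / (2 * \<eta>) * (norm (u - p))\<^sup>2 \<le> \<rho> u + 1 / (2 * \<eta>) * (norm (u - (x - \<eta> *\<^sub>R g)))\<^sup>2"
    and g: "g = gradient \<phi> x + b - z" "norm b \<le> G + \<gamma> * norm (x - xb)"
    and \<eta>: "0 < \<eta>" "\<eta> \<le> 1 / (2 * L)" and L: "0 < L"
    and \<gamma>: "0 \<le> \<gamma>" and mh: "0 < mh" "mh = \<mu> - 2 * \<gamma>" and w: "w = mh * \<eta> / (2 - \<mu> * \<eta>)"
    and small: "\<mu> * \<eta> < 2" and G: "0 \<le> G"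
  shows "(\<phi> p + \<rho> p) - (\<phi> xb + \<rho> xb)
    \<le> z \<bullet> (x - xb) + \<eta> * (norm z)\<^sup>2 + G\<^sup>2 / mh
      + (2 - \<mu> * \<eta>) / (4 * \<eta>) * ((1 - w) * (norm (x - xb))\<^sup>2 - (norm (p - xb))\<^sup>2)"
proof -
  let ?P = "p - x" and ?V = "x - xb" and ?Q = "p - xb"
  have prox: "\<rho> p + g \<bullet> ?Q + 1 / (2 * \<eta>) * ((norm ?P)\<^sup>2 + (norm ?Q)\<^sup>2 - (norm ?V)\<^sup>2) \<le> \<rho> xb"
  proof -
    have e: "(norm (u - (x - \<eta> *\<^sub>R g)))\<^sup>2 = (norm (u - x))\<^sup>2 + 2 * \<eta> * (g \<bullet> (u - x)) + \<eta>\<^sup>2 * (norm g)\<^sup>2" for u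
    proof -
      define d where "d = u - x"
      have "u - (x - \<eta> *\<^sub>R g) = d + \<eta> *\<^sub>R g" by (simp add: d_def)
      then show ?thesis
        unfolding d_def[symmetric] by (simp only: power2_norm_eq_inner)
           (simp add: inner_add_left inner_add_right inner_commute[of d g] power2_eq_square algebra_simps)
    qed
    have d: "1 / (2 * \<eta>) * (norm (u - (x - \<eta> *\<^sub>R g)))\<^sup>2
      = 1 / (2 * \<eta>) * (norm (u - x))\<^sup>2 + g \<bullet> (u - x) + 1 / (2 * \<eta>) * (\<eta>\<^sup>2 * (norm g)\<^sup>2)" for u
      unfolding e using \<eta> by (simp add: field_simps)
    have "g \<bullet> ?Q = g \<bullet> (p - x) - g \<bullet> (xb - x)"
      by (simp add: inner_diff_right)
    then show ?thesis
      using p[OF xb] unfolding d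
      by (simp add: norm_minus_commute[of xb] right_diff_distrib distrib_left)
  qed
  have up: "\<phi> p \<le> \<phi> x + gradient \<phi> x \<bullet> ?P + L / 2 * (norm ?P)\<^sup>2"
    by (rule smooth_with_upper[OF sm])
  have lo: "\<phi> x + gradient \<phi> x \<bullet> (xb - x) + \<mu> / 2 * (norm (xb - x))\<^sup>2 \<le> \<phi> xb"
    by (rule strongly_convex_lower[OF sc]) (use sm in \<open>auto simp: smooth_with_def\<close>)
  \<comment> \<open>The noise is paired with \<open>x - xb\<close>, which is known before the noise
    is drawn, and with the step \<open>p - x\<close>, which is not; only the latter is estimated by
    \<open>zP\<close>.\<close>
  have gq: "gradient \<phi> x \<bullet> ?P - gradient \<phi> x \<bullet> (xb - x) - g \<bullet> ?Q = z \<bullet> ?V + z \<bullet> ?P - b \<bullet> ?Q"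
    by (simp add: g inner_diff_right inner_add_left inner_diff_left)
  have zP: "z \<bullet> ?P \<le> \<eta> * (norm z)\<^sup>2 + 1 / (4 * \<eta>) * (norm ?P)\<^sup>2"
  proof -
    have "z \<bullet> ?P \<le> norm z * norm ?P" by (rule norm_cauchy_schwarz)
    moreover have "0 \<le> (2 * \<eta> * norm z - norm ?P)\<^sup>2 / (4 * \<eta>)" using \<eta> by simp
    moreover have "(2 * \<eta> * norm z - norm ?P)\<^sup>2 / (4 * \<eta>)
        = \<eta> * (norm z)\<^sup>2 - norm z * norm ?P + 1 / (4 * \<eta>) * (norm ?P)\<^sup>2"
      using \<eta> by (simp add: power2_diff power_mult_distrib field_simps power2_eq_square[of \<eta>])
    ultimately show ?thesis by linarith
  qed
  have bQ: "- (b \<bullet> ?Q) \<le> G\<^sup>2 / mh + mh / 4 * (norm ?Q)\<^sup>2 + \<gamma> / 2 * (norm ?V)\<^sup>2 + \<gamma> / 2 * (norm ?Q)\<^sup>2"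
  proof -
    have "- (b \<bullet> ?Q) \<le> norm b * norm ?Q"
      using Cauchy_Schwarz_ineq2[of b ?Q] by linarith
    also have "\<dots> \<le> (G + \<gamma> * norm ?V) * norm ?Q"
      by (rule mult_right_mono[OF g(2)]) simp
    also have "\<dots> = G * norm ?Q + \<gamma> * (norm ?V * norm ?Q)" by (simp add: algebra_simps)
    also have "\<gamma> * (norm ?V * norm ?Q) \<le> \<gamma> * (1 / 2 * (norm ?V)\<^sup>2 + 1 / 2 * (norm ?Q)\<^sup>2)"
      using sum_squares_bound[of "norm ?V" "norm ?Q"] by (intro mult_left_mono \<gamma>) simp
    also have "G * norm ?Q \<le> G\<^sup>2 / mh + mh / 4 * (norm ?Q)\<^sup>2"
    proof -
      have "0 \<le> (2 * G - mh * norm ?Q)\<^sup>2 / (4 * mh)" using mh by simp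
      moreover have "(2 * G - mh * norm ?Q)\<^sup>2 / (4 * mh) = G\<^sup>2 / mh - G * norm ?Q + mh / 4 * (norm ?Q)\<^sup>2"
        using mh(1) by (simp add: power2_diff power_mult_distrib field_simps power2_eq_square[of mh])
      ultimately show ?thesis by linarith
    qed
    finally show ?thesis by (simp add: distrib_left)
  qed
  \<comment> \<open>All squared step lengths cancel here; this is where
    \<open>\<eta> \<le> 1 / (2 * L)\<close> enters.\<close>
  have PL: "(L / 2 + 1 / (4 * \<eta>) - 1 / (2 * \<eta>)) * (norm ?P)\<^sup>2 \<le> 0"
  proof (rule mult_nonpos_nonneg)
    show "L / 2 + 1 / (4 * \<eta>) - 1 / (2 * \<eta>) \<le> 0" using \<eta> L by (simp add: field_simps)
  qed simp
  \<comment> \<open>The origin of the averaging weight: the coefficients of the squared distances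
    before and after the step have ratio exactly \<open>1 - w\<close>.\<close>
  have coeff: "(2 - \<mu> * \<eta>) / (4 * \<eta>) * ((1 - w) * (norm ?V)\<^sup>2 - (norm ?Q)\<^sup>2)
    = (1 / (2 * \<eta>) - \<mu> / 2 + \<gamma> / 2) * (norm ?V)\<^sup>2 - (1 / (2 * \<eta>) - mh / 4 - \<gamma> / 2) * (norm ?Q)\<^sup>2"
  proof -
    have "(2 - \<mu> * \<eta>) * (1 - w) = 2 - \<mu> * \<eta> - mh * \<eta>"
      using small by (simp add: w field_simps)
    then have "(2 - \<mu> * \<eta>) / (4 * \<eta>) * (1 - w) = (2 - \<mu> * \<eta> - mh * \<eta>) / (4 * \<eta>)"
      by (simp only: times_divide_eq_left)
    also have "\<dots> = 1 / (2 * \<eta>) - \<mu> / 2 + \<gamma> / 2"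
      using \<eta> by (simp add: mh(2) field_simps)
    finally have "(2 - \<mu> * \<eta>) / (4 * \<eta>) * (1 - w) = 1 / (2 * \<eta>) - \<mu> / 2 + \<gamma> / 2" .
    moreover have "(2 - \<mu> * \<eta>) / (4 * \<eta>) = 1 / (2 * \<eta>) - mh / 4 - \<gamma> / 2"
      using \<eta> by (simp add: mh(2) field_simps)
    ultimately show ?thesis by (simp add: right_diff_distrib mult.assoc[symmetric])
  qed
  show ?thesis
    unfolding coeff
    using prox up lo gq zP bQ PL
    by (simp add: norm_minus_commute[of xb] distrib_right left_diff_distrib right_diff_distrib distrib_left)
qed

text \<open>Since \<open>w * (2 - \<mu> * \<eta>) / (4 * \<eta>) = mh / 4\<close>, the distance
  terms contract by \<open>1 - w\<close>, the same factor that convexity gives for the gap of the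
  average.\<close>

lemma prox_gradient_potential:
  fixes \<phi> \<rho> :: "'a::euclidean_space \<Rightarrow> real"
  assumes step: "(\<phi> p + \<rho> p) - (\<phi> xb + \<rho> xb) \<le> e + (2 - \<mu> * \<eta>) / (4 * \<eta>) * ((1 - w) * (norm (x - xb))\<^sup>2 - (norm (p - xb))\<^sup>2)"
    and S: "p \<in> S" "y \<in> S" and conv: "strongly_convex_on S 0 (\<lambda>u. \<phi> u + \<rho> u)"
    and \<eta>: "0 < \<eta>" and w: "w = mh * \<eta> / (2 - \<mu> * \<eta>)" "0 \<le> w" "w \<le> 1"
    and small: "\<mu> * \<eta> < 2"
  defines "y' \<equiv> (1 - w) *\<^sub>R y + w *\<^sub>R p"
  shows "(\<phi> y' + \<rho> y') - (\<phi> xb + \<rho> xb) + mh / 4 * (norm (p - xb))\<^sup>2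
    \<le> (1 - w) * ((\<phi> y + \<rho> y) - (\<phi> xb + \<rho> xb) + mh / 4 * (norm (x - xb))\<^sup>2) + w * e"
proof -
  have "\<phi> y' + \<rho> y' \<le> (1 - w) * (\<phi> y + \<rho> y) + w * (\<phi> p + \<rho> p)"
    using conv S w unfolding strongly_convex_on_def y'_def by force
  moreover have "w * ((\<phi> p + \<rho> p) - (\<phi> xb + \<rho> xb))
      \<le> w * e + mh / 4 * ((1 - w) * (norm (x - xb))\<^sup>2 - (norm (p - xb))\<^sup>2)"
  proof -
    have "w * ((\<phi> p + \<rho> p) - (\<phi> xb + \<rho> xb))
      \<le> w * (e + (2 - \<mu> * \<eta>) / (4 * \<eta>) * ((1 - w) * (norm (x - xb))\<^sup>2 - (norm (p - xb))\<^sup>2))"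
    using step w(2) by (rule mult_left_mono)
    also have "w * ((2 - \<mu> * \<eta>) / (4 * \<eta>)) = mh / 4"
      using small \<eta> by (simp add: w(1) field_simps)
    then have "w * (e + (2 - \<mu> * \<eta>) / (4 * \<eta>) * ((1 - w) * (norm (x - xb))\<^sup>2 - (norm (p - xb))\<^sup>2))
        = w * e + mh / 4 * ((1 - w) * (norm (x - xb))\<^sup>2 - (norm (p - xb))\<^sup>2)"
      by (simp only: distrib_left mult.assoc[symmetric])
    finally show ?thesis .
  qed
  ultimately show ?thesis
    by (simp add: algebra_simps diff_divide_distrib)
qed

text \<open>The difference of the two losses is \<open>B\<close>-Lipschitz with
  \<open>B = G + \<gamma> * norm (p' - p)\<close>. Quadratic growth at both minimizers controls
  their distance, hence \<open>B \<le> 2 * G\<close>. The lemma carries the initial gap from time 0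
  to the final time.\<close>

lemma gap_change_of_time:
  fixes \<phi> \<phi>' \<rho> :: "'a::euclidean_space \<Rightarrow> real"
  assumes S: "convex S" and sc: "strongly_convex \<mu> \<phi>" "strongly_convex \<mu> \<phi>'"
    and sm: "smooth_with L \<phi>" "smooth_with L \<phi>'" and cv: "strongly_convex_on S 0 \<rho>"
    and p: "p \<in> S" "\<And>u. u \<in> S \<Longrightarrow> \<phi> p + \<rho> p \<le> \<phi> u + \<rho> u"
    and p': "p' \<in> S" "\<And>u. u \<in> S \<Longrightarrow> \<phi>' p' + \<rho> p' \<le> \<phi>' u + \<rho> u"
    and G: "0 \<le> G" "\<And>u. norm (gradient \<phi>' u - gradient \<phi> u) \<le> G + \<gamma> * norm (p' - p)"
    and \<gamma>: "0 \<le> \<gamma>" "2 * \<gamma> < \<mu>" and x: "x \<in> S"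
  shows "(\<phi>' x + \<rho> x) - (\<phi>' p' + \<rho> p') \<le> 2 * ((\<phi> x + \<rho> x) - (\<phi> p + \<rho> p)) + 6 * G\<^sup>2 / \<mu>"
proof -
  define d where "d = norm (p' - p)"
  define B where "B = G + \<gamma> * d"
  have \<mu>: "0 < \<mu>" using \<gamma> by simp
  have d0: "0 \<le> d" by (simp add: d_def)
  have lipdiff: "(\<phi>' u - \<phi> u) - (\<phi>' v - \<phi> v) \<le> B * norm (u - v)" for u v
  proof -
    let ?h = "\<lambda>u. \<phi>' u - \<phi> u"
    have der: "(?h has_derivative (\<lambda>k. k \<bullet> (gradient \<phi>' w - gradient \<phi> w))) (at w within UNIV)" for w
      using GDERIV_diff[OF gderiv_gradient gderiv_gradient, of \<phi>' w \<phi>] sm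
      unfolding gderiv_def smooth_with_def by auto
    have "norm (?h u - ?h v) \<le> B * norm (u - v)"
    proof (rule differentiable_bound[OF convex_UNIV der])
      fix w
      show "onorm (\<lambda>k. k \<bullet> (gradient \<phi>' w - gradient \<phi> w)) \<le> B"
      proof (rule onorm_le)
        fix k
        have "norm (k \<bullet> (gradient \<phi>' w - gradient \<phi> w)) \<le> norm k * norm (gradient \<phi>' w - gradient \<phi> w)"
          by (rule Cauchy_Schwarz_ineq2[folded real_norm_def])
        also have "\<dots> \<le> norm k * B"
          using G(2)[of w] by (intro mult_left_mono) (auto simp: B_def d_def)
        finally show "norm (k \<bullet> (gradient \<phi>' w - gradient \<phi> w)) \<le> B * norm k"
          by (simp add: mult.commute)
      qed
    qed auto
    then show ?thesis by (simp add: abs_le_iff)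
  qed
  have grow: "\<phi> p + \<rho> p + \<mu> / 2 * (norm (u - p))\<^sup>2 \<le> \<phi> u + \<rho> u" if "u \<in> S" for u
    using strongly_convex_on_minimizer_growth[OF S strongly_convex_on_add[OF strongly_convex_imp_on[OF sc(1)] cv]]
      p that by simp
  have grow': "\<phi>' p' + \<rho> p' + \<mu> / 2 * (norm (u - p'))\<^sup>2 \<le> \<phi>' u + \<rho> u" if "u \<in> S" for u
    using strongly_convex_on_minimizer_growth[OF S strongly_convex_on_add[OF strongly_convex_imp_on[OF sc(2)] cv]]
      p' that by simp
  \<comment> \<open>The two growth inequalities are added, each evaluated at the other minimizer.
    Because \<open>B\<close> contains \<open>\<gamma> * d\<close>, solving for \<open>d\<close> uses
    \<open>2 * \<gamma> < \<mu>\<close>.\<close>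
  have "\<mu> * d\<^sup>2 \<le> B * d"
    using grow[OF p'(1)] grow'[OF p(1)] lipdiff[of p p']
    by (simp add: d_def norm_minus_commute[of p])
  then have "\<mu> * d \<le> B"
    using G(1) \<gamma>(1) d0 by (cases "d = 0") (auto simp: B_def power2_eq_square)
  then have "(\<mu> - \<gamma>) * d \<le> G" by (simp add: B_def algebra_simps)
  moreover have "\<mu> / 2 * d \<le> (\<mu> - \<gamma>) * d" using d0 \<gamma> by (intro mult_right_mono) auto
  ultimately have d: "\<mu> * d \<le> 2 * G" by simp
  have "2 * \<gamma> * d \<le> \<mu> * d" using \<gamma> d0 by (intro mult_right_mono) auto
  then have B: "B \<le> 2 * G" "0 \<le> B" using d G \<gamma> d0 by (auto simp: B_def)
  define e where "e = norm (x - p)"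
  define g where "g = (\<phi> x + \<rho> x) - (\<phi> p + \<rho> p)"
  have e0: "0 \<le> e" by (simp add: e_def)
  have ge: "\<mu> / 2 * e\<^sup>2 \<le> g" using grow[OF x] by (simp add: g_def e_def)
  have "(\<phi>' x + \<rho> x) - (\<phi>' p' + \<rho> p') \<le> g + B * norm (x - p')"
    using lipdiff[of x p'] p(2)[OF p'(1)] by (simp add: g_def)
  also have "B * norm (x - p') \<le> (2 * G) * (e + d)"
  proof (rule mult_mono)
    show "norm (x - p') \<le> e + d"
      using norm_triangle_ineq[of "x - p" "p - p'"] by (simp add: e_def d_def norm_minus_commute)
  qed (use B G in auto)
  also have "(2 * G) * (e + d) \<le> g + 6 * G\<^sup>2 / \<mu>"
  proof -
    have "0 \<le> (2 * G - \<mu> * e)\<^sup>2 / (2 * \<mu>)" using \<mu> by simp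
    moreover have "(2 * G - \<mu> * e)\<^sup>2 / (2 * \<mu>) = 2 * G\<^sup>2 / \<mu> - 2 * G * e + \<mu> / 2 * e\<^sup>2"
      using \<mu> by (simp add: power2_diff power_mult_distrib field_simps power2_eq_square[of \<mu>])
    moreover have "2 * G * d \<le> 4 * G\<^sup>2 / \<mu>"
      using mult_left_mono[OF d, of "2 * G"] G \<mu> by (simp add: field_simps power2_eq_square)
    moreover have "6 * G\<^sup>2 / \<mu> = 2 * G\<^sup>2 / \<mu> + 4 * G\<^sup>2 / \<mu>" by (simp add: add_divide_distrib[symmetric])
    ultimately show ?thesis using ge unfolding distrib_left by linarith
  qed
  finally show ?thesis by (simp add: g_def)
qed

section \<open>Conditional exponential moments of the noise\<close>

text \<open>The linear term carries coefficient one and no constant, so it drops out in expectation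
  for mean zero variables and only the square remains.\<close>

lemma exp_le_add_exp_square: "exp x \<le> x + exp (x\<^sup>2)" for x :: real
proof -
  define h where "h y = y + exp (y\<^sup>2) - exp y" for y :: real
  have A: "0 \<le> h y" if "0 \<le> y" "y \<le> 1" for y
  proof -
    have 1: "exp y \<le> 1 + y + y\<^sup>2" using that by (rule exp_bound)
    have 2: "1 + y\<^sup>2 \<le> exp (y\<^sup>2)" by (rule exp_ge_add_one_self)
    show ?thesis using 1 2 unfolding h_def by linarith
  qed
  have B: "0 \<le> h y" if "1 \<le> y" for y
  proof -
    have "y * 1 \<le> y * y" using that by (intro mult_left_mono) auto
    then have "exp y \<le> exp (y\<^sup>2)" unfolding exp_le_cancel_iff by (simp add: power2_eq_square)
    then show ?thesis using that unfolding h_def by linarith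
  qed
  have C: "0 \<le> h (- y)" if "0 \<le> y" for y
  proof -
    show ?thesis
    proof (cases "y \<le> 1")
      case True
      \<comment> \<open>The right-hand product is \<open>1 + y ^ 3\<close>, so this proves the
        second-order bound \<open>exp (- y) \<le> 1 - y + y\<^sup>2\<close>.\<close>
      have "exp y * (1 - y + y\<^sup>2) \<ge> (1 + y) * (1 - y + y\<^sup>2)"
        using True exp_ge_add_one_self[of y] by (intro mult_right_mono) auto
      moreover have "(1 + y) * (1 - y + y\<^sup>2) = 1 + y ^ 3"
        by (simp add: power2_eq_square power3_eq_cube algebra_simps)
      ultimately have "1 \<le> exp y * (1 - y + y\<^sup>2)"
        using zero_le_power[OF that, of 3] by linarith
      then have "exp (- y) \<le> 1 - y + y\<^sup>2"
        by (simp add: exp_minus inverse_eq_divide divide_le_eq mult.commute)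
      then show ?thesis using exp_ge_add_one_self[of "y\<^sup>2"] unfolding h_def power2_minus by linarith
    next
      case False
      then have "y * 1 \<le> y * y" by (intro mult_left_mono) auto
      then have "y \<le> y\<^sup>2" by (simp add: power2_eq_square)
      moreover have "exp (- y) \<le> 1" using that by simp
      ultimately show ?thesis using exp_ge_add_one_self[of "y\<^sup>2"] unfolding h_def power2_minus by linarith
    qed
  qed
  have "0 \<le> h x"
    using A[of x] B[of x] C[of "- x"] unfolding minus_minus by linarith
  then show ?thesis by (simp add: h_def)
qed

lemma exp_mult_le_interpolate:
  fixes l z :: real
  assumes "0 \<le> l" "l \<le> 1"
  shows "exp (l * z) \<le> 1 - l + l * exp z"
proof -
  have "exp ((1 - l) *\<^sub>R 0 + l *\<^sub>R z) \<le> (1 - l) * exp 0 + l * exp z"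
    using exp_convex assms by (intro convex_onD[where A = UNIV]) auto
  then show ?thesis by simp
qed

text \<open>With \<open>s = a * norm v * \<sigma>\<close>, \<open>\<beta> = b * \<sigma>\<^sup>2\<close> and \<open>Z = norm (z)\<^sup>2 / \<sigma>\<^sup>2\<close>, the exponential of the linear and
  quadratic noise terms is at most a mean zero term plus an affine function of \<open>exp Z\<close> whose
  coefficients are determined by \<open>v\<close>.\<close>

definition lin_coeff :: "real \<Rightarrow> real \<Rightarrow> real" where
  "lin_coeff s \<beta> = (if s \<le> 1 / 2 then exp (- 4 * s\<^sup>2 - 2 * \<beta>) else 0)"

definition const_coeff :: "real \<Rightarrow> real \<Rightarrow> real" where
  "const_coeff s \<beta> = (if s \<le> 1 / 2 then exp (- 4 * s\<^sup>2 - 2 * \<beta>) * (1 - 2 * s\<^sup>2 - \<beta>)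
     else exp (- (7 / 2) * s\<^sup>2 - 2 * \<beta>) * (1 / 2 - \<beta>))"

definition exp_coeff :: "real \<Rightarrow> real \<Rightarrow> real" where
  "exp_coeff s \<beta> = (if s \<le> 1 / 2 then exp (- 4 * s\<^sup>2 - 2 * \<beta>) * (2 * s\<^sup>2 + \<beta>)
     else exp (- (7 / 2) * s\<^sup>2 - 2 * \<beta>) * (1 / 2 + \<beta>))"

text \<open>The 3 in the last inequality is the bound on the conditional expectation of
  \<open>exp Z\<close>. The bound on \<open>lin_coeff s \<beta> * s\<close> will make the linear
  term integrable for \<open>v\<close> of any size.\<close>

lemma coeff_bounds:
  assumes s: "0 \<le> s" and \<beta>: "0 \<le> \<beta>" "\<beta> \<le> 1 / 2"
  shows "0 \<le> lin_coeff s \<beta>" "lin_coeff s \<beta> \<le> 1"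
    and "lin_coeff s \<beta> * s \<le> 1"
    and "0 \<le> const_coeff s \<beta>" "0 \<le> exp_coeff s \<beta>" "const_coeff s \<beta> + 3 * exp_coeff s \<beta> \<le> 1"
proof -
  have "- 4 * s\<^sup>2 - 2 * \<beta> \<le> 0"
    using \<beta> zero_le_power2[of s] by linarith
  then have "exp (- 4 * s\<^sup>2 - 2 * \<beta>) \<le> 1"
    by (simp only: exp_le_one_iff)
  then show l: "0 \<le> lin_coeff s \<beta>" "lin_coeff s \<beta> \<le> 1"
    by (simp_all add: lin_coeff_def)
  show "lin_coeff s \<beta> * s \<le> 1"
    using l s mult_mono[of "lin_coeff s \<beta>" 1 s 1] by (cases "s \<le> 1 / 2") (auto simp: lin_coeff_def)
  have sq: "s\<^sup>2 \<le> 1 / 4" if "s \<le> 1 / 2"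
    using power_mono[OF that s, of 2] by (simp add: power2_eq_square)
  show "0 \<le> const_coeff s \<beta>"
    using \<beta> sq by (auto simp: const_coeff_def)
  show "0 \<le> exp_coeff s \<beta>"
    using \<beta> by (auto simp: exp_coeff_def)
  show "const_coeff s \<beta> + 3 * exp_coeff s \<beta> \<le> 1"
  proof (cases "s \<le> 1 / 2")
    case True
    have "const_coeff s \<beta> + 3 * exp_coeff s \<beta> = exp (- 4 * s\<^sup>2 - 2 * \<beta>) * (1 + (4 * s\<^sup>2 + 2 * \<beta>))"
      using True by (simp add: const_coeff_def exp_coeff_def algebra_simps)
    also have "\<dots> \<le> exp (- 4 * s\<^sup>2 - 2 * \<beta>) * exp (4 * s\<^sup>2 + 2 * \<beta>)"
      by (intro mult_left_mono exp_ge_add_one_self) simp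
    also have "\<dots> = 1" by (simp add: exp_add[symmetric])
    finally show ?thesis .
  next
    case False
    then have "(1 / 2) ^ 2 \<le> s\<^sup>2" by (intro power_mono) auto
    then have sq: "1 / 4 \<le> s\<^sup>2" by (simp add: power2_eq_square)
    have "const_coeff s \<beta> + 3 * exp_coeff s \<beta> = exp (- (7 / 2) * s\<^sup>2 - 2 * \<beta>) * (2 * (1 + \<beta>))"
      using False by (simp add: const_coeff_def exp_coeff_def algebra_simps)
    also have "\<dots> \<le> exp (- (7 / 2) * s\<^sup>2 - 2 * \<beta>) * (exp (7 / 2 * s\<^sup>2) * exp \<beta>)"
    proof (intro mult_left_mono mult_mono)
      \<comment> \<open>The tangent bound for \<open>exp (7 / 8)\<close> gives only 15 / 8; applied
        to the square root and squared it exceeds 2.\<close>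
      have "(1 + 7 / 2 / 8 :: real) ^ 2 \<le> (exp (7 / 2 / 8)) ^ 2"
        by (intro power_mono exp_ge_add_one_self) auto
      also have "\<dots> = exp (7 / 2 / 4 :: real)" by (simp add: power2_eq_square exp_add[symmetric])
      also have "\<dots> \<le> exp (7 / 2 * s\<^sup>2)" using sq by simp
      finally show "2 \<le> exp (7 / 2 * s\<^sup>2)" by (simp add: power2_eq_square)
      show "1 + \<beta> \<le> exp \<beta>" by (rule exp_ge_add_one_self)
    qed (use \<beta> in auto)
    also have "\<dots> = exp (- \<beta>)" by (simp add: exp_add[symmetric])
    also have "\<dots> \<le> 1" using \<beta> by simp
    finally show ?thesis .
  qed
qed

text \<open>For small \<open>s\<close> the two terms are separated by the arithmetic-geometric mean
  inequality, the linear one keeps its mean zero part, and \<open>4 * s\<^sup>2 \<le> 1\<close>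
  allows interpolation of the exponential. For large \<open>s\<close> the compensator alone is
  strong enough.\<close>

lemma noise_exp_bound:
  fixes y s \<beta> Z :: real
  assumes s: "0 \<le> s" and \<beta>: "0 \<le> \<beta>" "\<beta> \<le> 1 / 2" and Z: "0 \<le> Z" and y: "y\<^sup>2 \<le> s\<^sup>2 * Z"
  shows "exp (y + \<beta> * Z - 4 * s\<^sup>2 - 2 * \<beta>)
    \<le> lin_coeff s \<beta> * y + const_coeff s \<beta> + exp_coeff s \<beta> * exp Z"
proof (cases "s \<le> 1 / 2")
  case True
  have sq: "s\<^sup>2 \<le> 1 / 4" using power_mono[OF True s, of 2] by (simp add: power2_eq_square)
  have "exp (y + \<beta> * Z) \<le> 1 / 2 * exp (2 * y) + 1 / 2 * exp (2 * \<beta> * Z)"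
  proof -
    have "0 \<le> (exp y - exp (\<beta> * Z))\<^sup>2" by simp
    then show ?thesis
      by (simp add: power2_diff exp_add mult_exp_exp[symmetric] power2_eq_square field_simps)
         (simp add: exp_add[symmetric] algebra_simps)
  qed
  also have "exp (2 * y) \<le> 2 * y + exp ((2 * y)\<^sup>2)" by (rule exp_le_add_exp_square)
  also have "exp ((2 * y)\<^sup>2) \<le> exp (4 * s\<^sup>2 * Z)" using y by (simp add: power_mult_distrib)
  also have "\<dots> \<le> 1 - 4 * s\<^sup>2 + 4 * s\<^sup>2 * exp Z" using sq by (intro exp_mult_le_interpolate) auto
  also have "exp (2 * \<beta> * Z) \<le> 1 - 2 * \<beta> + 2 * \<beta> * exp Z" using \<beta> by (intro exp_mult_le_interpolate) auto
  finally have "exp (y + \<beta> * Z) \<le> y + (1 - 2 * s\<^sup>2 - \<beta>) + (2 * s\<^sup>2 + \<beta>) * exp Z"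
    by (simp add: algebra_simps)
  then have "exp (- 4 * s\<^sup>2 - 2 * \<beta>) * exp (y + \<beta> * Z)
      \<le> exp (- 4 * s\<^sup>2 - 2 * \<beta>) * (y + (1 - 2 * s\<^sup>2 - \<beta>) + (2 * s\<^sup>2 + \<beta>) * exp Z)"
    by (intro mult_left_mono) auto
  then show ?thesis
    using True by (simp add: lin_coeff_def const_coeff_def exp_coeff_def exp_add[symmetric] algebra_simps)
next
  case False
  \<comment> \<open>No cancellation is used for large \<open>s\<close>: Young's inequality costs
    \<open>s\<^sup>2 / 2\<close> of the compensator \<open>4 * s\<^sup>2\<close>, and the remaining
    \<open>7 / 2 * s\<^sup>2\<close> outweighs the factor 2.\<close>
  have "y \<le> s\<^sup>2 / 2 + Z / 2"
  proof -
    have "y \<le> sqrt (s\<^sup>2 * Z)" using y by (rule real_le_rsqrt)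
    also have "\<dots> \<le> (s\<^sup>2 + Z) / 2" using Z by (intro arith_geo_mean_sqrt) auto
    finally show ?thesis by simp
  qed
  then have "y + \<beta> * Z - 4 * s\<^sup>2 - 2 * \<beta> \<le> (- (7 / 2) * s\<^sup>2 - 2 * \<beta>) + (1 / 2 + \<beta>) * Z"
    by (simp add: algebra_simps)
  then have "exp (y + \<beta> * Z - 4 * s\<^sup>2 - 2 * \<beta>) \<le> exp (- (7 / 2) * s\<^sup>2 - 2 * \<beta>) * exp ((1 / 2 + \<beta>) * Z)"
    by (simp add: exp_add[symmetric])
  also have "\<dots> \<le> exp (- (7 / 2) * s\<^sup>2 - 2 * \<beta>) * (1 - (1 / 2 + \<beta>) + (1 / 2 + \<beta>) * exp Z)"
    using \<beta> by (intro mult_left_mono exp_mult_le_interpolate) auto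
  finally show ?thesis
    using False by (simp add: lin_coeff_def const_coeff_def exp_coeff_def algebra_simps)
qed

lemma nn_integral_exp_upto:
  fixes Z :: real
  assumes "0 \<le> Z"
  shows "ennreal (exp Z) = 1 + (\<integral>\<^sup>+ s. ennreal (exp s) * indicator {0..Z} s \<partial>lborel)"
proof -
  have "(\<integral>\<^sup>+ s. ennreal (exp s) * indicator {0..Z} s \<partial>lborel) = ennreal (exp Z - exp 0)"
    using assms by (intro nn_integral_FTC_Icc) (auto intro!: derivative_eq_intros)
  then show ?thesis
    using assms by (simp add: ennreal_plus[symmetric] del: ennreal_plus flip: ennreal_1)
qed

lemma nn_integral_exp_decay: "(\<integral>\<^sup>+ s. ennreal (2 * exp (- s)) * indicator {0..} s \<partial>lborel) = 2"
proof -
  have "((\<lambda>s::real. - 2 * exp (- s)) \<longlongrightarrow> 0) at_top"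
    by (intro tendsto_mult_right_zero filterlim_compose[OF exp_at_bot filterlim_uminus_at_bot_at_top])
  then have "(\<integral>\<^sup>+ s. ennreal (2 * exp (- s)) * indicator {0..} s \<partial>lborel) = ennreal (0 - (- 2 * exp (- 0)))"
    by (intro nn_integral_FTC_atLeast) (auto intro!: derivative_eq_intros)
  then show ?thesis by simp
qed

text \<open>Layer-cake representation of \<open>exp Z\<close> and Fubini: the tail contributes
  \<open>2 * exp (- s)\<close>, of integral 2, on top of 1. The weight \<open>Q\<close> known to
  \<open>G\<close> turns this into an integrated form of a conditional expectation bounded by
  3.\<close>

lemma (in prob_space) nn_integral_exp_light_tail:
  assumes sub: "subalgebra M G" and Q: "Q \<in> borel_measurable G"
    and Z: "Z \<in> borel_measurable M" "\<And>\<omega>. \<omega> \<in> space M \<Longrightarrow> 0 \<le> Z \<omega>"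
    and tail: "\<And>s. 0 < s \<Longrightarrow> AE \<omega> in M. cond_probability M G {\<omega> \<in> space M. s \<le> Z \<omega>} \<omega> \<le> 2 * exp (- 2 * s)"
  shows "(\<integral>\<^sup>+ \<omega>. Q \<omega> * ennreal (exp (Z \<omega>)) \<partial>M) \<le> 3 * (\<integral>\<^sup>+ \<omega>. Q \<omega> \<partial>M)"
proof -
  interpret G: finite_measure_subalgebra M G
    by unfold_locales (use sub in auto)
  note [measurable] = Z(1)
  have QM[measurable]: "Q \<in> borel_measurable M" by (rule measurable_from_subalg[OF sub Q])
  have tail_int: "(\<integral>\<^sup>+ \<omega>. Q \<omega> * indicator {\<omega> \<in> space M. s \<le> Z \<omega>} \<omega> \<partial>M)
      \<le> ennreal (2 * exp (- 2 * s)) * (\<integral>\<^sup>+ \<omega>. Q \<omega> \<partial>M)" if s: "0 < s" for s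
  proof -
    let ?A = "{\<omega> \<in> space M. s \<le> Z \<omega>}"
    have A[measurable]: "?A \<in> sets M" by measurable
    \<comment> \<open>\<open>real_cond_exp\<close> passes through \<open>enn2real\<close>, which
      sends infinity to 0, so a bound on it carries over to \<open>nn_cond_exp\<close> only once
      finiteness is known.\<close>
    have fin: "AE \<omega> in M. nn_cond_exp M G (indicator ?A) \<omega> \<le> 1"
    proof -
      have "AE \<omega> in M. nn_cond_exp M G (indicator ?A) \<omega> \<le> nn_cond_exp M G (\<lambda>_. 1) \<omega>"
        by (intro G.nn_cond_exp_mono) (auto simp: indicator_def)
      moreover have "AE \<omega> in M. 1 = nn_cond_exp M G (\<lambda>_. 1) \<omega>"
        by (rule G.nn_cond_exp_F_meas) auto
      ultimately show ?thesis by eventually_elim auto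
    qed
    have z: "AE \<omega> in M. nn_cond_exp M G (\<lambda>\<omega>. ennreal (- indicat_real ?A \<omega>)) \<omega> = 0"
    proof -
      have "(\<lambda>\<omega>. ennreal (- indicat_real ?A \<omega>)) = (\<lambda>_. 0)"
        by (auto simp: indicator_def ennreal_neg)
      moreover have "AE \<omega> in M. 0 = nn_cond_exp M G (\<lambda>_. 0) \<omega>"
        by (rule G.nn_cond_exp_F_meas) auto
      ultimately show ?thesis by auto
    qed
    have "AE \<omega> in M. nn_cond_exp M G (indicator ?A) \<omega> \<le> ennreal (2 * exp (- 2 * s))"
      using tail[OF s] fin z
    proof eventually_elim
      case (elim \<omega>)
      have "(\<lambda>\<omega>. ennreal (indicat_real ?A \<omega>)) = indicator ?A"
        by (auto simp: indicator_def)
      then have "enn2real (nn_cond_exp M G (indicator ?A) \<omega>) \<le> 2 * exp (- 2 * s)"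
        using elim by (simp add: cond_probability_def real_cond_exp_def)
      then have "ennreal (enn2real (nn_cond_exp M G (indicator ?A) \<omega>)) \<le> ennreal (2 * exp (- 2 * s))"
        by (rule ennreal_leI)
      moreover have "nn_cond_exp M G (indicator ?A) \<omega> < top"
        using elim(2) by (rule le_less_trans) simp
      ultimately show ?case
        by simp
    qed
    then have "(\<integral>\<^sup>+ \<omega>. Q \<omega> * nn_cond_exp M G (indicator ?A) \<omega> \<partial>M) \<le> (\<integral>\<^sup>+ \<omega>. Q \<omega> * ennreal (2 * exp (- 2 * s)) \<partial>M)"
      by (intro nn_integral_mono_AE) (auto elim!: eventually_mono intro!: mult_left_mono)
    then show ?thesis
      by (simp add: G.nn_cond_exp_intg[OF Q] nn_integral_multc mult.commute)
  qed
  interpret P: pair_sigma_finite M lborel ..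
  have "(\<integral>\<^sup>+ \<omega>. Q \<omega> * ennreal (exp (Z \<omega>)) \<partial>M)
      = (\<integral>\<^sup>+ \<omega>. Q \<omega> + (\<integral>\<^sup>+ s. Q \<omega> * (ennreal (exp s) * indicator {0..} s * (if s \<le> Z \<omega> then 1 else 0)) \<partial>lborel) \<partial>M)"
  proof (intro nn_integral_cong)
    fix \<omega> assume "\<omega> \<in> space M"
    have "(\<integral>\<^sup>+ s. Q \<omega> * (ennreal (exp s) * indicator {0..} s * (if s \<le> Z \<omega> then 1 else 0)) \<partial>lborel)
      = (\<integral>\<^sup>+ s. Q \<omega> * (ennreal (exp s) * indicator {0..Z \<omega>} s) \<partial>lborel)"
      by (intro nn_integral_cong) (auto simp: indicator_def)
    also have "\<dots> = Q \<omega> * (\<integral>\<^sup>+ s. ennreal (exp s) * indicator {0..Z \<omega>} s \<partial>lborel)"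
      by (intro nn_integral_cmult) auto
    finally show "Q \<omega> * ennreal (exp (Z \<omega>))
      = Q \<omega> + (\<integral>\<^sup>+ s. Q \<omega> * (ennreal (exp s) * indicator {0..} s * (if s \<le> Z \<omega> then 1 else 0)) \<partial>lborel)"
      unfolding nn_integral_exp_upto[OF Z(2)[OF \<open>\<omega> \<in> space M\<close>]] by (simp add: distrib_left)
  qed
  also have "\<dots> = (\<integral>\<^sup>+ \<omega>. Q \<omega> \<partial>M) + (\<integral>\<^sup>+ \<omega>. (\<integral>\<^sup>+ s. Q \<omega> * (ennreal (exp s) * indicator {0..} s * (if s \<le> Z \<omega> then 1 else 0)) \<partial>lborel) \<partial>M)"
    by (intro nn_integral_add) measurable
  also have "(\<integral>\<^sup>+ \<omega>. (\<integral>\<^sup>+ s. Q \<omega> * (ennreal (exp s) * indicator {0..} s * (if s \<le> Z \<omega> then 1 else 0)) \<partial>lborel) \<partial>M)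
      = (\<integral>\<^sup>+ s. (\<integral>\<^sup>+ \<omega>. Q \<omega> * (ennreal (exp s) * indicator {0..} s * (if s \<le> Z \<omega> then 1 else 0)) \<partial>M) \<partial>lborel)"
    by (rule P.Fubini'[symmetric]) measurable
  also have "\<dots> \<le> (\<integral>\<^sup>+ s. ennreal (2 * exp (- s)) * indicator {0..} s * (\<integral>\<^sup>+ \<omega>. Q \<omega> \<partial>M) \<partial>lborel)"
  proof (rule nn_integral_mono_AE)
    \<comment> \<open>The tail bound is available for positive \<open>s\<close> only; the point 0 is
      a null set.\<close>
    have "AE s in lborel. s \<noteq> (0::real)" by (rule AE_lborel_singleton)
    then show "AE s in lborel. (\<integral>\<^sup>+ \<omega>. Q \<omega> * (ennreal (exp s) * indicator {0..} s * (if s \<le> Z \<omega> then 1 else 0)) \<partial>M)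
      \<le> ennreal (2 * exp (- s)) * indicator {0..} s * (\<integral>\<^sup>+ \<omega>. Q \<omega> \<partial>M)"
    proof eventually_elim
      case (elim s)
      show ?case
      proof (cases "0 < s")
        case True
        have "(\<integral>\<^sup>+ \<omega>. Q \<omega> * (ennreal (exp s) * indicator {0..} s * (if s \<le> Z \<omega> then 1 else 0)) \<partial>M)
          = (\<integral>\<^sup>+ \<omega>. ennreal (exp s) * (Q \<omega> * indicator {\<omega> \<in> space M. s \<le> Z \<omega>} \<omega>) \<partial>M)"
          using True by (intro nn_integral_cong) (auto simp: indicator_def mult.commute)
        also have "\<dots> = ennreal (exp s) * (\<integral>\<^sup>+ \<omega>. Q \<omega> * indicator {\<omega> \<in> space M. s \<le> Z \<omega>} \<omega> \<partial>M)"
          by (intro nn_integral_cmult) measurable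
        also have "\<dots> \<le> ennreal (exp s) * (ennreal (2 * exp (- 2 * s)) * (\<integral>\<^sup>+ \<omega>. Q \<omega> \<partial>M))"
          by (intro mult_left_mono tail_int True) auto
        also have "\<dots> = ennreal (exp s * (2 * exp (- 2 * s))) * (\<integral>\<^sup>+ \<omega>. Q \<omega> \<partial>M)"
          by (simp add: ennreal_mult mult.assoc)
        also have "exp s * (2 * exp (- 2 * s)) = 2 * exp (- s)"
          by (simp add: exp_add[symmetric] mult.left_commute)
        finally show ?thesis using True by simp
      next
        case False
        then show ?thesis using elim by simp
      qed
    qed
  qed
  also have "\<dots> = 2 * (\<integral>\<^sup>+ \<omega>. Q \<omega> \<partial>M)"
    by (subst nn_integral_multc) (auto simp: nn_integral_exp_decay)
  also have "(\<integral>\<^sup>+ \<omega>. Q \<omega> \<partial>M) + 2 * (\<integral>\<^sup>+ \<omega>. Q \<omega> \<partial>M) = 3 * (\<integral>\<^sup>+ \<omega>. Q \<omega> \<partial>M)"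
    using distrib_right[of 1 2 "\<integral>\<^sup>+ \<omega>. Q \<omega> \<partial>M"] by simp
  finally show ?thesis by (simp add: add_left_mono)
qed

lemma exp_coeff_measurable [measurable]:
  assumes [measurable]: "s \<in> borel_measurable G"
  shows "(\<lambda>\<omega>. lin_coeff (s \<omega>) \<beta>) \<in> borel_measurable G"
    and "(\<lambda>\<omega>. const_coeff (s \<omega>) \<beta>) \<in> borel_measurable G"
    and "(\<lambda>\<omega>. exp_coeff (s \<omega>) \<beta>) \<in> borel_measurable G"
  unfolding lin_coeff_def const_coeff_def exp_coeff_def by measurable

lemma sqrt_le_exp: "0 \<le> x \<Longrightarrow> sqrt x \<le> exp x"
proof -
  assume x: "0 \<le> x"
  have "sqrt x \<le> 1 + x"
    using x arith_geo_mean_sqrt[of 1 x] by simp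
  also have "\<dots> \<le> exp x" by (rule exp_ge_add_one_self)
  finally show ?thesis .
qed

text \<open>\<open>noise_exp_bound\<close> dominates \<open>W\<close> by three parts:
  \<open>T1\<close> is linear in the noise with a coefficient known to \<open>G\<close> and
  integrates to 0, \<open>T2\<close> is known to \<open>G\<close>, and \<open>T3\<close> costs a
  factor 3. Together they return at most \<open>Q\<close> by \<open>coeff_bounds\<close>.\<close>

lemma (in prob_space) noise_exp_step:
  fixes z v :: "'a \<Rightarrow> 'b::euclidean_space"
  assumes sub: "subalgebra M G" and Q: "Q \<in> borel_measurable G" "\<And>\<omega>. 0 \<le> Q \<omega>" "integrable M Q"
    and v: "v \<in> borel_measurable G" and z: "cond_mean_zero M G z" and \<sigma>: "0 < \<sigma>"
    and tail: "\<And>\<tau>. 0 < \<tau> \<Longrightarrow> AE \<omega> in M. cond_probability M G {\<omega> \<in> space M. norm (z \<omega>) \<ge> \<tau>} \<omega>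
                \<le> 2 * exp (- 2 * \<tau>\<^sup>2 / \<sigma>\<^sup>2)"
    and a: "0 \<le> a" and b: "0 \<le> b" "b * \<sigma>\<^sup>2 \<le> 1 / 2"
  defines "W \<equiv> \<lambda>\<omega>. Q \<omega> * exp (a * (z \<omega> \<bullet> v \<omega>) + b * (norm (z \<omega>))\<^sup>2 - 4 * a\<^sup>2 * \<sigma>\<^sup>2 * (norm (v \<omega>))\<^sup>2 - 2 * b * \<sigma>\<^sup>2)"
  shows "integrable M W" and "(\<integral>\<omega>. W \<omega> \<partial>M) \<le> (\<integral>\<omega>. Q \<omega> \<partial>M)"
proof -
  interpret G: finite_measure_subalgebra M G
    by unfold_locales (use sub in auto)
  define Z where "Z \<omega> = (norm (z \<omega>))\<^sup>2 / \<sigma>\<^sup>2" for \<omega>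
  define s where "s \<omega> = a * norm (v \<omega>) * \<sigma>" for \<omega>
  define \<beta> where "\<beta> = b * \<sigma>\<^sup>2"
  have \<beta>: "0 \<le> \<beta>" "\<beta> \<le> 1 / 2" using b by (auto simp: \<beta>_def)
  have zint: "integrable M z" using z by (simp add: cond_mean_zero_def)
  note [measurable] = v Q(1)
  have zM[measurable]: "z \<in> borel_measurable M" using zint by auto
  have QM[measurable]: "Q \<in> borel_measurable M" by (rule measurable_from_subalg[OF sub Q(1)])
  have vM[measurable]: "v \<in> borel_measurable M" by (rule measurable_from_subalg[OF sub v])
  have sG[measurable]: "s \<in> borel_measurable G" unfolding s_def by measurable
  have sM[measurable]: "s \<in> borel_measurable M" by (rule measurable_from_subalg[OF sub sG])
  have ZM[measurable]: "Z \<in> borel_measurable M" unfolding Z_def by measurable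
  have Z0: "0 \<le> Z \<omega>" for \<omega> by (simp add: Z_def)
  have s0: "0 \<le> s \<omega>" for \<omega> using a \<sigma> by (simp add: s_def)
  note co = coeff_bounds[OF s0 \<beta>]
  have tailZ: "AE \<omega> in M. cond_probability M G {\<omega> \<in> space M. t \<le> Z \<omega>} \<omega> \<le> 2 * exp (- 2 * t)" if t: "0 < t" for t
  proof -
    have "t \<le> Z \<omega> \<longleftrightarrow> \<sigma> * sqrt t \<le> norm (z \<omega>)" for \<omega>
    proof -
      have "t \<le> Z \<omega> \<longleftrightarrow> (\<sigma> * sqrt t)\<^sup>2 \<le> (norm (z \<omega>))\<^sup>2"
        using \<sigma> t by (simp add: Z_def power_mult_distrib field_simps)
      also have "\<dots> \<longleftrightarrow> \<sigma> * sqrt t \<le> norm (z \<omega>)"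
        using \<sigma> t by (intro power_mono_iff) auto
      finally show ?thesis .
    qed
    moreover have "- 2 * (\<sigma> * sqrt t)\<^sup>2 / \<sigma>\<^sup>2 = - 2 * t"
      using \<sigma> t by (simp add: power_mult_distrib)
    ultimately show ?thesis
      using tail[of "\<sigma> * sqrt t"] \<sigma> t by simp
  qed
  have moment: "(\<integral>\<^sup>+ \<omega>. ennreal (R \<omega>) * ennreal (exp (Z \<omega>)) \<partial>M) \<le> 3 * (\<integral>\<^sup>+ \<omega>. ennreal (R \<omega>) \<partial>M)"
    if R[measurable]: "R \<in> borel_measurable G" for R
    by (rule nn_integral_exp_light_tail[OF sub _ ZM Z0 tailZ]) auto
  have QZ: "integrable M (\<lambda>\<omega>. Q \<omega> * exp (Z \<omega>))"
  proof (rule integrableI_nonneg)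
    have "(\<integral>\<^sup>+ \<omega>. ennreal (Q \<omega> * exp (Z \<omega>)) \<partial>M) \<le> 3 * (\<integral>\<^sup>+ \<omega>. ennreal (Q \<omega>) \<partial>M)"
      using moment[OF Q(1)] Q(2) by (simp add: ennreal_mult)
    also have "\<dots> < \<infinity>"
      using integrableD(2)[OF Q(3)] Q(2) by (simp add: ennreal_mult_less_top top.not_eq_extremum)
    finally show "(\<integral>\<^sup>+ \<omega>. ennreal (Q \<omega> * exp (Z \<omega>)) \<partial>M) < \<infinity>" .
  qed (use Q in auto)
  \<comment> \<open>\<open>v\<close> is only measurable; the linear part is nevertheless dominated
    by \<open>exp Z\<close>, because \<open>lin_coeff\<close> vanishes where \<open>s\<close> is
    large.\<close>
  have prodle: "lin_coeff (s \<omega>) \<beta> * a * norm (v \<omega>) * norm (z \<omega>) \<le> exp (Z \<omega>)" for \<omega>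
  proof -
    have "lin_coeff (s \<omega>) \<beta> * a * norm (v \<omega>) * norm (z \<omega>) = (lin_coeff (s \<omega>) \<beta> * s \<omega>) * sqrt (Z \<omega>)"
      using \<sigma> by (simp add: s_def Z_def real_sqrt_divide)
    also have "\<dots> \<le> 1 * exp (Z \<omega>)"
      using co(3) sqrt_le_exp[OF Z0] Z0 by (intro mult_mono) auto
    finally show ?thesis by simp
  qed
  define T1 where "T1 \<omega> = Q \<omega> * (lin_coeff (s \<omega>) \<beta> * (a * (z \<omega> \<bullet> v \<omega>)))" for \<omega>
  define T2 where "T2 \<omega> = Q \<omega> * const_coeff (s \<omega>) \<beta>" for \<omega>
  define T3 where "T3 \<omega> = Q \<omega> * exp_coeff (s \<omega>) \<beta> * exp (Z \<omega>)" for \<omega>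
  define E where "E \<omega> = Q \<omega> * exp_coeff (s \<omega>) \<beta>" for \<omega>
  \<comment> \<open>Conditional mean zero is a statement about components, so the inner product is
    expanded in the basis.\<close>
  have T1_eq: "T1 \<omega> = (\<Sum>e\<in>Basis. (Q \<omega> * lin_coeff (s \<omega>) \<beta> * a * (v \<omega> \<bullet> e)) * (z \<omega> \<bullet> e))" for \<omega>
    unfolding T1_def euclidean_inner[of "z \<omega>" "v \<omega>"] sum_distrib_left
    by (intro sum.cong) (simp_all only: mult_ac)
  have comp: "integrable M (\<lambda>\<omega>. (Q \<omega> * lin_coeff (s \<omega>) \<beta> * a * (v \<omega> \<bullet> e)) * (z \<omega> \<bullet> e))"
    "(\<integral>\<omega>. (Q \<omega> * lin_coeff (s \<omega>) \<beta> * a * (v \<omega> \<bullet> e)) * (z \<omega> \<bullet> e) \<partial>M) = 0" if e: "e \<in> Basis" for e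
  proof -
    show int: "integrable M (\<lambda>\<omega>. (Q \<omega> * lin_coeff (s \<omega>) \<beta> * a * (v \<omega> \<bullet> e)) * (z \<omega> \<bullet> e))"
    proof (rule Bochner_Integration.integrable_bound[OF QZ])
      have "norm ((Q \<omega> * lin_coeff (s \<omega>) \<beta> * a * (v \<omega> \<bullet> e)) * (z \<omega> \<bullet> e)) \<le> norm (Q \<omega> * exp (Z \<omega>))" for \<omega>
      proof -
        have "norm ((Q \<omega> * lin_coeff (s \<omega>) \<beta> * a * (v \<omega> \<bullet> e)) * (z \<omega> \<bullet> e))
          = Q \<omega> * (lin_coeff (s \<omega>) \<beta> * a * (\<bar>v \<omega> \<bullet> e\<bar> * \<bar>z \<omega> \<bullet> e\<bar>))"
          using Q(2) co(1) a by (simp add: abs_mult)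
        also have "\<dots> \<le> Q \<omega> * (lin_coeff (s \<omega>) \<beta> * a * (norm (v \<omega>) * norm (z \<omega>)))"
          using Q(2) co(1) a e by (intro mult_left_mono mult_mono Basis_le_norm) auto
        also have "\<dots> \<le> Q \<omega> * exp (Z \<omega>)"
          using prodle[of \<omega>] Q(2) by (intro mult_left_mono) (auto simp: mult.assoc)
        finally show ?thesis using Q(2) by simp
      qed
      then show "AE \<omega> in M. norm ((Q \<omega> * lin_coeff (s \<omega>) \<beta> * a * (v \<omega> \<bullet> e)) * (z \<omega> \<bullet> e)) \<le> norm (Q \<omega> * exp (Z \<omega>))"
        by simp
    qed measurable
    have "(\<integral>\<omega>. (Q \<omega> * lin_coeff (s \<omega>) \<beta> * a * (v \<omega> \<bullet> e)) * (z \<omega> \<bullet> e) \<partial>M)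
        = (\<integral>\<omega>. (Q \<omega> * lin_coeff (s \<omega>) \<beta> * a * (v \<omega> \<bullet> e)) * real_cond_exp M G (\<lambda>\<omega>. z \<omega> \<bullet> e) \<omega> \<partial>M)"
      by (rule G.real_cond_exp_intg(2)[OF int, symmetric]) measurable
    also have "\<dots> = (\<integral>\<omega>. 0 \<partial>M)"
    proof (rule integral_cong_AE)
      show "AE \<omega> in M. Q \<omega> * lin_coeff (s \<omega>) \<beta> * a * (v \<omega> \<bullet> e) * real_cond_exp M G (\<lambda>\<omega>. z \<omega> \<bullet> e) \<omega> = 0"
        using z e by (auto simp: cond_mean_zero_def elim!: eventually_mono)
    qed measurable
    finally show "(\<integral>\<omega>. (Q \<omega> * lin_coeff (s \<omega>) \<beta> * a * (v \<omega> \<bullet> e)) * (z \<omega> \<bullet> e) \<partial>M) = 0" by simp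
  qed
  have T1: "integrable M T1" "(\<integral>\<omega>. T1 \<omega> \<partial>M) = 0"
    unfolding T1_eq using comp by (auto simp: Bochner_Integration.integral_sum)
  have le1: "const_coeff (s \<omega>) \<beta> \<le> 1" "exp_coeff (s \<omega>) \<beta> \<le> 1" for \<omega>
    using co(4,5,6)[of \<omega>] by linarith+
  have T2: "integrable M T2"
    unfolding T2_def using Q(2) le1 co(4)
    by (intro Bochner_Integration.integrable_bound[OF Q(3)]) (auto intro!: AE_I2 mult_left_le simp: abs_mult)
  have E: "integrable M E"
    unfolding E_def using Q(2) le1 co(5)
    by (intro Bochner_Integration.integrable_bound[OF Q(3)]) (auto intro!: AE_I2 mult_left_le simp: abs_mult)
  have T3: "integrable M T3"
  proof (unfold T3_def, rule Bochner_Integration.integrable_bound[OF QZ])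
    show "AE \<omega> in M. norm (Q \<omega> * exp_coeff (s \<omega>) \<beta> * exp (Z \<omega>)) \<le> norm (Q \<omega> * exp (Z \<omega>))"
      using Q(2) le1 co(5) by (auto intro!: AE_I2 mult_left_le mult_right_mono simp: abs_mult)
  qed measurable
  have T3_le: "(\<integral>\<omega>. T3 \<omega> \<partial>M) \<le> 3 * (\<integral>\<omega>. E \<omega> \<partial>M)"
  proof -
    have E0: "0 \<le> E \<omega>" "0 \<le> T3 \<omega>" "T3 \<omega> = E \<omega> * exp (Z \<omega>)" for \<omega> using Q(2) co(5) by (auto simp: E_def T3_def)
    have EG: "E \<in> borel_measurable G" unfolding E_def by measurable
    have "ennreal (\<integral>\<omega>. T3 \<omega> \<partial>M) = (\<integral>\<^sup>+ \<omega>. ennreal (T3 \<omega>) \<partial>M)"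
      using E0(2) by (intro nn_integral_eq_integral[symmetric] T3) auto
    also have "\<dots> \<le> 3 * (\<integral>\<^sup>+ \<omega>. ennreal (E \<omega>) \<partial>M)"
      using moment[OF EG] E0 by (simp add: ennreal_mult)
    also have "(\<integral>\<^sup>+ \<omega>. ennreal (E \<omega>) \<partial>M) = ennreal (\<integral>\<omega>. E \<omega> \<partial>M)"
      using E E0 by (intro nn_integral_eq_integral) auto
    also have "3 * ennreal (\<integral>\<omega>. E \<omega> \<partial>M) = ennreal (3 * (\<integral>\<omega>. E \<omega> \<partial>M))"
      using E0 by (simp add: ennreal_mult integral_nonneg_AE)
    finally show ?thesis
      using E0(1) by (subst (asm) ennreal_le_iff) (auto intro!: integral_nonneg_AE)
  qed
  have Wle: "W \<omega> \<le> T1 \<omega> + T2 \<omega> + T3 \<omega>" for \<omega>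
  proof -
    have "(a * (z \<omega> \<bullet> v \<omega>))\<^sup>2 \<le> (s \<omega>)\<^sup>2 * Z \<omega>"
    proof -
      have "(a * (z \<omega> \<bullet> v \<omega>))\<^sup>2 \<le> (a * (norm (z \<omega>) * norm (v \<omega>)))\<^sup>2"
        using a Cauchy_Schwarz_ineq2[of "z \<omega>" "v \<omega>"]
        by (intro power2_le_iff_abs_le[THEN iffD2]) (auto simp: abs_mult intro!: mult_left_mono)
      also have "\<dots> = (s \<omega>)\<^sup>2 * Z \<omega>"
        using \<sigma> by (simp add: s_def Z_def power_mult_distrib)
      finally show ?thesis .
    qed
    from noise_exp_bound[OF s0 \<beta> Z0 this]
    have "exp (a * (z \<omega> \<bullet> v \<omega>) + \<beta> * Z \<omega> - 4 * (s \<omega>)\<^sup>2 - 2 * \<beta>)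
      \<le> lin_coeff (s \<omega>) \<beta> * (a * (z \<omega> \<bullet> v \<omega>)) + const_coeff (s \<omega>) \<beta> + exp_coeff (s \<omega>) \<beta> * exp (Z \<omega>)" .
    moreover have "a * (z \<omega> \<bullet> v \<omega>) + \<beta> * Z \<omega> - 4 * (s \<omega>)\<^sup>2 - 2 * \<beta>
      = a * (z \<omega> \<bullet> v \<omega>) + b * (norm (z \<omega>))\<^sup>2 - 4 * a\<^sup>2 * \<sigma>\<^sup>2 * (norm (v \<omega>))\<^sup>2 - 2 * b * \<sigma>\<^sup>2"
      using \<sigma> by (simp add: \<beta>_def Z_def s_def power_mult_distrib)
    ultimately have "W \<omega> \<le> Q \<omega> * (lin_coeff (s \<omega>) \<beta> * (a * (z \<omega> \<bullet> v \<omega>)) + const_coeff (s \<omega>) \<beta>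
        + exp_coeff (s \<omega>) \<beta> * exp (Z \<omega>))"
      unfolding W_def using Q(2) by (intro mult_left_mono) simp_all
    then show ?thesis
      by (simp only: T1_def T2_def T3_def distrib_left mult.assoc)
  qed
  have TT: "integrable M (\<lambda>\<omega>. T1 \<omega> + T2 \<omega> + T3 \<omega>)" using T1 T2 T3 by auto
  show Wint: "integrable M W"
  proof (rule Bochner_Integration.integrable_bound[OF TT])
    show "W \<in> borel_measurable M" unfolding W_def by measurable
    have "0 \<le> W \<omega>" for \<omega> using Q(2) by (simp add: W_def)
    then show "AE \<omega> in M. norm (W \<omega>) \<le> norm (T1 \<omega> + T2 \<omega> + T3 \<omega>)"
      using Wle by (intro AE_I2) (smt (verit) real_norm_def)
  qed
  have "(\<integral>\<omega>. W \<omega> \<partial>M) \<le> (\<integral>\<omega>. T1 \<omega> + T2 \<omega> + T3 \<omega> \<partial>M)"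
    using Wint TT Wle by (intro integral_mono) auto
  also have "\<dots> = (\<integral>\<omega>. T2 \<omega> \<partial>M) + (\<integral>\<omega>. T3 \<omega> \<partial>M)"
    using T1 T2 T3 by simp
  also have "\<dots> \<le> (\<integral>\<omega>. T2 \<omega> + 3 * E \<omega> \<partial>M)"
    using T2 E T3_le by simp
  also have "\<dots> \<le> (\<integral>\<omega>. Q \<omega> \<partial>M)"
  proof (rule integral_mono)
    show "T2 \<omega> + 3 * E \<omega> \<le> Q \<omega>" for \<omega>
      using mult_left_mono[OF co(6)[of \<omega>] Q(2)[of \<omega>]] by (simp add: T2_def E_def algebra_simps)
  qed (use T2 E Q in auto)
  finally show "(\<integral>\<omega>. W \<omega> \<partial>M) \<le> (\<integral>\<omega>. Q \<omega> \<partial>M)" .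
qed

text \<open>The partial exponential plays the role of \<open>Q\<close> in
  \<open>noise_exp_step\<close>, which adds one factor at a time. The compensator in
  \<open>v\<close> is random and therefore remains inside the exponent.\<close>

lemma (in prob_space) noise_exp_supermartingale:
  fixes z v :: "nat \<Rightarrow> 'a \<Rightarrow> 'b::euclidean_space"
  assumes sub: "\<And>i. i < N \<Longrightarrow> subalgebra M (G i)"
    and mono: "\<And>i j. i \<le> j \<Longrightarrow> j < N \<Longrightarrow> sets (G i) \<subseteq> sets (G j)"
    and v: "\<And>i. i < N \<Longrightarrow> v i \<in> borel_measurable (G i)"
    and zG: "\<And>i j. i < j \<Longrightarrow> j < N \<Longrightarrow> z i \<in> borel_measurable (G j)"
    and z: "\<And>i. i < N \<Longrightarrow> cond_mean_zero M (G i) (z i)" and \<sigma>: "0 < \<sigma>"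
    and tail: "\<And>i \<tau>. i < N \<Longrightarrow> 0 < \<tau> \<Longrightarrow>
        AE \<omega> in M. cond_probability M (G i) {\<omega> \<in> space M. norm (z i \<omega>) \<ge> \<tau>} \<omega> \<le> 2 * exp (- 2 * \<tau>\<^sup>2 / \<sigma>\<^sup>2)"
    and a: "\<And>i. i < N \<Longrightarrow> 0 \<le> a i" and b: "\<And>i. i < N \<Longrightarrow> 0 \<le> b i" "\<And>i. i < N \<Longrightarrow> b i * \<sigma>\<^sup>2 \<le> 1 / 2"
  defines "S \<equiv> \<lambda>n \<omega>. \<Sum>i<n. a i * (z i \<omega> \<bullet> v i \<omega>) + b i * (norm (z i \<omega>))\<^sup>2
      - 4 * (a i)\<^sup>2 * \<sigma>\<^sup>2 * (norm (v i \<omega>))\<^sup>2 - 2 * b i * \<sigma>\<^sup>2"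
  shows "S N \<in> borel_measurable M" and "(\<integral>\<^sup>+ \<omega>. ennreal (exp (S N \<omega>)) \<partial>M) \<le> 1"
proof -
  have vG: "v i \<in> borel_measurable (G j)" if "i \<le> j" "j < N" for i j
    using v[of i] mono[OF that] sub[of i] sub[of j] that
    by (auto simp: measurable_def subalgebra_def)
  have SG: "S n \<in> borel_measurable (G n)" if "n < N" for n
    unfolding S_def using that vG zG
    by (intro borel_measurable_sum borel_measurable_diff borel_measurable_add borel_measurable_times
        borel_measurable_const borel_measurable_inner borel_measurable_power borel_measurable_norm) auto
  have main: "integrable M (\<lambda>\<omega>. exp (S n \<omega>)) \<and> (\<integral>\<omega>. exp (S n \<omega>) \<partial>M) \<le> 1" if "n \<le> N" for n
    using that
  proof (induction n)
    case 0
    then show ?case by (simp add: S_def prob_space)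
  next
    case (Suc n)
    then have n: "n < N" and IH: "integrable M (\<lambda>\<omega>. exp (S n \<omega>))" "(\<integral>\<omega>. exp (S n \<omega>) \<partial>M) \<le> 1" by auto
    have Sn: "(\<lambda>\<omega>. exp (S n \<omega>)) \<in> borel_measurable (G n)" using SG[OF n] by measurable
    have "exp (S (Suc n) \<omega>) = exp (S n \<omega>) * exp (a n * (z n \<omega> \<bullet> v n \<omega>) + b n * (norm (z n \<omega>))\<^sup>2
      - 4 * (a n)\<^sup>2 * \<sigma>\<^sup>2 * (norm (v n \<omega>))\<^sup>2 - 2 * b n * \<sigma>\<^sup>2)" for \<omega>
      by (simp add: S_def exp_add[symmetric])
    then show ?case
      using noise_exp_step[OF sub[OF n] Sn _ IH(1) v[OF n] z[OF n] \<sigma> tail[OF n] a[OF n] b(1)[OF n] b(2)[OF n]] IH(2)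
      by auto
  qed
  have zM: "z i \<in> borel_measurable M" if "i < N" for i
    using z[OF that] by (auto simp: cond_mean_zero_def)
  have vM: "v i \<in> borel_measurable M" if "i < N" for i
    using measurable_from_subalg[OF sub v] that by blast
  show "S N \<in> borel_measurable M"
    unfolding S_def using zM vM
    by (intro borel_measurable_sum borel_measurable_diff borel_measurable_add borel_measurable_times
        borel_measurable_const borel_measurable_inner borel_measurable_power borel_measurable_norm) auto
  have "(\<integral>\<^sup>+ \<omega>. ennreal (exp (S N \<omega>)) \<partial>M) = ennreal (\<integral>\<omega>. exp (S N \<omega>) \<partial>M)"
    using main[of N] by (intro nn_integral_eq_integral) auto
  also have "\<dots> \<le> 1" using main[of N] by (simp add: ennreal_le_1)
  finally show "(\<integral>\<^sup>+ \<omega>. ennreal (exp (S N \<omega>)) \<partial>M) \<le> 1" .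
qed

section \<open>From exponential moments to tail probabilities\<close>

lemma (in prob_space) exp_moment_tail:
  assumes f[measurable]: "f \<in> borel_measurable M" and C: "0 < C" "(\<integral>\<^sup>+ \<omega>. ennreal (exp (f \<omega>)) \<partial>M) \<le> ennreal C"
    and \<delta>: "0 < \<delta>"
  shows "1 - \<delta> \<le> prob {\<omega> \<in> space M. f \<omega> \<le> ln (C / \<delta>)}"
proof -
  let ?A = "{\<omega> \<in> space M. 1 \<le> ennreal (\<delta> / C) * ennreal (exp (f \<omega>))}"
  have "emeasure M ?A \<le> ennreal (\<delta> / C) * (\<integral>\<^sup>+ \<omega>. ennreal (exp (f \<omega>)) \<partial>M)"
  proof -
    have "emeasure M ?A \<le> ennreal (\<delta> / C) * (\<integral>\<^sup>+ \<omega>. ennreal (exp (f \<omega>)) * indicator (space M) \<omega> \<partial>M)"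
      by (intro nn_integral_Markov_inequality) auto
    also have "(\<integral>\<^sup>+ \<omega>. ennreal (exp (f \<omega>)) * indicator (space M) \<omega> \<partial>M) = (\<integral>\<^sup>+ \<omega>. ennreal (exp (f \<omega>)) \<partial>M)"
      by (intro nn_integral_cong) auto
    finally show ?thesis .
  qed
  also have "\<dots> \<le> ennreal (\<delta> / C) * ennreal C"
    by (intro mult_left_mono C) simp
  also have "\<dots> = ennreal \<delta>" using C \<delta> by (simp add: ennreal_mult[symmetric])
  finally have "prob ?A \<le> \<delta>" using \<delta> by (simp add: emeasure_eq_measure)
  have "prob {\<omega> \<in> space M. \<not> f \<omega> \<le> ln (C / \<delta>)} \<le> prob ?A"
  proof (intro finite_measure_mono)
    show "{\<omega> \<in> space M. \<not> f \<omega> \<le> ln (C / \<delta>)} \<subseteq> ?A"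
    proof
      fix \<omega> assume "\<omega> \<in> {\<omega> \<in> space M. \<not> f \<omega> \<le> ln (C / \<delta>)}"
      then have \<omega>: "\<omega> \<in> space M" "ln (C / \<delta>) < f \<omega>" by auto
      have "C / \<delta> \<le> exp (f \<omega>)"
        using \<omega>(2) C \<delta> by (metis divide_pos_pos exp_le_cancel_iff exp_ln less_imp_le)
      then have "1 \<le> \<delta> / C * exp (f \<omega>)" using C \<delta> by (simp add: field_simps)
      then show "\<omega> \<in> ?A"
        using \<omega>(1) C \<delta> by (simp add: ennreal_mult[symmetric])
    qed
  qed measurable
  also note \<open>prob ?A \<le> \<delta>\<close>
  finally show ?thesis
    by (subst (asm) prob_neg) auto
qed

text \<open>Jensen's inequality for the probability weights
  \<open>\<beta> i / sum \<beta> I\<close>: the moment of the weighted mean is at most the weighted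
  mean of the moments, whatever the joint law.\<close>

lemma (in prob_space) weighted_exp_moment:
  assumes I: "finite I" and \<beta>: "\<And>i. i \<in> I \<Longrightarrow> 0 \<le> \<beta> i" "0 < sum \<beta> I"
    and H[measurable]: "\<And>i. i \<in> I \<Longrightarrow> H i \<in> borel_measurable M"
    and m: "\<And>i. i \<in> I \<Longrightarrow> (\<integral>\<^sup>+ \<omega>. ennreal (exp (H i \<omega>)) \<partial>M) \<le> ennreal C" and C: "0 \<le> C"
  shows "(\<integral>\<^sup>+ \<omega>. ennreal (exp ((\<Sum>i\<in>I. \<beta> i * H i \<omega>) / sum \<beta> I)) \<partial>M) \<le> ennreal C"
proof -
  define p where "p i = \<beta> i / sum \<beta> I" for i
  have p: "\<And>i. i \<in> I \<Longrightarrow> 0 \<le> p i" "sum p I = 1"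
    using \<beta> by (auto simp: p_def sum_divide_distrib[symmetric])
  have "I \<noteq> {}" using \<beta>(2) by auto
  have "exp ((\<Sum>i\<in>I. \<beta> i * H i \<omega>) / sum \<beta> I) \<le> (\<Sum>i\<in>I. p i * exp (H i \<omega>))" for \<omega>
  proof -
    have "exp (\<Sum>i\<in>I. p i *\<^sub>R H i \<omega>) \<le> (\<Sum>i\<in>I. p i * exp (H i \<omega>))"
      using I \<open>I \<noteq> {}\<close> p exp_convex by (intro convex_on_sum[where C = UNIV]) auto
    then show ?thesis by (simp add: p_def sum_divide_distrib)
  qed
  then have "(\<integral>\<^sup>+ \<omega>. ennreal (exp ((\<Sum>i\<in>I. \<beta> i * H i \<omega>) / sum \<beta> I)) \<partial>M)
      \<le> (\<integral>\<^sup>+ \<omega>. (\<Sum>i\<in>I. ennreal (p i) * ennreal (exp (H i \<omega>))) \<partial>M)"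
    using p by (intro nn_integral_mono) (simp add: sum_ennreal ennreal_mult[symmetric] ennreal_leI)
  also have "\<dots> = (\<Sum>i\<in>I. ennreal (p i) * (\<integral>\<^sup>+ \<omega>. ennreal (exp (H i \<omega>)) \<partial>M))"
    by (subst nn_integral_sum) (auto simp: nn_integral_cmult)
  also have "\<dots> \<le> (\<Sum>i\<in>I. ennreal (p i) * ennreal C)"
    using m by (intro sum_mono mult_left_mono) auto
  also have "\<dots> = ennreal C"
    using p C by (simp add: ennreal_mult[symmetric] sum_ennreal sum_distrib_right[symmetric])
  finally show ?thesis .
qed

section \<open>A lower bound for the constant\<close>

lemma
  fixes u :: "'a::euclidean_space"
  shows gradient_half_norm_square: "gradient (\<lambda>u. (norm u)\<^sup>2 / 2) u = u"
    and half_norm_square_differentiable: "(\<lambda>u. (norm u)\<^sup>2 / 2) differentiable (at u)"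
proof -
  have "((\<lambda>u::'a. (u \<bullet> u) / 2) has_derivative (\<lambda>k. (u \<bullet> k + k \<bullet> u) / 2)) (at u)"
    by (auto intro!: derivative_eq_intros)
  then have D: "GDERIV (\<lambda>u. (norm u)\<^sup>2 / 2) u :> u"
    unfolding gderiv_def by (simp add: power2_norm_eq_inner inner_commute)
  then show "gradient (\<lambda>u. (norm u)\<^sup>2 / 2) u = u"
    by (rule gradient_eqI)
  show "(\<lambda>u. (norm u)\<^sup>2 / 2) differentiable (at u)"
    using D unfolding gderiv_def differentiable_def by blast
qed

lemma prox_zero:
  fixes v :: "'a::euclidean_space"
  assumes "0 < \<eta>"
  shows "prox \<eta> (\<lambda>_. 0) v = v"
proof -
  let ?h = "\<lambda>u. (0::ereal) + ereal (1 / (2 * \<eta>) * (norm (u - v))\<^sup>2)"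
  have "is_arg_min ?h (\<lambda>_. True) v"
    using assms by (auto simp: is_arg_min_linorder)
  then have "is_arg_min ?h (\<lambda>_. True) (prox \<eta> (\<lambda>_. 0) v)"
    unfolding prox_def arg_min_def by (rule someI)
  then have "?h (prox \<eta> (\<lambda>_. 0) v) \<le> ?h v"
    by (simp only: is_arg_min_linorder)
  then have "1 / (2 * \<eta>) * (norm (prox \<eta> (\<lambda>_. 0) v - v))\<^sup>2 \<le> 0"
    by simp
  then show ?thesis
    using assms by (simp add: field_simps mult_le_0_iff)
qed

lemma real_cond_exp_zero:
  assumes "prob_space M" "subalgebra M G"
  shows "AE \<omega> in M. real_cond_exp M G (\<lambda>_. 0) \<omega> = 0"
proof -
  interpret prob_space M by fact
  interpret finite_measure_subalgebra M G by unfold_locales fact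
  show ?thesis
    by (rule real_cond_exp_F_meas) auto
qed

lemma subalgebra_joined_algebra:
  assumes "subalgebra M G" "y \<in> borel_measurable M"
  shows "subalgebra M (joined_algebra G y)"
proof -
  have sp: "space G = space M" and st: "sets G \<subseteq> sets M"
    using assms(1) by (auto simp: subalgebra_def)
  have gen: "sets G \<union> {y -` A \<inter> space G | A. A \<in> sets borel} \<subseteq> sets M"
    using st assms(2) by (auto simp: sp intro: measurable_sets)
  then have "sets G \<union> {y -` A \<inter> space G | A. A \<in> sets borel} \<subseteq> Pow (space G)"
    using sets.space_closed[of M] sp by auto
  then show ?thesis
    unfolding subalgebra_def joined_algebra_def using gen
    by (simp add: sets_measure_of space_measure_of sp sets.sigma_sets_subset)
qed

text \<open>The instance is noiseless gradient descent on half the squared norm, observed at time \<open>0\<close>.\<close>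

lemma constant_step_bound_lower:
  fixes M :: "'w measure"
  assumes c: "constant_step_bound TYPE('w) TYPE('a::euclidean_space) c" and M: "prob_space M"
  shows "9 / 10 \<le> c"
proof -
  interpret prob_space M by fact
  obtain b :: 'a where b: "norm b = 1"
    using vector_choose_size[of 1] by auto
  define f :: "nat \<Rightarrow> 'w \<Rightarrow> 'a \<Rightarrow> 'a \<Rightarrow> real" where "f = (\<lambda>t \<omega> x u. (norm u)\<^sup>2 / 2)"
  define r :: "nat \<Rightarrow> 'w \<Rightarrow> 'a \<Rightarrow> ereal" where "r = (\<lambda>t \<omega> u. 0)"
  define xbar :: "nat \<Rightarrow> 'w \<Rightarrow> 'a" where "xbar = (\<lambda>t \<omega>. 0)"
  \<comment> \<open>Step size 1 / 2 with the exact gradient, which is the point itself, halves the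
    iterate; hence \<open>x\<close> also serves as the gradient sequence.\<close>
  define x :: "nat \<Rightarrow> 'w \<Rightarrow> 'a" where "x = (\<lambda>t \<omega>. (1 / 2) ^ t *\<^sub>R b)"
  define xhat :: "nat \<Rightarrow> 'w \<Rightarrow> 'a" where
    "xhat = (\<lambda>t \<omega>. snd (avg_prox_run 1 0 (1 / 2) (\<lambda>t. r t \<omega>) (\<lambda>t. x t \<omega>) 0 b t))"
  define F :: "nat \<Rightarrow> 'w measure" where "F = (\<lambda>t. sigma (space M) {})"
  obtain \<omega>0 where \<omega>0: "\<omega>0 \<in> space M" using not_empty by auto
  have gr: "gradient (f t \<omega> y) u = u" for t \<omega> y u
    by (simp add: f_def gradient_half_norm_square)
  have sc: "strongly_convex 1 (f t \<omega> y)" for t \<omega> y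
    using strongly_convex_norm_square[of 1 "0::'a"] by (simp add: f_def)
  have sm: "smooth_with 1 (f t \<omega> y)" for t \<omega> y
    unfolding smooth_with_def gr[abs_def]
    by (auto simp: f_def half_norm_square_differentiable intro!: lipschitz_onI)
  have pcc: "proper_closed_convex (r t \<omega>)" for t \<omega>
  proof -
    have "{(u::'a, s::real). (0::ereal) \<le> ereal s} = UNIV \<times> {0..}" by auto
    then show ?thesis
      by (simp add: proper_closed_convex_def r_def closed_Times convex_Times)
  qed
  have gap: "psi_gap f r xbar t \<omega> u = ereal ((norm u)\<^sup>2 / 2)" for t \<omega> u
    by (simp add: psi_gap_def psi_def f_def r_def xbar_def)
  have arg: "is_arg_min (psi f r xbar t \<omega>) (\<lambda>_. True) (xbar t \<omega>)" for t \<omega>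
    by (simp add: is_arg_min_linorder psi_def f_def r_def xbar_def)
  have ex: "\<exists>x y::'a. x \<noteq> y" using b by (intro exI[of _ b] exI[of _ 0]) auto
  have pl: "ereal 0 = param_lipschitz (space M) f"
  proof -
    have "param_lipschitz (space M) f = (SUP (\<omega>, t, u, x, y) \<in> {(\<omega>, t::nat, u::'a, x::'a, y::'a). \<omega> \<in> space M \<and> x \<noteq> y}. 0)"
      unfolding param_lipschitz_def gr by (intro SUP_cong) auto
    also have "\<dots> = 0"
      using \<omega>0 ex by (subst case_prod_unfold)+ (intro SUP_const, auto)
    finally show ?thesis by simp
  qed
  have drift: "gradient_drift f i t = (\<lambda>_. 0)" for i t
    unfolding gradient_drift_def gr by (auto simp: case_prod_unfold)
  have noise: "gradient_noise f x x t = (\<lambda>_. 0)" for t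
    by (simp add: gradient_noise_def gr fun_eq_iff)
  have subF: "subalgebra M (F t)" for t
    by (simp add: subalgebra_def F_def sigma_sets_empty_eq)
  have filt: "filtration (space M) F"
    by (intro filtration.intro) (auto simp: F_def)
  have F0: "sets (F 0) = {{}, space M}"
    by (simp add: F_def sigma_sets_empty_eq)
  have cmz: "cond_mean_zero M G (\<lambda>_. 0 :: 'a)" if "subalgebra M G" for G
    using real_cond_exp_zero[OF M that] by (simp add: cond_mean_zero_def)
  have subJ: "subalgebra M (joined_algebra (F i) (xbar t))" for i t
    by (intro subalgebra_joined_algebra subF) (simp add: xbar_def)
  have xm: "x t \<in> borel_measurable G" "xbar t \<in> borel_measurable G" for t and G :: "'w measure"
    by (simp_all add: x_def xbar_def)
  have gap0: "psi_gap f r xbar 0 \<omega> (x 0 \<omega>) = ereal ((norm b)\<^sup>2 / 2)" for \<omega>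
    by (simp add: gap x_def)
  have fw: "light_tailed_framework M 1 1 0 f r xbar F x x (1 / 100) (1 / 100)"
  proof (intro light_tailed_framework.intro stochastic_framework.intro decision_dependent_problem.intro
      light_tailed_framework_axioms.intro stochastic_framework_axioms.intro decision_dependent_problem_axioms.intro)
    fix i t :: nat and \<tau> :: real
    assume \<tau>: "0 < \<tau>"
    have "{\<omega> \<in> space M. \<tau> \<le> norm (gradient_noise f x x i \<omega>)} = {}" using \<tau> by (simp add: noise)
    then have "indicat_real {\<omega> \<in> space M. \<tau> \<le> norm (gradient_noise f x x i \<omega>)} = (\<lambda>_. 0)" by (simp only: fun_eq_iff indicator_def empty_iff of_bool_eq simp_thms)
    then show "AE \<omega> in M. cond_probability M (joined_algebra (F i) (xbar t))
        {\<omega> \<in> space M. \<tau> \<le> norm (gradient_noise f x x i \<omega>)} \<omega> \<le> 2 * exp (- 2 * \<tau>\<^sup>2 / (1 / 100)\<^sup>2)"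
      unfolding cond_probability_def
      by (auto intro!: eventually_mono[OF real_cond_exp_zero[OF M subJ[of i t]]])
  next
    show "r s \<omega> = r t \<omega>" for s t \<omega>
      by (simp add: r_def)
  next
    fix i t :: nat and l :: real assume "0 \<le> l"
    then show "(\<integral>\<^sup>+ \<omega>. ennreal (exp (l * (real_of_ereal (gradient_drift f i t \<omega>))\<^sup>2)) \<partial>M)
            \<le> ennreal (exp (l * ((1 - 2 * 0) * (1 / 100) * \<bar>real i - real t\<bar>)\<^sup>2))"
      using ennreal_leI[of 1 "exp (l * (\<bar>real i - real t\<bar> / 100)\<^sup>2)"] by (simp add: drift emeasure_space_1)
  qed (simp_all add: sc sm pcc pl arg filt subF F0 noise cmz subJ drift xm gap0 M)
  have fst_run: "fst (avg_prox_run 1 0 (1 / 2) (\<lambda>t. r t \<omega>) (\<lambda>t. x t \<omega>) 0 b t) = x t \<omega>" for t \<omega>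
  proof (induction t)
    case 0
    then show ?case by (simp add: x_def)
  next
    case (Suc t)
    have "x t \<omega> - (1 / 2) *\<^sub>R x t \<omega> = x (Suc t) \<omega>"
      by (simp add: x_def scaleR_left_diff_distrib[symmetric])
    then show ?case
      using Suc by (simp add: Let_def case_prod_unfold r_def prox_zero)
  qed
  have run: "\<forall>\<omega>\<in>space M. \<forall>t. (x t \<omega>, xhat t \<omega>) =
          avg_prox_run 1 0 (1 / 2) (\<lambda>t. r t \<omega>) (\<lambda>t. x t \<omega>) 0 (x 0 \<omega>) t"
    using fst_run by (auto simp: xhat_def x_def prod_eq_iff)
  have meas: "\<forall>t. (\<lambda>\<omega>. psi_gap f r xbar t \<omega> (xhat t \<omega>)) \<in> borel_measurable M"
    by (simp only: gap xhat_def) (simp add: r_def x_def)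
  \<comment> \<open>At time 0 both gaps equal 1 / 2. Noise and drift parameters 1 / 100 make the
    additive term 9 / 20000, and \<delta> = 99 / 100 keeps the logarithm below 100 / 99, so
    \<open>c\<close> is nearly forced to be 1.\<close>
  let ?S = "{\<omega> \<in> space M. psi_gap f r xbar 0 \<omega> (xhat 0 \<omega>) \<le>
            ereal c *
            (ereal ((1 - (1 - 2 * 0) * (1 / 2) / 2) ^ 0) * psi_gap f r xbar 0 \<omega> (x 0 \<omega>)
              + ereal (1 / 2 * (1 / 100)\<^sup>2 + (1 / 100)\<^sup>2 / ((1 - 2 * 0) * (1 / 2)\<^sup>2))) *
            ereal (ln (exp 1 / (99 / 100)))}"
  \<comment> \<open>Positive probability makes the event nonempty, and its defining inequality does
    not depend on the outcome.\<close>
  have "1 - 99 / 100 \<le> measure M ?S"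
    using c[unfolded constant_step_bound_def, rule_format, OF fw _ _ run[rule_format] meas[rule_format], of "99 / 100" 0]
    by simp
  then have "measure M ?S \<noteq> measure M {}" by simp
  then have "?S \<noteq> {}" by metis
  then obtain \<omega> where "\<omega> \<in> ?S" by blast
  then have "1 / 2 \<le> c * (1 / 2 + (1 / 2 * (1 / 100)\<^sup>2 + (1 / 100)\<^sup>2 / (1 / 2)\<^sup>2)) * ln (exp 1 / (99 / 100))"
    by (simp add: gap xhat_def x_def b)
  moreover have "ln (exp 1 / (99 / 100) :: real) = 1 + ln (100 / 99)"
    by (simp add: ln_div ln_mult)
  moreover have "ln (100 / 99 :: real) \<le> 100 / 99 - 1"
    by (rule ln_le_minus_one) simp
  moreover have "0 \<le> ln (100 / 99 :: real)" by simp
  ultimately have *: "1 / 2 \<le> c * (1 / 2 + 9 / 20000) * (1 + ln (100 / 99))" "1 + ln (100 / 99 :: real) \<le> 100 / 99"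
      "0 \<le> ln (100 / 99 :: real)"
    by (simp_all add: power2_eq_square)
  \<comment> \<open>The sign comes first, because replacing the logarithm by its upper bound
    multiplies an inequality by \<open>c\<close>.\<close>
  have "0 \<le> c"
  proof (rule ccontr)
    assume "\<not> 0 \<le> c"
    then have "c * (1 / 2 + 9 / 20000) * (1 + ln (100 / 99)) \<le> 0"
      using *(3) by (intro mult_nonpos_nonneg) auto
    then show False using *(1) by simp
  qed
  then have "c * (1 / 2 + 9 / 20000) * (1 + ln (100 / 99)) \<le> c * (1 / 2 + 9 / 20000) * (100 / 99)"
    using *(2) by (intro mult_left_mono) auto
  then show ?thesis using *(1) by simp
qed

section \<open>Epoch weights\<close>

lemma one_minus_power_le_exp:
  fixes w :: real
  assumes "w \<le> 1" "y \<le> w * real n"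
  shows "(1 - w) ^ n \<le> exp (- y)"
proof -
  have "(1 - w) ^ n \<le> (exp (- w)) ^ n"
    using assms exp_ge_add_one_self[of "- w"] by (intro power_mono) auto
  also have "\<dots> = exp (- (w * real n))"
    by (simp add: exp_of_nat_mult[symmetric] mult.commute)
  also have "\<dots> \<le> exp (- y)" using assms by simp
  finally show ?thesis .
qed

text \<open>The factor \<open>1 + (1 - (1 - w) ^ m) / 10\<close> pays for the compensator of the noise:
  it is bounded, while its increments absorb the quadratic terms.\<close>

definition epoch_weight :: "real \<Rightarrow> real \<Rightarrow> nat \<Rightarrow> real" where
  "epoch_weight \<Lambda> w m = \<Lambda> * (1 - w) ^ m * (1 + (1 - (1 - w) ^ m) / 10)"

lemma epoch_weight_bounds:
  assumes "0 \<le> \<Lambda>" "0 \<le> w" "w \<le> 1"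
  shows "0 \<le> epoch_weight \<Lambda> w m" "epoch_weight \<Lambda> w m \<le> 11 / 10 * (\<Lambda> * (1 - w) ^ m)"
proof -
  have q: "0 \<le> (1 - w) ^ m" "(1 - w) ^ m \<le> 1"
    using assms by (auto intro: power_le_one)
  then show "0 \<le> epoch_weight \<Lambda> w m"
    using assms unfolding epoch_weight_def by (intro mult_nonneg_nonneg) auto
  have "\<Lambda> * (1 - w) ^ m * (1 + (1 - (1 - w) ^ m) / 10) \<le> \<Lambda> * (1 - w) ^ m * (11 / 10)"
    using assms q by (intro mult_left_mono mult_nonneg_nonneg) auto
  then show "epoch_weight \<Lambda> w m \<le> 11 / 10 * (\<Lambda> * (1 - w) ^ m)"
    by (simp add: epoch_weight_def)
qed

text \<open>With \<open>q = (1 - w) ^ m\<close>, the gain of the weight over plain contraction is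
  exactly \<open>\<Lambda> * q\<^sup>2 * w * (1 - w) / 10\<close>, quadratic in \<open>q\<close>
  like the compensator. The bound 1 / 200 makes the latter at most
  \<open>1936 / 30000 * \<Lambda> * q\<^sup>2 * w\<close>, just below the gain for
  \<open>w \<le> 1 / 3\<close>.\<close>

lemma epoch_weight_Suc:
  assumes \<Lambda>: "0 \<le> \<Lambda>" and w: "0 \<le> w" "w \<le> 1 / 3" and mh: "0 < mh" and we: "w \<le> 2 / 3 * mh * e"
    and \<Lambda>e: "\<Lambda> * e * s \<le> 1 / 200" and s: "0 \<le> s"
  shows "epoch_weight \<Lambda> w m * (1 - w) + 16 * (epoch_weight \<Lambda> w m * w)\<^sup>2 * s / mh \<le> epoch_weight \<Lambda> w (Suc m)"
proof -
  define q where "q = (1 - w) ^ m"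
  have q: "0 \<le> q" "q \<le> 1" using w by (auto simp: q_def intro: power_le_one)
  define t where "t = epoch_weight \<Lambda> w m"
  have t: "0 \<le> t" "t \<le> 11 / 10 * (\<Lambda> * q)"
    using epoch_weight_bounds[OF \<Lambda>, of w m] w by (auto simp: t_def q_def)
  have "w * s * \<Lambda> / mh \<le> 2 / 3 * (\<Lambda> * e * s)"
    using mult_right_mono[OF we, of "s * \<Lambda>"] s \<Lambda> mh by (simp add: field_simps)
  also have "\<dots> \<le> 1 / 300" using \<Lambda>e by simp
  finally have small: "w * s * \<Lambda> / mh \<le> 1 / 300" .
  have "16 * (t * w)\<^sup>2 * s / mh \<le> 16 * ((11 / 10 * (\<Lambda> * q)) * w)\<^sup>2 * s / mh"
    using t w s mh by (intro divide_right_mono mult_right_mono mult_left_mono power_mono) auto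
  also have "\<dots> = 1936 / 100 * (\<Lambda> * q\<^sup>2 * w) * (w * s * \<Lambda> / mh)"
    by (simp add: power2_eq_square field_simps)
  also have "\<dots> \<le> 1936 / 100 * (\<Lambda> * q\<^sup>2 * w) * (1 / 300)"
    using small \<Lambda> w by (intro mult_left_mono) auto
  also have "\<dots> = (\<Lambda> * q\<^sup>2 * w) * (1936 / 30000)" by simp
  also have "\<dots> \<le> (\<Lambda> * q\<^sup>2 * w) * ((1 - w) / 10)"
    using \<Lambda> w by (intro mult_left_mono) auto
  also have "\<dots> = epoch_weight \<Lambda> w (Suc m) - t * (1 - w)"
    by (simp add: t_def epoch_weight_def q_def power2_eq_square field_simps)
  finally show ?thesis by (simp add: t_def)
qed

text \<open>The weight at step \<open>k\<close> refers to the \<open>n - k\<close> steps still to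
  come. Since \<open>V\<close> is at most \<open>4 / mh\<close> times the potential, the compensator
  is a multiple of the potential, which the growth of the weight covers.\<close>

lemma epoch_potential:
  fixes \<Phi> V \<xi> d :: "nat \<Rightarrow> real"
  assumes step: "\<And>j. j < n \<Longrightarrow> \<Phi> (Suc j) \<le> (1 - w) * \<Phi> j + w * (\<xi> j + d j)"
    and V: "\<And>j. j < n \<Longrightarrow> 0 \<le> V j" "\<And>j. j < n \<Longrightarrow> mh / 4 * V j \<le> \<Phi> j"
    and \<Lambda>: "0 \<le> \<Lambda>" and w: "0 \<le> w" "w \<le> 1 / 3" and mh: "0 < mh" and we: "w \<le> 2 / 3 * mh * e"
    and \<Lambda>e: "\<Lambda> * e * s \<le> 1 / 200" and s: "0 \<le> s"
  defines "a \<equiv> \<lambda>j. epoch_weight \<Lambda> w (n - Suc j) * w"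
  shows "\<Lambda> * \<Phi> n \<le> epoch_weight \<Lambda> w n * \<Phi> 0 + (\<Sum>j<n. a j * \<xi> j - 4 * (a j)\<^sup>2 * s * V j + a j * d j)"
proof -
  have w1: "w \<le> 1" using w by simp
  have "epoch_weight \<Lambda> w (n - k) * \<Phi> k
    \<le> epoch_weight \<Lambda> w n * \<Phi> 0 + (\<Sum>j<k. a j * \<xi> j - 4 * (a j)\<^sup>2 * s * V j + a j * d j)" if "k \<le> n" for k
    using that
  proof (induction k)
    case 0
    then show ?case by simp
  next
    case (Suc k)
    then have k: "k < n" by simp
    define m where "m = n - Suc k"
    define t where "t = epoch_weight \<Lambda> w m"
    have t0: "0 \<le> t" using epoch_weight_bounds(1)[OF \<Lambda> w(1) w1] by (simp add: t_def)
    have m: "n - k = Suc m" using k by (simp add: m_def)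
    have a: "a k = t * w" by (simp add: a_def t_def m_def)
    have \<Phi>0: "0 \<le> \<Phi> k"
      using V(1)[OF k] V(2)[OF k] mh by (meson divide_nonneg_nonneg less_imp_le mult_nonneg_nonneg order_trans zero_le_numeral)
    have V': "V k \<le> 4 / mh * \<Phi> k"
      using V(2)[OF k] mh by (simp add: field_simps)
    have quad: "4 * (a k)\<^sup>2 * s * V k \<le> 16 * (t * w)\<^sup>2 * s / mh * \<Phi> k"
      using mult_left_mono[OF V', of "4 * (a k)\<^sup>2 * s"] s by (simp add: a)
    have "epoch_weight \<Lambda> w m * \<Phi> (Suc k) \<le> t * ((1 - w) * \<Phi> k + w * (\<xi> k + d k))"
      unfolding t_def[symmetric] by (intro mult_left_mono step k t0)
    also have "\<dots> = (t * (1 - w) + 16 * (t * w)\<^sup>2 * s / mh) * \<Phi> k - 16 * (t * w)\<^sup>2 * s / mh * \<Phi> k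
        + a k * \<xi> k + a k * d k"
      by (simp add: a distrib_left distrib_right)
    also have "\<dots> \<le> epoch_weight \<Lambda> w (Suc m) * \<Phi> k - 4 * (a k)\<^sup>2 * s * V k + a k * \<xi> k + a k * d k"
      using quad mult_right_mono[OF epoch_weight_Suc[OF \<Lambda> w mh we \<Lambda>e s, of m] \<Phi>0]
      unfolding t_def[symmetric] by linarith
    finally show ?case
      using Suc.IH k unfolding m m_def[symmetric] sum.lessThan_Suc by linarith
  qed
  \<comment> \<open>With no step left the weight is \<Lambda> itself.\<close>
  from this[of n] show ?thesis by (simp add: epoch_weight_def)
qed

text \<open>\<open>h\<close> is a supersolution:
  \<open>w * y\<^sup>2 + (1 - w) * h y \<le> h (y - 1)\<close>, which telescopes. In the application
  \<open>n\<close> is the distance from the end of an epoch to the final time, and \<open>m\<close>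
  counts steps backwards from that end.\<close>

lemma geometric_quadratic_tail:
  fixes w \<nu> n :: real
  assumes w: "\<nu> \<le> w" "w \<le> 1" and \<nu>: "0 < \<nu>" and n: "0 \<le> n"
  defines "h \<equiv> \<lambda>n. 2 * (n + 4 / \<nu>)\<^sup>2"
  shows "(\<Sum>m<T. w * (1 - w) ^ m * (n + real m + 1)\<^sup>2) + (1 - w) ^ T * h (n + real T) \<le> h n"
proof (induction T)
  case 0
  then show ?case by simp
next
  case (Suc T)
  define y where "y = n + real T + 1"
  have y: "1 \<le> y" using n by (simp add: y_def)
  have "w * y\<^sup>2 + (1 - w) * h y \<le> h (y - 1)"
  proof -
    have "4 * (y + 4 / \<nu>) - 2 \<le> \<nu> * (y + 4 / \<nu>) * (y + 4 / \<nu>)"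
    proof -
      \<comment> \<open>The shift \<open>4 / \<nu>\<close> is chosen so that contraction at rate
        \<nu> outweighs the increase of \<open>h\<close> over one unit.\<close>
      have "4 \<le> \<nu> * (y + 4 / \<nu>)" using \<nu> y by (simp add: distrib_left)
      then have "4 * (y + 4 / \<nu>) \<le> \<nu> * (y + 4 / \<nu>) * (y + 4 / \<nu>)"
        using \<nu> y by (intro mult_right_mono) auto
      then show ?thesis by simp
    qed
    also have "\<dots> \<le> w * (y + 4 / \<nu>)\<^sup>2"
      using mult_right_mono[OF w(1), of "(y + 4 / \<nu>)\<^sup>2"] by (simp add: power2_eq_square mult.assoc)
    also have "\<dots> \<le> w * (2 * (y + 4 / \<nu>)\<^sup>2 - y\<^sup>2)"
    proof (intro mult_left_mono)
      have "y\<^sup>2 \<le> (y + 4 / \<nu>)\<^sup>2" using \<nu> y by (intro power_mono) auto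
      then show "(y + 4 / \<nu>)\<^sup>2 \<le> 2 * (y + 4 / \<nu>)\<^sup>2 - y\<^sup>2" by simp
    qed (use w \<nu> in auto)
    finally have "4 * (y + 4 / \<nu>) - 2 \<le> w * h y - w * y\<^sup>2"
      by (simp add: h_def right_diff_distrib)
    moreover have "h y - h (y - 1) = 4 * (y + 4 / \<nu>) - 2"
    proof -
      define u where "u = y + 4 / \<nu>"
      have "y - 1 + 4 / \<nu> = u - 1" by (simp add: u_def)
      then show ?thesis
        unfolding h_def u_def[symmetric] by (simp add: power2_eq_square algebra_simps)
    qed
    ultimately show ?thesis by (simp add: left_diff_distrib)
  qed
  then have "(1 - w) ^ T * (w * y\<^sup>2 + (1 - w) * h y) \<le> (1 - w) ^ T * h (n + real T)"
    using w by (intro mult_left_mono) (auto simp: y_def)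
  then show ?case
    using Suc by (simp add: y_def algebra_simps)
qed

lemma half_rate_power:
  fixes w :: real
  assumes "0 \<le> w" "w \<le> 1"
  shows "(1 - w) ^ m \<le> (1 - w / 2) ^ m" "(1 - w) ^ m \<le> ((1 - w / 2) ^ m)\<^sup>2"
proof -
  show "(1 - w) ^ m \<le> (1 - w / 2) ^ m" using assms by (intro power_mono) auto
  have "1 - w \<le> (1 - w / 2)\<^sup>2" by (simp add: power2_eq_square algebra_simps)
  then have "(1 - w) ^ m \<le> ((1 - w / 2)\<^sup>2) ^ m" using assms by (intro power_mono) auto
  then show "(1 - w) ^ m \<le> ((1 - w / 2) ^ m)\<^sup>2" by (simp add: power_mult[symmetric] mult.commute)
qed

text \<open>Half of the rate is kept for summing the drift; the other half is at most the square
  root of 5 / 18, below 6 / 11, and 33 / 20 * 6 / 11 = 9 / 10 still contracts.\<close>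

lemma reset_factor:
  fixes w :: real
  assumes w: "0 \<le> w" "w \<le> 1" and q: "(1 - w) ^ T \<le> 5 / 18"
  shows "33 / 20 * (1 - w) ^ T \<le> 9 / 10 * (1 - w / 2) ^ T"
proof -
  have "((1 - w) ^ T)\<^sup>2 \<le> 5 / 18 * ((1 - w / 2) ^ T)\<^sup>2"
  proof -
    have "(1 - w) ^ T * (1 - w) ^ T \<le> 5 / 18 * ((1 - w / 2) ^ T)\<^sup>2"
      using w by (intro mult_mono q half_rate_power) auto
    then show ?thesis by (simp add: power2_eq_square)
  qed
  also have "\<dots> \<le> (6 / 11 * (1 - w / 2) ^ T)\<^sup>2"
    by (simp add: power_mult_distrib power2_eq_square)
  finally have "(1 - w) ^ T \<le> 6 / 11 * (1 - w / 2) ^ T"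
    by (rule power2_le_imp_le) (use w in auto)
  then show ?thesis by simp
qed

lemma sum_epochs:
  fixes h :: "nat \<Rightarrow> 'a::comm_monoid_add"
  assumes start: "\<And>k. start k = (\<Sum>i<k. T i)"
  shows "(\<Sum>i<start (Suc k). h i) = (\<Sum>i<start k. h i) + (\<Sum>j<T k. h (start k + j))"
proof -
  have "(\<Sum>i<start k + n. h i) = (\<Sum>i<start k. h i) + (\<Sum>j<n. h (start k + j))" for n
    by (induction n) (simp_all add: add.assoc)
  then show ?thesis by (simp add: start)
qed

text \<open>Epochs of length zero cause no ambiguity: they end no later than they begin, so the
  least epoch ending after the given time skips them.\<close>

lemma epoch_of_time:
  fixes T start :: "nat \<Rightarrow> nat"
  assumes start: "\<And>k. start k = (\<Sum>i<k. T i)" and j: "j < T k"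
  shows "(LEAST l. start k + j < start (Suc l)) = k"
proof -
  have mono: "start l \<le> start l'" if "l \<le> l'" for l l'
    unfolding start using that by (intro sum_mono2) auto
  show ?thesis
  proof (rule Least_equality)
    show "start k + j < start (Suc k)" using j by (simp add: start)
  next
    fix l assume "start k + j < start (Suc l)"
    then have "\<not> Suc l \<le> k" using mono[of "Suc l" k] by auto
    then show "k \<le> l" by simp
  qed
qed

text \<open>The multiplier of the noise and drift terms at time \<open>i\<close> in the unrolled recursion; the weight
  at the start of an epoch is \<open>33 / 20 = 11 / 10 * 3 / 2\<close> times the contraction of the epoch, where
  \<open>3 / 2\<close> is the cost of resetting the iterate to the average.\<close>

definition start_weight :: "real \<Rightarrow> (nat \<Rightarrow> real) \<Rightarrow> (nat \<Rightarrow> nat) \<Rightarrow> nat \<Rightarrow> nat \<Rightarrow> real" where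
  "start_weight \<Lambda> w T K k = \<Lambda> * (\<Prod>l\<in>{k..<K}. 33 / 20 * (1 - w l) ^ T l)"

definition time_weight :: "real \<Rightarrow> (nat \<Rightarrow> real) \<Rightarrow> (nat \<Rightarrow> nat) \<Rightarrow> nat \<Rightarrow> nat \<Rightarrow> real" where
  "time_weight \<Lambda> w T K i =
    (let k = LEAST l. i < (\<Sum>i<Suc l. T i)
     in epoch_weight (start_weight \<Lambda> w T K (Suc k)) (w k) (T k - Suc (i - (\<Sum>i<k. T i))) * w k)"

lemma start_weight_step: "k < K \<Longrightarrow>
    start_weight \<Lambda> w T K k = 33 / 20 * (start_weight \<Lambda> w T K (Suc k) * (1 - w k) ^ T k)"
  by (simp add: start_weight_def prod.atLeast_Suc_lessThan)

lemma start_weight_end: "start_weight \<Lambda> w T K K = \<Lambda>"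
  by (simp add: start_weight_def)

lemma time_weight_epoch:
  fixes T start :: "nat \<Rightarrow> nat"
  assumes start: "\<And>k. start k = (\<Sum>i<k. T i)" and j: "j < T k"
  shows "time_weight \<Lambda> w T K (start k + j)
    = epoch_weight (start_weight \<Lambda> w T K (Suc k)) (w k) (T k - Suc j) * w k"
  using epoch_of_time[OF start j] by (simp add: time_weight_def Let_def start)

section \<open>The epoch schedule\<close>

lemma powr_third_eqI:
  fixes x y :: real
  assumes "0 < x" "x ^ 3 = y"
  shows "y powr (1 / 3) = x"
proof -
  have "x powr 3 = y" using assms by simp
  then have "y powr (1 / 3) = x powr (3 * (1 / 3))" by (simp only: powr_powr[symmetric])
  then show ?thesis using assms by simp
qed

lemma powr_third_cube:
  fixes y :: real
  assumes "0 < y"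
  shows "(y powr (1 / 3)) ^ 3 = y"
proof -
  have "(y powr (1 / 3)) ^ 3 = (y powr (1 / 3)) powr 3" using assms by simp
  also have "\<dots> = y powr (1 / 3 * 3)" by (simp only: powr_powr)
  finally show ?thesis using assms by simp
qed

text \<open>The deterministic side of the problem. \<open>scale\<close> is \<open>\<eta>star\<close>
  without the factor 2 under the cube root, so that \<open>Ghat\<close> becomes
  \<open>\<sigma>\<^sup>2 * scale\<close>; the two bounds on \<open>2 ^ (K - 1)\<close> are what the
  ceiling in the number of epochs provides.\<close>

locale epoch_schedule =
  fixes \<mu> \<gamma> mh L \<Delta> \<sigma> scale \<eta>star D \<delta> c :: real
    and \<eta> :: "nat \<Rightarrow> real" and T start :: "nat \<Rightarrow> nat" and K :: nat
  assumes mh: "0 < mh" "mh = \<mu> - 2 * \<gamma>" and \<gamma>: "0 \<le> \<gamma>" and \<mu>L: "\<mu> \<le> L"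
    and \<sigma>: "0 < \<sigma>" and \<Delta>: "0 < \<Delta>" and D: "0 < D" and \<delta>: "0 < \<delta>" "\<delta> < 1" and c: "9 / 10 \<le> c"
    and scale: "0 < scale" "scale ^ 3 = \<Delta>\<^sup>2 / (mh * \<sigma>\<^sup>2)"
    and \<eta>star: "scale \<le> \<eta>star" "\<eta>star \<le> 2 * scale" "L * \<eta>star \<le> 1 / 2"
    and K: "3 \<le> K" "1 / (L * scale) \<le> 2 ^ (K - 1)" "2 ^ (K - 1) \<le> 2 / (L * scale)"
    and \<eta>_0: "\<eta> 0 = 1 / (2 * L)" and \<eta>_step: "\<And>k. \<eta> (Suc k) = (\<eta> k + \<eta>star) / 2"
    and T_0: "T 0 = nat \<lceil>4 * L / mh * max 0 (ln (L * D / \<sigma>\<^sup>2))\<rceil>"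
    and T_step: "\<And>k. T (Suc k) = nat \<lceil>2 * max 0 (ln (4 * c * ln (exp 1 / \<delta>))) / (mh * \<eta> (Suc k))\<rceil>"
    and start: "\<And>k. start k = (\<Sum>i<k. T i)"
begin

section \<open>Step sizes, contraction rates and epoch lengths\<close>

definition w :: "nat \<Rightarrow> real" where
  "w k = mh * \<eta> k / (2 - \<mu> * \<eta> k)"

lemma mu_pos: "0 < \<mu>" and L_pos: "0 < L" and mh_le: "mh \<le> L"
  using mh \<gamma> \<mu>L by auto

lemma log_ge_1: "1 \<le> ln (exp 1 / \<delta>)"
  using \<delta> by (simp add: ln_div)

lemma eta_eq: "\<eta> k = \<eta>star + (1 / (2 * L) - \<eta>star) / 2 ^ k"
proof (induction k)
  case 0
  then show ?case by (simp add: \<eta>_0)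
next
  case (Suc k)
  then show ?case by (simp add: \<eta>_step field_simps)
qed

lemma etastar_le: "\<eta>star \<le> 1 / (2 * L)"
  using \<eta>star(3) L_pos by (simp add: field_simps)

lemma etastar_pos: "0 < \<eta>star"
  using scale \<eta>star by linarith

lemma eta_ge: "\<eta>star \<le> \<eta> k"
  using etastar_le by (simp add: eta_eq)

lemma eta_pos: "0 < \<eta> k"
  using eta_ge[of k] etastar_pos by linarith

lemma eta_le: "\<eta> k \<le> 1 / (2 * L)"
proof -
  have "(1 / (2 * L) - \<eta>star) / 2 ^ k \<le> (1 / (2 * L) - \<eta>star) / 1"
    using etastar_le by (intro divide_left_mono) auto
  then show ?thesis by (simp add: eta_eq)
qed

lemma eta_half: "\<eta> k \<le> 2 * \<eta> (Suc k)"
  using etastar_pos by (simp add: \<eta>_step)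

lemma eta_ge_power: "1 / (2 * L * 2 ^ k) \<le> \<eta> k"
proof (induction k)
  case 0
  then show ?case by (simp add: \<eta>_0)
next
  case (Suc k)
  then show ?case using eta_half[of k] by (simp add: field_simps)
qed

text \<open>The number of epochs is made for this: \<open>K - 1\<close> halvings reduce the excess
  over \<open>\<eta>star\<close> to at most \<open>scale / 2\<close>.\<close>

lemma eta_last: "\<eta> (K - 1) \<le> 2 * \<eta>star"
proof -
  have "(1 / (2 * L) - \<eta>star) / 2 ^ (K - 1) \<le> (1 / (2 * L)) / 2 ^ (K - 1)"
    using etastar_pos by (intro divide_right_mono) auto
  also have "\<dots> \<le> (1 / (2 * L)) / (1 / (L * scale))"
    using K(2) L_pos scale by (intro divide_left_mono) auto
  also have "\<dots> = scale / 2" using L_pos by simp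
  finally show ?thesis using \<eta>star(1) scale(1) eta_eq[of "K - 1"] by linarith
qed

lemma mu_eta: "\<mu> * \<eta> k \<le> 1 / 2" "mh * \<eta> k \<le> 1 / 2"
proof -
  have "L * \<eta> k \<le> 1 / 2" using eta_le[of k] L_pos by (simp add: field_simps)
  moreover have "\<mu> * \<eta> k \<le> L * \<eta> k" "mh * \<eta> k \<le> L * \<eta> k"
    using \<mu>L mh_le eta_pos[of k] by (auto intro!: mult_right_mono)
  ultimately show "\<mu> * \<eta> k \<le> 1 / 2" "mh * \<eta> k \<le> 1 / 2" by auto
qed

text \<open>By \<open>mu_eta\<close> the denominator of \<open>w\<close> lies between 3 / 2 and
  2.\<close>

lemma w_bounds: "0 < w k" "w k \<le> 1 / 3" "w k \<le> 2 / 3 * mh * \<eta> k" "mh * \<eta> k / 2 \<le> w k"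
proof -
  have p: "0 < mh * \<eta> k" "0 \<le> \<mu> * \<eta> k" using mh(1) mu_pos eta_pos[of k] by auto
  show "0 < w k" using p mu_eta[of k] by (simp add: w_def)
  have "w k \<le> mh * \<eta> k / (3 / 2)"
    unfolding w_def using p mu_eta[of k] by (intro divide_left_mono) auto
  then show "w k \<le> 2 / 3 * mh * \<eta> k" by simp
  then show "w k \<le> 1 / 3" using mu_eta[of k] by simp
  show "mh * \<eta> k / 2 \<le> w k"
    unfolding w_def using p mu_eta[of k] by (intro divide_left_mono) auto
qed

lemma w_ge: "mh * \<eta>star / 2 \<le> w k"
  using w_bounds(4)[of k] mult_left_mono[OF eta_ge[of k] less_imp_le[OF mh(1)]] by simp

lemma w_le_1: "w k \<le> 1"
  using w_bounds(2)[of k] by simp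

text \<open>The length turns \<open>w \<ge> mh * \<eta> / 2\<close> into an exponent of at least
  \<open>ln (4 * c * ln (exp 1 / \<delta>))\<close>. As \<open>c \<ge> 9 / 10\<close> and the inner
  logarithm is at least 1, this is at least \<open>ln (18 / 5)\<close>.\<close>

lemma epoch_contraction: "(1 - w (Suc k)) ^ T (Suc k) \<le> 5 / 18"
proof -
  define l where "l = max 0 (ln (4 * c * ln (exp 1 / \<delta>)))"
  have "2 * l / (mh * \<eta> (Suc k)) \<le> real (T (Suc k))"
    unfolding T_step l_def by linarith
  then have "l \<le> mh * \<eta> (Suc k) / 2 * real (T (Suc k))"
    using mh(1) eta_pos[of "Suc k"] by (simp add: field_simps)
  also have "\<dots> \<le> w (Suc k) * real (T (Suc k))"
    using w_bounds(4) by (intro mult_right_mono) auto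
  finally have "(1 - w (Suc k)) ^ T (Suc k) \<le> exp (- l)"
    using w_le_1 by (intro one_minus_power_le_exp)
  also have "\<dots> \<le> exp (- ln (18 / 5))"
  proof -
    have "18 / 5 * 1 \<le> 4 * c * ln (exp 1 / \<delta>)"
      using c log_ge_1 by (intro mult_mono) auto
    then have "ln (18 / 5) \<le> ln (4 * c * ln (exp 1 / \<delta>))" by (simp add: ln_mono)
    then show ?thesis by (simp add: l_def)
  qed
  also have "\<dots> = 5 / 18" by (simp add: exp_minus)
  finally show ?thesis .
qed

text \<open>The first epoch lasts until \<open>D\<close> has come down to the noise level of its
  step size, \<open>\<sigma>\<^sup>2 / L = 2 * \<eta> 0 * \<sigma>\<^sup>2\<close>.\<close>

lemma initial_contraction: "(1 - w 0) ^ T 0 * D \<le> \<sigma>\<^sup>2 / L"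
proof -
  define l where "l = max 0 (ln (L * D / \<sigma>\<^sup>2))"
  have "4 * L / mh * l \<le> real (T 0)"
    unfolding T_0 l_def by linarith
  then have "l \<le> mh * \<eta> 0 / 2 * real (T 0)"
    using mh(1) L_pos by (simp add: \<eta>_0 field_simps)
  also have "\<dots> \<le> w 0 * real (T 0)"
    using w_bounds(4) by (intro mult_right_mono) auto
  finally have "(1 - w 0) ^ T 0 \<le> exp (- l)"
    using w_le_1 by (intro one_minus_power_le_exp)
  then have "(1 - w 0) ^ T 0 * D \<le> exp (- l) * D"
    using D by (intro mult_right_mono) auto
  also have "\<dots> \<le> exp (- ln (L * D / \<sigma>\<^sup>2)) * D"
    using D by (simp add: l_def)
  also have "\<dots> = \<sigma>\<^sup>2 / L"
    using D L_pos \<sigma> by (simp add: exp_minus)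
  finally show ?thesis .
qed

text \<open>The factor with which the final gap is exponentiated: the largest one meeting the
  condition 1 / 200 of \<open>epoch_weight_Suc\<close> in the last epoch.\<close>

definition lam :: real where "lam = 1 / (200 * \<eta> (K - 1) * \<sigma>\<^sup>2)"

definition sw :: "nat \<Rightarrow> real" where "sw = start_weight lam w T K"

definition tw :: "nat \<Rightarrow> real" where "tw = time_weight lam w T K"

lemma lam_pos: "0 < lam"
  using eta_pos \<sigma> by (simp add: lam_def)

lemma sw_step: "k < K \<Longrightarrow> sw k = 33 / 20 * (sw (Suc k) * (1 - w k) ^ T k)"
  by (simp add: sw_def start_weight_step)

lemma sw_end: "sw K = lam"
  by (simp add: sw_def start_weight_end)

lemma sw_pos: "0 < sw k"
proof -
  have "0 < 1 - w l" for l using w_bounds(2)[of l] by simp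
  then show ?thesis
    unfolding sw_def start_weight_def using lam_pos by (intro mult_pos_pos prod_pos) auto
qed

lemma tw_epoch: "j < T k \<Longrightarrow> tw (start k + j) = epoch_weight (sw (Suc k)) (w k) (T k - Suc j) * w k"
  unfolding tw_def sw_def by (rule time_weight_epoch[OF start])

lemma tw_epoch_bounds:
  assumes "j < T k"
  shows "0 \<le> tw (start k + j)" "tw (start k + j) \<le> 11 / 10 * sw (Suc k) * (w k * (1 - w k) ^ (T k - Suc j))"
proof -
  note e = epoch_weight_bounds[of "sw (Suc k)" "w k" "T k - Suc j"]
  have p: "0 \<le> sw (Suc k)" "0 \<le> w k" "w k \<le> 1"
    using sw_pos[of "Suc k"] w_bounds(1)[of k] w_le_1[of k] by auto
  show "0 \<le> tw (start k + j)"
    using e(1)[OF p] p by (simp add: tw_epoch[OF assms])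
  show "tw (start k + j) \<le> 11 / 10 * sw (Suc k) * (w k * (1 - w k) ^ (T k - Suc j))"
    using mult_right_mono[OF e(2)[OF p] p(2)] by (simp add: tw_epoch[OF assms] mult_ac)
qed

text \<open>Backwards over one epoch the weight gains at most 33 / 20 * 5 / 18 = 11 / 24, less than
  the 1 / 2 that would balance a doubled step size.\<close>

lemma sw_eta_step:
  assumes "Suc k < K"
  shows "sw (Suc k) * \<eta> k \<le> 11 / 12 * (sw (Suc (Suc k)) * \<eta> (Suc k))"
proof -
  have "sw (Suc k) \<le> 33 / 20 * (sw (Suc (Suc k)) * (5 / 18))"
    unfolding sw_step[OF assms] using sw_pos[of "Suc (Suc k)"] epoch_contraction[of k]
    by (intro mult_left_mono) auto
  then have "sw (Suc k) * \<eta> k \<le> 33 / 20 * (sw (Suc (Suc k)) * (5 / 18)) * (2 * \<eta> (Suc k))"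
    using sw_pos[of "Suc (Suc k)"] eta_half[of k] eta_pos[of k] by (intro mult_mono) auto
  then show ?thesis by (simp add: mult_ac)
qed

lemma sw_eta: "k < K \<Longrightarrow> sw (Suc k) * \<eta> k * \<sigma>\<^sup>2 \<le> 1 / 200"
proof -
  assume k: "k < K"
  \<comment> \<open>Backward induction from the last epoch, where \<open>lam\<close> gives
    equality.\<close>
  have "sw (Suc k) * \<eta> k \<le> lam * \<eta> (K - 1)"
    using k
  proof (induction "K - Suc k" arbitrary: k)
    case 0
    then have "K = Suc k" by simp
    then show ?case using sw_end by auto
  next
    case (Suc n)
    then have k: "Suc k < K" by simp
    have "0 \<le> sw (Suc (Suc k)) * \<eta> (Suc k)"
      using sw_pos[of "Suc (Suc k)"] eta_pos[of "Suc k"] by simp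
    then have "sw (Suc k) * \<eta> k \<le> sw (Suc (Suc k)) * \<eta> (Suc k)"
      using sw_eta_step[OF k] by linarith
    also have "\<dots> \<le> lam * \<eta> (K - 1)"
      using Suc k by (intro Suc.hyps(1)) auto
    finally show ?case .
  qed
  then have "sw (Suc k) * \<eta> k * \<sigma>\<^sup>2 \<le> lam * \<eta> (K - 1) * \<sigma>\<^sup>2"
    by (intro mult_right_mono) auto
  also have "\<dots> = 1 / 200"
    using eta_pos[of "K - 1"] \<sigma> by (simp add: lam_def)
  finally show ?thesis .
qed

text \<open>The 12 is the sum of the geometric series with ratio 11 / 12.\<close>

lemma sum_sw_eta: "k < K \<Longrightarrow> (\<Sum>l<Suc k. sw (Suc l) * \<eta> l) \<le> 12 * (sw (Suc k) * \<eta> k)"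
proof (induction k)
  case 0
  then show ?case using sw_pos[of "Suc 0"] eta_pos[of 0] by simp
next
  case (Suc k)
  then have "(\<Sum>l<Suc k. sw (Suc l) * \<eta> l) \<le> 12 * (sw (Suc k) * \<eta> k)" by simp
  then show ?case
    using sw_eta_step[OF Suc.prems] unfolding sum.lessThan_Suc[of _ "Suc k"] by linarith
qed

lemma geometric_sum_w: "(\<Sum>j<n. w k * (1 - w k) ^ (n - Suc j)) \<le> 1"
proof -
  have "(\<Sum>j<n. w k * (1 - w k) ^ (n - Suc j)) = w k * (\<Sum>j<n. (1 - w k) ^ j)"
    by (simp add: sum_distrib_left[symmetric] sum.nat_diff_reindex)
  also have "\<dots> = 1 - (1 - w k) ^ n"
    using w_bounds(1)[of k] by (simp add: sum_gp_strict)
  also have "\<dots> \<le> 1" using w_le_1[of k] by simp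
  finally show ?thesis .
qed

definition epoch_of :: "nat \<Rightarrow> nat" where
  "epoch_of i = (LEAST k. i < start (Suc k))"

lemma epoch_of: "j < T k \<Longrightarrow> epoch_of (start k + j) = k"
  unfolding epoch_of_def by (rule epoch_of_time[OF start])

lemma time_decompose:
  assumes "i < start n"
  obtains k j where "k < n" "j < T k" "i = start k + j"
  using assms
proof (induction n arbitrary: thesis)
  case 0
  then show ?case by (simp add: start)
next
  case (Suc n)
  show ?case
  proof (cases "i < start n")
    case True
    then show ?thesis using Suc.IH[of thesis] Suc.prems(1) less_SucI by blast
  next
    case False
    then show ?thesis
      using Suc.prems(2) by (intro Suc.prems(1)[of n "i - start n"]) (auto simp: start)
  qed
qed

lemma tw_nonneg: "i < start n \<Longrightarrow> 0 \<le> tw i"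
  by (erule time_decompose) (simp add: tw_epoch_bounds)

text \<open>The condition \<open>b * \<sigma>\<^sup>2 \<le> 1 / 2\<close> of the noise estimates,
  for \<open>b = tw * \<eta>\<close>.\<close>

lemma tw_eta_small:
  assumes "i < start K"
  shows "tw i * \<eta> (epoch_of i) * \<sigma>\<^sup>2 \<le> 1 / 2"
proof -
  obtain k j where kj: "k < K" "j < T k" "i = start k + j"
    using time_decompose[OF assms] by blast
  have "w k * (1 - w k) ^ (T k - Suc j) \<le> 1"
    using w_bounds[of k] w_le_1[of k] by (intro mult_le_one power_le_one) auto
  then have "11 / 10 * sw (Suc k) * (w k * (1 - w k) ^ (T k - Suc j)) \<le> 11 / 10 * sw (Suc k) * 1"
    using sw_pos[of "Suc k"] by (intro mult_left_mono) auto
  then have "tw i \<le> 11 / 10 * sw (Suc k) * 1"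
    using tw_epoch_bounds(2)[OF kj(2)] unfolding kj(3) by linarith
  then have "tw i * (\<eta> k * \<sigma>\<^sup>2) \<le> 11 / 10 * sw (Suc k) * 1 * (\<eta> k * \<sigma>\<^sup>2)"
    using eta_pos[of k] by (intro mult_right_mono) auto
  then show ?thesis
    using sw_eta[OF kj(1)] kj by (simp add: epoch_of mult_ac)
qed

text \<open>The total of the deterministic compensators \<open>2 * b * \<sigma>\<^sup>2\<close> for
  the squared noise; the constant is 11 / 5 * 12 / 200.\<close>

lemma sum_tw_eta: "(\<Sum>i<start K. tw i * (2 * \<eta> (epoch_of i) * \<sigma>\<^sup>2)) \<le> 33 / 250"
proof -
  have "(\<Sum>i<start k. tw i * (2 * \<eta> (epoch_of i) * \<sigma>\<^sup>2))
      \<le> 11 / 5 * \<sigma>\<^sup>2 * (\<Sum>l<k. sw (Suc l) * \<eta> l)" for k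
  proof (induction k)
    case 0
    then show ?case by (simp add: start)
  next
    case (Suc k)
    have "(\<Sum>j<T k. tw (start k + j) * (2 * \<eta> (epoch_of (start k + j)) * \<sigma>\<^sup>2))
      \<le> (\<Sum>j<T k. 11 / 10 * sw (Suc k) * (w k * (1 - w k) ^ (T k - Suc j)) * (2 * \<eta> k * \<sigma>\<^sup>2))"
    proof (intro sum_mono)
      fix j assume "j \<in> {..<T k}"
      then have j: "j < T k" by simp
      have "0 \<le> 2 * \<eta> k * \<sigma>\<^sup>2" using eta_pos[of k] by simp
      from mult_right_mono[OF tw_epoch_bounds(2)[OF j] this]
      show "tw (start k + j) * (2 * \<eta> (epoch_of (start k + j)) * \<sigma>\<^sup>2)
          \<le> 11 / 10 * sw (Suc k) * (w k * (1 - w k) ^ (T k - Suc j)) * (2 * \<eta> k * \<sigma>\<^sup>2)"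
        by (simp only: epoch_of[OF j])
    qed
    also have "\<dots> = 11 / 5 * \<sigma>\<^sup>2 * (sw (Suc k) * \<eta> k) * (\<Sum>j<T k. w k * (1 - w k) ^ (T k - Suc j))"
      unfolding sum_distrib_left by (intro sum.cong) auto
    also have "\<dots> \<le> 11 / 5 * \<sigma>\<^sup>2 * (sw (Suc k) * \<eta> k) * 1"
      using sw_pos[of "Suc k"] eta_pos[of k] by (intro mult_left_mono geometric_sum_w) auto
    finally show ?case
      using Suc by (simp add: sum_epochs[OF start] distrib_left)
  qed
  also have "11 / 5 * \<sigma>\<^sup>2 * (\<Sum>l<K. sw (Suc l) * \<eta> l) \<le> 11 / 5 * \<sigma>\<^sup>2 * (12 * (sw K * \<eta> (K - 1)))"
    using sum_sw_eta[of "K - 1"] K(1) by (intro mult_left_mono) auto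
  also have "\<dots> \<le> 33 / 250"
    using sw_eta[of "K - 1"] K(1) by (simp add: mult_ac)
  finally show ?thesis .
qed

text \<open>The 2 is the loss in moving the initial gap to the final time.\<close>

lemma sw_initial: "sw 0 * (2 * D) \<le> 33 / 1000"
proof -
  have "sw 0 * (2 * D) = 33 / 10 * sw (Suc 0) * ((1 - w 0) ^ T 0 * D)"
    using sw_step[of 0] K(1) by simp
  also have "\<dots> \<le> 33 / 10 * sw (Suc 0) * (\<sigma>\<^sup>2 / L)"
    using initial_contraction sw_pos[of "Suc 0"] by (intro mult_left_mono) auto
  also have "\<dots> = 33 / 5 * (sw (Suc 0) * \<eta> 0 * \<sigma>\<^sup>2)" by (simp add: \<eta>_0)
  also have "\<dots> \<le> 33 / 1000" using sw_eta[of 0] K(1) by (simp add: mult_ac)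
  finally show ?thesis .
qed

text \<open>The second summand on the left is the drift incurred in moving the initial gap to the
  final time. The order of the bound says that the method remembers about
  \<open>1 / (mh * \<eta>star)\<close> steps.\<close>

lemma drift_weight:
  "(\<Sum>i<start K. tw i * (real (start K) - real i)\<^sup>2) + 6 * sw 0 * (real (start K))\<^sup>2
    \<le> 2560 * lam / (mh * \<eta>star)\<^sup>2"
proof -
  define \<nu> where "\<nu> = mh * \<eta>star / 4"
  define h where "h n = 2 * (n + 4 / \<nu>)\<^sup>2" for n
  let ?N = "real (start K)"
  have \<nu>: "0 < \<nu>" using mh(1) etastar_pos by (simp add: \<nu>_def)
  have nu_le: "\<nu> \<le> w k / 2" for k
    using w_ge[of k] unfolding \<nu>_def by linarith
  have h0: "0 \<le> h n" for n by (simp add: h_def)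
  have le: "start k \<le> start K" if "k \<le> K" for k
    unfolding start using that by (intro sum_mono2) auto
  \<comment> \<open>Passing to the rate \<open>w / 2\<close> doubles 11 / 10 to 11 / 5. The
    subtracted term is kept, since it cancels part of what earlier epochs contribute.\<close>
  have epoch: "(\<Sum>j<T k. tw (start k + j) * (?N - real (start k + j))\<^sup>2)
      \<le> 11 / 5 * sw (Suc k) * (h (?N - real (start (Suc k))) - (1 - w k / 2) ^ T k * h (?N - real (start k)))"
    if k: "k < K" for k
  proof -
    define n where "n = ?N - real (start (Suc k))"
    have n: "0 \<le> n" using le[of "Suc k"] k by (simp add: n_def)
    have nk: "?N - real (start k) = n + real (T k)" by (simp add: n_def start)
    have "(\<Sum>j<T k. tw (start k + j) * (?N - real (start k + j))\<^sup>2)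
        \<le> (\<Sum>j<T k. 11 / 5 * sw (Suc k) * (w k / 2 * (1 - w k / 2) ^ (T k - Suc j) * (n + real (T k - Suc j) + 1)\<^sup>2))"
    proof (intro sum_mono)
      fix j assume "j \<in> {..<T k}"
      then have j: "j < T k" by simp
      have e: "?N - real (start k + j) = n + real (T k - Suc j) + 1"
        using j nk by (simp add: of_nat_diff)
      have "tw (start k + j) \<le> 11 / 10 * sw (Suc k) * (w k * (1 - w k) ^ (T k - Suc j))"
        by (rule tw_epoch_bounds[OF j])
      also have "\<dots> \<le> 11 / 10 * sw (Suc k) * (w k * (1 - w k / 2) ^ (T k - Suc j))"
        using sw_pos[of "Suc k"] w_bounds(1)[of k] w_le_1[of k]
        by (intro mult_left_mono half_rate_power) auto
      finally have "tw (start k + j) \<le> 11 / 5 * sw (Suc k) * (w k / 2 * (1 - w k / 2) ^ (T k - Suc j))"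
        by simp
      then have "tw (start k + j) * (n + real (T k - Suc j) + 1)\<^sup>2
        \<le> 11 / 5 * sw (Suc k) * (w k / 2 * (1 - w k / 2) ^ (T k - Suc j)) * (n + real (T k - Suc j) + 1)\<^sup>2"
        by (intro mult_right_mono) auto
      then show "tw (start k + j) * (?N - real (start k + j))\<^sup>2
          \<le> 11 / 5 * sw (Suc k) * (w k / 2 * (1 - w k / 2) ^ (T k - Suc j) * (n + real (T k - Suc j) + 1)\<^sup>2)"
        unfolding e by (simp add: mult.assoc)
    qed
    also have "\<dots> = 11 / 5 * sw (Suc k) * (\<Sum>m<T k. w k / 2 * (1 - w k / 2) ^ m * (n + real m + 1)\<^sup>2)"
      unfolding sum_distrib_left[symmetric]
      by (subst sum.nat_diff_reindex[of "\<lambda>m. w k / 2 * (1 - w k / 2) ^ m * (n + real m + 1)\<^sup>2"]) simp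
    also have "\<dots> \<le> 11 / 5 * sw (Suc k) * (h n - (1 - w k / 2) ^ T k * h (n + real (T k)))"
    proof (intro mult_left_mono)
      have "\<nu> \<le> w k / 2" by (rule nu_le)
      moreover have "w k / 2 \<le> 1" using w_le_1[of k] by simp
      ultimately show "(\<Sum>m<T k. w k / 2 * (1 - w k / 2) ^ m * (n + real m + 1)\<^sup>2)
          \<le> h n - (1 - w k / 2) ^ T k * h (n + real (T k))"
        using geometric_quadratic_tail[of \<nu> "w k / 2" n "T k"] \<nu> n unfolding h_def by linarith
    qed (use sw_pos[of "Suc k"] in auto)
    finally show ?thesis by (simp add: nk n_def)
  qed
  have mono: "(1 - w k / 2) ^ T k * h (?N - real (start k)) \<le> h (?N - real (start (Suc k)))" if k: "k < K" for k
  proof -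
    define n where "n = ?N - real (start (Suc k))"
    have n: "0 \<le> n" using le[of "Suc k"] k by (simp add: n_def)
    have nk: "?N - real (start k) = n + real (T k)" by (simp add: n_def start)
    have "w k / 2 \<le> 1" using w_le_1[of k] by simp
    moreover have "0 \<le> (\<Sum>m<T k. w k / 2 * (1 - w k / 2) ^ m * (n + real m + 1)\<^sup>2)"
      using w_bounds(1)[of k] w_le_1[of k] by (intro sum_nonneg mult_nonneg_nonneg) auto
    ultimately have "(1 - w k / 2) ^ T k * h (n + real (T k)) \<le> h n"
      using geometric_quadratic_tail[of \<nu> "w k / 2" n "T k"] \<nu> n nu_le[of k] unfolding h_def by linarith
    then show ?thesis by (simp only: nk n_def[symmetric])
  qed
  \<comment> \<open>The constant 5 is dictated by the first epoch, where the transported initial gap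
    leads to 6 * 33 / 20 / 2 = 99 / 20; later epochs need only 9 / 2.\<close>
  have claim: "(\<Sum>i<start (Suc k). tw i * (?N - real i)\<^sup>2) + 6 * sw 0 * ?N\<^sup>2
      \<le> 5 * sw (Suc k) * h (?N - real (start (Suc k)))" if "k < K" for k
    using that
  proof (induction k)
    case 0
    let ?q = "(1 - w 0 / 2) ^ T 0"
    let ?h = "h (?N - real (start (Suc 0)))"
    have q: "0 \<le> ?q * h ?N" "0 \<le> ?q" using w_le_1[of 0] h0 by auto
    have mono0: "?q * h ?N \<le> ?h"
      using mono[OF 0] by (simp add: start)
    have "?N\<^sup>2 \<le> h ?N / 2"
      using \<nu> unfolding h_def by (simp add: power_mono)
    have "6 * sw 0 * ?N\<^sup>2 \<le> 6 * sw 0 * (h ?N / 2)"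
      using sw_pos[of 0] \<open>?N\<^sup>2 \<le> h ?N / 2\<close> by (intro mult_left_mono) auto
    also have "\<dots> = 99 / 20 * sw (Suc 0) * ((1 - w 0) ^ T 0 * h ?N)"
      using sw_step[OF 0] by simp
    also have "\<dots> \<le> 99 / 20 * sw (Suc 0) * (?q * h ?N)"
      using sw_pos[of "Suc 0"] w_bounds(1)[of 0] w_le_1[of 0] h0
      by (intro mult_left_mono mult_right_mono half_rate_power) auto
    finally have 1: "6 * sw 0 * ?N\<^sup>2 \<le> 99 / 20 * sw (Suc 0) * (?q * h ?N)" .
    have 2: "(\<Sum>i<start (Suc 0). tw i * (?N - real i)\<^sup>2) \<le> 11 / 5 * sw (Suc 0) * (?h - ?q * h ?N)"
      using epoch[OF 0] sum_epochs[OF start, of "\<lambda>i. tw i * (?N - real i)\<^sup>2" 0] by (simp add: start)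
    have "(\<Sum>i<start (Suc 0). tw i * (?N - real i)\<^sup>2) + 6 * sw 0 * ?N\<^sup>2
        \<le> sw (Suc 0) * (11 / 5 * ?h + 11 / 4 * (?q * h ?N))"
      using 1 2 by (simp add: algebra_simps)
    also have "\<dots> \<le> sw (Suc 0) * (5 * ?h)"
      using mono0 h0[of "?N - real (start (Suc 0))"] sw_pos[of "Suc 0"] by (intro mult_left_mono) auto
    finally show ?case by simp
  next
    case (Suc k)
    let ?q = "(1 - w (Suc k) / 2) ^ T (Suc k)"
    let ?h = "h (?N - real (start (Suc (Suc k))))" and ?h' = "h (?N - real (start (Suc k)))"
    let ?s = "sw (Suc (Suc k))"
    have IH: "(\<Sum>i<start (Suc k). tw i * (?N - real i)\<^sup>2) + 6 * sw 0 * ?N\<^sup>2 \<le> 5 * sw (Suc k) * ?h'"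
      using Suc by simp
    have "5 * sw (Suc k) * ?h' = 5 * ?s * (33 / 20 * (1 - w (Suc k)) ^ T (Suc k) * ?h')"
      using sw_step[OF Suc.prems] by simp
    also have "\<dots> \<le> 5 * ?s * (9 / 10 * ?q * ?h')"
      using sw_pos[of "Suc (Suc k)"] w_bounds(1)[of "Suc k"] w_le_1[of "Suc k"] h0
      by (intro mult_left_mono mult_right_mono reset_factor epoch_contraction) auto
    finally have 1: "5 * sw (Suc k) * ?h' \<le> ?s * (9 / 2 * (?q * ?h'))" by (simp add: mult_ac)
    have 2: "(\<Sum>i<start (Suc (Suc k)). tw i * (?N - real i)\<^sup>2) + 6 * sw 0 * ?N\<^sup>2
        \<le> 5 * sw (Suc k) * ?h' + 11 / 5 * ?s * (?h - ?q * ?h')"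
      using IH epoch[OF Suc.prems] sum_epochs[OF start, of "\<lambda>i. tw i * (?N - real i)\<^sup>2" "Suc k"] by linarith
    also have "\<dots> \<le> ?s * (9 / 2 * (?q * ?h')) + 11 / 5 * ?s * (?h - ?q * ?h')"
      using 1 by (rule add_right_mono)
    also have "\<dots> = ?s * (11 / 5 * ?h + 23 / 10 * (?q * ?h'))"
    proof -
      have "s * (9 / 2 * X) + 11 / 5 * s * (Y - X) = s * (11 / 5 * Y + 23 / 10 * X)" for s X Y :: real
        by (simp add: field_simps)
      then show ?thesis .
    qed
    also have "\<dots> \<le> ?s * (5 * ?h)"
    proof (rule mult_left_mono)
      show "11 / 5 * ?h + 23 / 10 * (?q * ?h') \<le> 5 * ?h"
        using mono[OF Suc.prems] h0[of "?N - real (start (Suc (Suc k)))"] by linarith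
      show "0 \<le> ?s" using sw_pos[of "Suc (Suc k)"] by linarith
    qed
    finally show ?case by (simp only: mult_ac)
  qed
  have "(\<Sum>i<start K. tw i * (?N - real i)\<^sup>2) + 6 * sw 0 * ?N\<^sup>2 \<le> 5 * lam * h 0"
    using claim[of "K - 1"] K(1) sw_end by simp
  \<comment> \<open>Here \<open>5 * h 0 = 10 * (16 / (mh * \<eta>star))\<^sup>2\<close>.\<close>
  also have "\<dots> = 2560 * lam / (mh * \<eta>star)\<^sup>2"
    using mh(1) etastar_pos by (simp add: h_def \<nu>_def power_divide power_mult_distrib)
  finally show ?thesis .
qed

end

section \<open>Length of the horizon and the pathwise tracking bound\<close>

context epoch_schedule
begin

text \<open>An epoch without steps would not contract. Positivity is needed because drift bounds are
  available only for times strictly before the horizon.\<close>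

lemma start_K_pos: "0 < start K"
proof -
  have "T (Suc 0) \<noteq> 0" using epoch_contraction[of 0] by (intro notI) simp
  moreover have "T (Suc 0) \<le> start K"
    unfolding start using K(1) by (intro member_le_sum) auto
  ultimately show ?thesis by simp
qed

text \<open>Step sizes at most halve, so the bounds on the epoch lengths double and their sum is
  governed by \<open>2 ^ (K - 1) \<le> 2 / (L * scale)\<close>. The dependence on \<open>c\<close>
  comes from bounding \<open>ln (4 * c)\<close> linearly.\<close>

lemma horizon_bound:
  "real (start K) \<le> 4 * (L / mh * max 0 (ln (L * D / \<sigma>\<^sup>2)))
     + (18 + 64 * c) * (1 / (mh * scale) * max 1 (ln (ln (exp 1 / \<delta>))))"
proof -
  define A where "A = L / mh * max 0 (ln (L * D / \<sigma>\<^sup>2))"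
  define lg where "lg = max 0 (ln (4 * c * ln (exp 1 / \<delta>)))"
  define m where "m = max 1 (ln (ln (exp 1 / \<delta>)))"
  have nat_ceil: "real (nat \<lceil>y\<rceil>) \<le> y + 1" if "0 \<le> y" for y :: real
    using that by linarith
  have lg0: "0 \<le> lg" and m1: "1 \<le> m" by (auto simp: lg_def m_def)
  have lg: "lg \<le> (1 + 4 * c) * m"
  proof -
    have "ln (4 * c * ln (exp 1 / \<delta>)) = ln (4 * c) + ln (ln (exp 1 / \<delta>))"
      using c log_ge_1 by (subst ln_mult) auto
    also have "\<dots> \<le> 4 * c + m"
      using ln_le_minus_one[of "4 * c"] c by (simp add: m_def)
    also have "\<dots> \<le> (1 + 4 * c) * m"
      using mult_left_mono[OF m1, of "4 * c"] c by (simp add: distrib_right)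
    finally show ?thesis using c m1 by (simp add: lg_def)
  qed
  have T0: "real (T 0) \<le> 4 * A + 1"
  proof -
    have "0 \<le> 4 * L / mh * max 0 (ln (L * D / \<sigma>\<^sup>2))" using L_pos mh(1) by simp
    from nat_ceil[OF this] show ?thesis by (simp add: T_0 A_def)
  qed
  have TS: "real (T (Suc k)) \<le> 4 * L * lg / mh * 2 ^ Suc k + 1" for k
  proof -
    have "0 \<le> 2 * lg / (mh * \<eta> (Suc k))" using lg0 mh(1) eta_pos[of "Suc k"] by simp
    then have "real (T (Suc k)) \<le> 2 * lg / (mh * \<eta> (Suc k)) + 1"
      unfolding T_step lg_def[symmetric] by (rule nat_ceil)
    also have "2 * lg / (mh * \<eta> (Suc k)) \<le> 2 * lg / (mh * (1 / (2 * L * 2 ^ Suc k)))"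
      using lg0 mh(1) L_pos eta_pos[of "Suc k"] eta_ge_power[of "Suc k"]
      by (intro divide_left_mono mult_left_mono mult_pos_pos) auto
    also have "\<dots> = 4 * L * lg / mh * 2 ^ Suc k" by simp
    finally show ?thesis by simp
  qed
  obtain n where n: "K = Suc n" using K(1) by (cases K) auto
  have two: "(2::real) ^ n \<le> 2 / (L * scale)" using K(3) by (simp add: n)
  have geo: "(\<Sum>k<n. (2::real) ^ Suc k) \<le> 2 * 2 ^ n" by (induction n) auto
  \<comment> \<open>The \<open>K\<close> units added by the ceilings are absorbed through
    \<open>K \<le> 2 ^ (K - 1)\<close>.\<close>
  have "real (Suc n) \<le> 2 ^ n"
    using less_exp[of n] by (metis Suc_leI of_nat_le_iff of_nat_numeral of_nat_power)
  then have Kle: "real (Suc n) \<le> 2 / (mh * scale)"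
    using two divide_left_mono[of "mh * scale" "L * scale" 2] mh_le mh(1) scale(1) L_pos by simp
  have "real (start K) = real (T 0) + (\<Sum>k<n. real (T (Suc k)))"
    by (simp add: start n sum.lessThan_Suc_shift del: sum.lessThan_Suc)
  also have "\<dots> \<le> (4 * A + 1) + (\<Sum>k<n. 4 * L * lg / mh * 2 ^ Suc k + 1)"
    by (intro add_mono sum_mono T0 TS)
  also have "\<dots> = 4 * A + 4 * L * lg / mh * (\<Sum>k<n. 2 ^ Suc k) + real (Suc n)"
    by (simp add: sum.distrib sum_distrib_left)
  also have "\<dots> \<le> 4 * A + 4 * L * lg / mh * (2 * (2 / (L * scale))) + 2 / (mh * scale)"
    using geo two lg0 mh(1) L_pos by (intro add_mono mult_left_mono Kle) auto
  also have "\<dots> = 4 * A + 1 / (mh * scale) * (16 * lg + 2)"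
    using L_pos by (simp add: field_simps add_divide_distrib)
  also have "\<dots> \<le> 4 * A + 1 / (mh * scale) * (16 * ((1 + 4 * c) * m) + 2 * m)"
    using lg m1 mh(1) scale(1) by (intro add_left_mono mult_left_mono) auto
  also have "16 * ((1 + 4 * c) * m) + 2 * m = (18 + 64 * c) * m" by (simp add: algebra_simps)
  also have "1 / (mh * scale) * ((18 + 64 * c) * m) = (18 + 64 * c) * (1 / (mh * scale) * m)" by simp
  finally show ?thesis unfolding A_def m_def .
qed

text \<open>The 3 / 2 of the reset and the 11 / 10 of \<open>epoch_weight_bounds\<close> multiply to
  the 33 / 20 in \<open>sw_step\<close>, so \<open>sw k * \<Gamma> k\<close> chains across
  epochs.\<close>

lemma unrolled_recursion:
  fixes \<Gamma> :: "nat \<Rightarrow> real" and \<Phi> :: "nat \<Rightarrow> nat \<Rightarrow> real" and \<xi> d V :: "nat \<Rightarrow> real"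
  assumes step: "\<And>k j. k < K \<Longrightarrow> j < T k \<Longrightarrow>
        \<Phi> k (Suc j) \<le> (1 - w k) * \<Phi> k j + w k * (\<xi> (start k + j) + d (start k + j))"
    and V: "\<And>i. 0 \<le> V i" "\<And>k j. k < K \<Longrightarrow> j < T k \<Longrightarrow> mh / 4 * V (start k + j) \<le> \<Phi> k j"
    and reset: "\<And>k. k < K \<Longrightarrow> \<Phi> k 0 \<le> 3 / 2 * \<Gamma> k" and out: "\<And>k. k < K \<Longrightarrow> \<Gamma> (Suc k) \<le> \<Phi> k (T k)"
    and \<Gamma>: "\<And>k. k \<le> K \<Longrightarrow> 0 \<le> \<Gamma> k"
  shows "lam * \<Gamma> K \<le> sw 0 * \<Gamma> 0
      + (\<Sum>i<start K. tw i * \<xi> i - 4 * (tw i)\<^sup>2 * \<sigma>\<^sup>2 * V i + tw i * d i)"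
proof -
  let ?t = "\<lambda>i. tw i * \<xi> i - 4 * (tw i)\<^sup>2 * \<sigma>\<^sup>2 * V i + tw i * d i"
  have "sw k * \<Gamma> k \<le> sw 0 * \<Gamma> 0 + (\<Sum>i<start k. ?t i)" if "k \<le> K" for k
    using that
  proof (induction k)
    case 0
    then show ?case by (simp add: start)
  next
    case (Suc k)
    then have k: "k < K" by simp
    have p: "0 \<le> sw (Suc k)" "0 \<le> w k" using sw_pos[of "Suc k"] w_bounds(1)[of k] by auto
    have "sw (Suc k) * \<Gamma> (Suc k) \<le> sw (Suc k) * \<Phi> k (T k)"
      by (intro mult_left_mono out k p)
    also have "\<dots> \<le> epoch_weight (sw (Suc k)) (w k) (T k) * \<Phi> k 0 + (\<Sum>j<T k.
        epoch_weight (sw (Suc k)) (w k) (T k - Suc j) * w k * \<xi> (start k + j)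
        - 4 * (epoch_weight (sw (Suc k)) (w k) (T k - Suc j) * w k)\<^sup>2 * \<sigma>\<^sup>2 * V (start k + j)
        + epoch_weight (sw (Suc k)) (w k) (T k - Suc j) * w k * d (start k + j))"
      by (rule epoch_potential[where mh = mh and e = "\<eta> k"])
         (use step[OF k] V(1) V(2)[OF k] p w_bounds[of k] mh(1) sw_eta[OF k] in auto)
    also have "(\<Sum>j<T k.
        epoch_weight (sw (Suc k)) (w k) (T k - Suc j) * w k * \<xi> (start k + j)
        - 4 * (epoch_weight (sw (Suc k)) (w k) (T k - Suc j) * w k)\<^sup>2 * \<sigma>\<^sup>2 * V (start k + j)
        + epoch_weight (sw (Suc k)) (w k) (T k - Suc j) * w k * d (start k + j))
        = (\<Sum>j<T k. ?t (start k + j))"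
      by (intro sum.cong refl) (simp add: tw_epoch)
    also have "epoch_weight (sw (Suc k)) (w k) (T k) * \<Phi> k 0 \<le> epoch_weight (sw (Suc k)) (w k) (T k) * (3 / 2 * \<Gamma> k)"
      using epoch_weight_bounds(1)[OF p w_le_1] by (intro mult_left_mono reset k) auto
    also have "\<dots> \<le> (11 / 10 * (sw (Suc k) * (1 - w k) ^ T k)) * (3 / 2 * \<Gamma> k)"
      using epoch_weight_bounds(2)[OF p w_le_1] \<Gamma>[of k] k by (intro mult_right_mono) auto
    also have "\<dots> = sw k * \<Gamma> k" by (simp add: sw_step[OF k])
    finally show ?case
      using Suc.IH k unfolding sum_epochs[OF start, of ?t k] by simp
  qed
  from this[of K] show ?thesis by (simp add: sw_end)
qed

text \<open>A statement about a single outcome. \<phi> stands for the loss at the final time with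
  the final equilibrium as parameter; the gradients actually used are then biased gradients of
  \<phi>, with bias \<open>b\<close>.\<close>

lemma tracking_deterministic:
  fixes \<phi> :: "'a::euclidean_space \<Rightarrow> real" and h :: "'a \<Rightarrow> ereal" and x g z X b :: "nat \<Rightarrow> 'a"
    and G :: "nat \<Rightarrow> real" and xb :: 'a
  defines "\<rho> \<equiv> \<lambda>u. real_of_ereal (h u)"
  defines "gap \<equiv> \<lambda>u. (\<phi> u + \<rho> u) - (\<phi> xb + \<rho> xb)"
  assumes h: "proper_closed_convex h" and sc: "strongly_convex \<mu> \<phi>" and sm: "smooth_with L \<phi>"
    and xb: "xb \<in> effective_domain h" "\<And>u. u \<in> effective_domain h \<Longrightarrow> \<phi> xb + \<rho> xb \<le> \<phi> u + \<rho> u"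
    and g: "\<And>i. g i = gradient \<phi> (x i) + b i - z i"
    and b: "\<And>i. i < start K \<Longrightarrow> norm (b i) \<le> G i + \<gamma> * norm (x i - xb)"
    and G: "\<And>i. 0 \<le> G i"
    and X0: "X 0 \<in> effective_domain h"
    and x: "\<And>k j. k < K \<Longrightarrow> j < T k \<Longrightarrow>
        x (start k + j) = fst (avg_prox_run \<mu> \<gamma> (\<eta> k) (\<lambda>_. h) g (start k) (X k) j)"
    and X: "\<And>k. k < K \<Longrightarrow> X (Suc k) = snd (avg_prox_run \<mu> \<gamma> (\<eta> k) (\<lambda>_. h) g (start k) (X k) (T k))"
  shows "X K \<in> effective_domain h"
    and "lam * gap (X K) \<le> sw 0 * gap (X 0)
      + (\<Sum>i<start K. tw i * (z i \<bullet> (x i - xb) + \<eta> (epoch_of i) * (norm (z i))\<^sup>2)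
          - 4 * (tw i)\<^sup>2 * \<sigma>\<^sup>2 * (norm (x i - xb))\<^sup>2 + tw i * ((G i)\<^sup>2 / mh))"
proof -
  let ?S = "effective_domain h"
  have S: "convex ?S" by (rule proper_closed_convexD(3)[OF h])
  have cv: "strongly_convex_on ?S 0 \<rho>" unfolding \<rho>_def by (rule proper_closed_convexD(4)[OF h])
  have scS: "strongly_convex_on ?S \<mu> (\<lambda>u. \<phi> u + \<rho> u)"
    using strongly_convex_on_add[OF strongly_convex_imp_on[OF sc] cv] by simp
  have sc0: "strongly_convex_on ?S 0 (\<lambda>u. \<phi> u + \<rho> u)"
    unfolding strongly_convex_on_def
  proof (intro ballI)
    fix u v \<theta> assume A: "u \<in> ?S" "v \<in> ?S" "\<theta> \<in> {0..1::real}"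
    have "0 \<le> \<mu> / 2 * \<theta> * (1 - \<theta>) * (norm (u - v))\<^sup>2" using A mu_pos by simp
    moreover have "\<phi> ((1 - \<theta>) *\<^sub>R u + \<theta> *\<^sub>R v) + \<rho> ((1 - \<theta>) *\<^sub>R u + \<theta> *\<^sub>R v)
        \<le> (1 - \<theta>) * (\<phi> u + \<rho> u) + \<theta> * (\<phi> v + \<rho> v) - \<mu> / 2 * \<theta> * (1 - \<theta>) * (norm (u - v))\<^sup>2"
      using scS A unfolding strongly_convex_on_def by blast
    ultimately show "\<phi> ((1 - \<theta>) *\<^sub>R u + \<theta> *\<^sub>R v) + \<rho> ((1 - \<theta>) *\<^sub>R u + \<theta> *\<^sub>R v)
        \<le> (1 - \<theta>) * (\<phi> u + \<rho> u) + \<theta> * (\<phi> v + \<rho> v) - 0 / 2 * \<theta> * (1 - \<theta>) * (norm (u - v))\<^sup>2"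
      by simp
  qed
  have grow: "\<mu> / 2 * (norm (u - xb))\<^sup>2 \<le> gap u" if "u \<in> ?S" for u
    using strongly_convex_on_minimizer_growth[OF S scS xb that] by (simp add: gap_def)
  have minorant: "(\<rho> xb + gradient \<phi> xb \<bullet> xb) + (- gradient \<phi> xb) \<bullet> u \<le> \<rho> u" if "u \<in> ?S" for u
    using convex_affine_minorant[OF S cv sm xb that] by (simp add: inner_diff_right)
  have prox_dom: "prox (\<eta> k) h v \<in> ?S" for k v
    by (rule prox_minimizer(1)[OF h eta_pos]) (rule minorant[unfolded \<rho>_def])
  have prox_min: "\<rho> (prox (\<eta> k) h v) + 1 / (2 * \<eta> k) * (norm (prox (\<eta> k) h v - v))\<^sup>2
        + 1 / (2 * \<eta> k) * (norm (u - prox (\<eta> k) h v))\<^sup>2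
      \<le> \<rho> u + 1 / (2 * \<eta> k) * (norm (u - v))\<^sup>2" if "u \<in> ?S" for k u v
    unfolding \<rho>_def by (rule prox_minimizer(2)[OF h eta_pos _ that]) (rule minorant[unfolded \<rho>_def])
  define run where "run k j = avg_prox_run \<mu> \<gamma> (\<eta> k) (\<lambda>_. h) g (start k) (X k) j" for k j
  have run0: "run k 0 = (X k, X k)" for k by (simp add: run_def)
  have runS: "fst (run k (Suc j)) = prox (\<eta> k) h (fst (run k j) - \<eta> k *\<^sub>R g (start k + j))"
    "snd (run k (Suc j)) = (1 - w k) *\<^sub>R snd (run k j) + w k *\<^sub>R fst (run k (Suc j))" for k j
    by (simp_all add: run_def Let_def case_prod_unfold w_def mh(2)[symmetric])
  have runin: "fst (run k j) \<in> ?S \<and> snd (run k j) \<in> ?S" if "X k \<in> ?S" for k j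
  proof (induction j)
    case 0
    then show ?case using that by (simp add: run0)
  next
    case (Suc j)
    have 1: "fst (run k (Suc j)) \<in> ?S" unfolding runS by (rule prox_dom)
    moreover have "snd (run k (Suc j)) \<in> ?S"
      unfolding runS(2) using Suc 1 w_bounds(1)[of k] w_le_1[of k] by (intro convexD[OF S]) auto
    ultimately show ?case ..
  qed
  have XS: "X k \<in> ?S" if "k \<le> K" for k
    using that
  proof (induction k)
    case 0
    show ?case by (rule X0)
  next
    case (Suc k)
    then show ?case using runin[of k "T k"] X[of k] by (simp add: run_def)
  qed
  then show "X K \<in> ?S" by simp
  define \<Phi> where "\<Phi> k j = gap (snd (run k j)) + mh / 4 * (norm (fst (run k j) - xb))\<^sup>2" for k j
  have gap0: "0 \<le> gap u" if "u \<in> ?S" for u using xb(2)[OF that] by (simp add: gap_def)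
  show "lam * gap (X K) \<le> sw 0 * gap (X 0)
      + (\<Sum>i<start K. tw i * (z i \<bullet> (x i - xb) + \<eta> (epoch_of i) * (norm (z i))\<^sup>2)
          - 4 * (tw i)\<^sup>2 * \<sigma>\<^sup>2 * (norm (x i - xb))\<^sup>2 + tw i * ((G i)\<^sup>2 / mh))"
  proof (rule unrolled_recursion[where \<Phi> = \<Phi>])
    fix k j assume k: "k < K" and j: "j < T k"
    let ?i = "start k + j"
    have X_k: "X k \<in> ?S" using XS k by simp
    \<comment> \<open>Available for \<open>j < T k\<close> only: at the end of the epoch the iterate
      of the run is dropped and \<open>x\<close> restarts from the average.\<close>
    have xi: "fst (run k j) = x ?i" using x[OF k j] by (simp add: run_def)
    have "start (Suc k) \<le> start K" unfolding start using k by (intro sum_mono2) auto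
    then have iN: "?i < start K" using j by (simp add: start)
    let ?p = "fst (run k (Suc j))"
    have small: "\<mu> * \<eta> k < 2" using mu_eta(1)[of k] by simp
    have "(\<phi> ?p + \<rho> ?p) - (\<phi> xb + \<rho> xb)
      \<le> z ?i \<bullet> (x ?i - xb) + \<eta> k * (norm (z ?i))\<^sup>2 + (G ?i)\<^sup>2 / mh
        + (2 - \<mu> * \<eta> k) / (4 * \<eta> k) * ((1 - w k) * (norm (x ?i - xb))\<^sup>2 - (norm (?p - xb))\<^sup>2)"
    proof (rule prox_gradient_step[OF sc sm xb(1) _ g b[OF iN] eta_pos eta_le L_pos \<gamma> mh w_def small G])
      fix u assume "u \<in> ?S"
      from prox_min[OF this, of k "x ?i - \<eta> k *\<^sub>R g ?i"]
      show "\<rho> ?p + 1 / (2 * \<eta> k) * (norm (?p - (x ?i - \<eta> k *\<^sub>R g ?i)))\<^sup>2 + 1 / (2 * \<eta> k) * (norm (u - ?p))\<^sup>2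
          \<le> \<rho> u + 1 / (2 * \<eta> k) * (norm (u - (x ?i - \<eta> k *\<^sub>R g ?i)))\<^sup>2"
        by (simp only: runS(1) xi)
    qed
    from prox_gradient_potential[OF this, of ?S "snd (run k j)" mh]
    show "\<Phi> k (Suc j) \<le> (1 - w k) * \<Phi> k j
        + w k * ((z ?i \<bullet> (x ?i - xb) + \<eta> (epoch_of ?i) * (norm (z ?i))\<^sup>2) + (G ?i)\<^sup>2 / mh)"
      using runin[OF X_k] sc0 eta_pos[of k] w_bounds(1)[of k] w_le_1[of k] small
      by (simp add: \<Phi>_def gap_def runS(2) xi epoch_of[OF j] w_def[of k, symmetric])
    show "mh / 4 * (norm (x ?i - xb))\<^sup>2 \<le> \<Phi> k j"
      using gap0 runin[OF X_k, of j] by (simp add: \<Phi>_def xi)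
  next
    fix k assume k: "k < K"
    have X_k: "X k \<in> ?S" using XS k by simp
    \<comment> \<open>By quadratic growth the distance part of the potential is at most half of the
      gap, which gives the reset cost 3 / 2.\<close>
    have "mh / 4 * (norm (X k - xb))\<^sup>2 \<le> \<mu> / 4 * (norm (X k - xb))\<^sup>2"
      using mh \<gamma> by (intro mult_right_mono) auto
    then show "\<Phi> k 0 \<le> 3 / 2 * gap (X k)"
      using grow[OF X_k] by (simp add: \<Phi>_def run0)
    show "gap (X (Suc k)) \<le> \<Phi> k (T k)"
      using X[OF k] mh(1) by (simp add: \<Phi>_def run_def)
  next
    show "0 \<le> gap (X k)" if "k \<le> K" for k using gap0 XS that by simp
  qed simp
qed

end

section \<open>The light-tailed framework\<close>

lemma joined_algebra_simps:
  fixes y :: "'w \<Rightarrow> 'a::euclidean_space"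
  shows "space (joined_algebra G y) = space G"
    and "sets (joined_algebra G y) = sigma_sets (space G) (sets G \<union> {y -` A \<inter> space G | A. A \<in> sets borel})"
proof -
  have "sets G \<union> {y -` A \<inter> space G | A. A \<in> sets borel} \<subseteq> Pow (space G)"
    using sets.space_closed[of G] by auto
  then show "space (joined_algebra G y) = space G"
    "sets (joined_algebra G y) = sigma_sets (space G) (sets G \<union> {y -` A \<inter> space G | A. A \<in> sets borel})"
    unfolding joined_algebra_def by (simp_all add: sets_measure_of space_measure_of)
qed

lemma measurable_joined_algebra:
  fixes y :: "'w \<Rightarrow> 'a::euclidean_space"
  shows "y \<in> borel_measurable (joined_algebra G y)"
    and "h \<in> borel_measurable G \<Longrightarrow> h \<in> borel_measurable (joined_algebra G y)"
    and "\<lbrakk>space G = space G'; sets G \<subseteq> sets G'\<rbrakk> \<Longrightarrow> sets (joined_algebra G y) \<subseteq> sets (joined_algebra G' y)"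
proof -
  show "y \<in> borel_measurable (joined_algebra G y)"
    by (auto simp: measurable_def joined_algebra_simps intro!: sigma_sets.Basic)
  show "h \<in> borel_measurable G \<Longrightarrow> h \<in> borel_measurable (joined_algebra G y)"
    by (auto simp: measurable_def joined_algebra_simps intro!: sigma_sets.Basic)
  show "\<lbrakk>space G = space G'; sets G \<subseteq> sets G'\<rbrakk> \<Longrightarrow> sets (joined_algebra G y) \<subseteq> sets (joined_algebra G' y)"
    unfolding joined_algebra_simps by (simp only:) (rule sigma_sets_mono', auto)
qed

lemma gradient_param_lipschitz:
  assumes "ereal \<gamma> = param_lipschitz \<Omega> f" "\<omega> \<in> \<Omega>"
  shows "norm (gradient (f t \<omega> x) u - gradient (f t \<omega> y) u) \<le> \<gamma> * norm (x - y)"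
proof (cases "x = y")
  case False
  have "ereal (norm (gradient (f t \<omega> x) u - gradient (f t \<omega> y) u) / norm (x - y)) \<le> ereal \<gamma>"
    unfolding assms(1) param_lipschitz_def
    by (rule SUP_upper2[of "(\<omega>, t, u, x, y)"]) (use False assms(2) in auto)
  then show ?thesis using False by (simp add: divide_le_eq)
qed simp

lemma gradient_le_drift:
  assumes "gradient_drift f i t \<omega> < \<infinity>"
  shows "norm (gradient (f i \<omega> x) u - gradient (f t \<omega> x) u) \<le> real_of_ereal (gradient_drift f i t \<omega>)"
proof -
  have le: "ereal (norm (gradient (f i \<omega> x) u - gradient (f t \<omega> x) u)) \<le> gradient_drift f i t \<omega>"
    unfolding gradient_drift_def by (rule SUP_upper2[of "(u, x)"]) auto
  then have "gradient_drift f i t \<omega> \<noteq> -\<infinity>" by auto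
  then show ?thesis
    using le assms by (cases "gradient_drift f i t \<omega>") auto
qed

lemma (in prob_space) prob_Int_ge:
  assumes A: "A \<in> events" "1 - a \<le> prob A" and B: "B \<in> events" "1 - b \<le> prob B"
  shows "1 - (a + b) \<le> prob (A \<inter> B)"
proof -
  have "prob A = prob (A \<inter> B) + prob (A - B)"
    using A(1) B(1) by (subst finite_measure_Union[symmetric]) (auto intro: arg_cong[where f = prob])
  moreover have "prob (A - B) \<le> prob (space M - B)"
    using A(1) B(1) sets.sets_into_space by (intro finite_measure_mono) auto
  moreover have "prob (space M - B) = 1 - prob B"
    using B(1) by (rule prob_compl)
  ultimately show ?thesis using A(2) B(2) by linarith
qed

text \<open>Low drift, squared, says \<open>16 * (L * scale) ^ 3 < 1\<close>. Hence the cube of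
  \<open>L * \<eta>star\<close> is below 1 / 8, and \<open>1 / (L * scale)\<close> exceeds 2, which
  later forces at least three epochs. Roots are compared through their cubes.\<close>

lemma epoch_schedule_scale:
  fixes mh \<Delta> \<sigma> L scale \<eta>star :: real
  assumes pos: "0 < mh" "0 < \<Delta>" "0 < \<sigma>" "0 < L" and low: "\<Delta> / \<sigma> < sqrt (mh / (16 * L ^ 3))"
  defines "scale \<equiv> (\<Delta>\<^sup>2 / (mh * \<sigma>\<^sup>2)) powr (1 / 3)"
    and "\<eta>star \<equiv> (2 * \<Delta>\<^sup>2 / (mh * \<sigma>\<^sup>2)) powr (1 / 3)"
  shows "0 < scale" "scale ^ 3 = \<Delta>\<^sup>2 / (mh * \<sigma>\<^sup>2)"
    and "scale \<le> \<eta>star" "\<eta>star \<le> 2 * scale" "L * \<eta>star \<le> 1 / 2"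
    and "mh * (\<Delta> * \<sigma>\<^sup>2 / mh\<^sup>2) powr (2 / 3) = \<sigma>\<^sup>2 * scale"
    and "(\<sigma>\<^sup>2 * mh / \<Delta>\<^sup>2) powr (1 / 3) = 1 / scale"
    and "2 * (L * scale) < 1"
proof -
  have p: "0 < \<Delta>\<^sup>2 / (mh * \<sigma>\<^sup>2)" using pos by simp
  show s: "0 < scale" and s3: "scale ^ 3 = \<Delta>\<^sup>2 / (mh * \<sigma>\<^sup>2)"
    using p powr_third_cube[OF p] by (auto simp: scale_def)
  have e: "0 < \<eta>star" using pos by (simp add: \<eta>star_def)
  have e3: "\<eta>star ^ 3 = 2 * scale ^ 3"
    using powr_third_cube[of "2 * \<Delta>\<^sup>2 / (mh * \<sigma>\<^sup>2)"] pos by (simp add: \<eta>star_def s3)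
  show "scale \<le> \<eta>star"
    by (rule power_le_imp_le_base[of _ 2]) (use e e3 s in \<open>auto simp: numeral_3_eq_3[symmetric]\<close>)
  show "\<eta>star \<le> 2 * scale"
    by (rule power_le_imp_le_base[of _ 2]) (use e e3 s in \<open>auto simp: numeral_3_eq_3[symmetric] power_mult_distrib\<close>)
  have "(\<Delta> / \<sigma>)\<^sup>2 < (sqrt (mh / (16 * L ^ 3)))\<^sup>2"
    using low pos by (intro power_strict_mono) auto
  then have "\<Delta>\<^sup>2 / \<sigma>\<^sup>2 < mh / (16 * L ^ 3)"
    using pos by (simp add: power_divide)
  then have "16 * (L ^ 3 * (\<Delta>\<^sup>2 / (mh * \<sigma>\<^sup>2))) < 1"
    using pos by (simp add: field_simps)
  then have small: "16 * (L * scale) ^ 3 < 1" by (simp add: s3 power_mult_distrib)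
  have "(L * \<eta>star) ^ 3 = 2 * (L * scale) ^ 3"
    by (simp add: power_mult_distrib e3)
  then have "(L * \<eta>star) ^ 3 \<le> (1 / 2) ^ 3"
    using small by (simp add: power_divide)
  then show "L * \<eta>star \<le> 1 / 2"
    by (subst (asm) power_mono_iff) (use pos e in auto)
  show "2 * (L * scale) < 1"
  proof (rule power_less_imp_less_base)
    show "(2 * (L * scale)) ^ 3 < 1 ^ 3"
      using small zero_less_power[of "L * scale" 3] pos s by (simp add: power_mult_distrib)
  qed simp
  show "(\<sigma>\<^sup>2 * mh / \<Delta>\<^sup>2) powr (1 / 3) = 1 / scale"
    using s by (intro powr_third_eqI) (auto simp: power_divide s3 mult.commute)
  have "(\<Delta> * \<sigma>\<^sup>2 / mh\<^sup>2) powr (2 / 3) = ((\<Delta> * \<sigma>\<^sup>2 / mh\<^sup>2) powr 2) powr (1 / 3)"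
    by (simp only: powr_powr) simp
  also have "(\<Delta> * \<sigma>\<^sup>2 / mh\<^sup>2) powr 2 = (\<Delta> * \<sigma>\<^sup>2 / mh\<^sup>2)\<^sup>2" using pos by simp
  also have "((\<Delta> * \<sigma>\<^sup>2 / mh\<^sup>2)\<^sup>2) powr (1 / 3) = \<sigma>\<^sup>2 * scale / mh"
  proof (rule powr_third_eqI)
    have "(\<sigma>\<^sup>2 * scale / mh) ^ 3 = (\<sigma>\<^sup>2) ^ 3 * (\<Delta>\<^sup>2 / (mh * \<sigma>\<^sup>2)) / mh ^ 3"
      by (simp add: power_mult_distrib power_divide s3)
    also have "\<dots> = (\<Delta> * \<sigma>\<^sup>2 / mh\<^sup>2)\<^sup>2"
      using pos by (simp add: power_mult_distrib power_divide field_simps power2_eq_square power3_eq_cube)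
    finally show "(\<sigma>\<^sup>2 * scale / mh) ^ 3 = (\<Delta> * \<sigma>\<^sup>2 / mh\<^sup>2)\<^sup>2" .
  qed (use s pos in auto)
  finally show "mh * (\<Delta> * \<sigma>\<^sup>2 / mh\<^sup>2) powr (2 / 3) = \<sigma>\<^sup>2 * scale" using pos by simp
qed

text \<open>\<open>y > 2\<close> makes the ceiling at least 2, so the conversion by
  \<open>nat\<close> truncates nothing.\<close>

lemma ceiling_log2_bounds:
  fixes y :: real and K :: nat
  assumes "2 < y"
  defines "K \<equiv> nat (1 + \<lceil>log 2 y\<rceil>)"
  shows "3 \<le> K" "y \<le> 2 ^ (K - 1)" "2 ^ (K - 1) \<le> 2 * y"
proof -
  have "1 < log 2 y" using assms by (simp add: less_log_iff)
  then have c: "2 \<le> \<lceil>log 2 y\<rceil>" by linarith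
  then show "3 \<le> K" unfolding K_def by linarith
  have K1: "real (K - 1) = of_int \<lceil>log 2 y\<rceil>" using c unfolding K_def by linarith
  have pw: "2 powr real (K - 1) = 2 ^ (K - 1)" by (rule powr_realpow) simp
  have y: "2 powr log 2 y = y" using assms by simp
  have "2 powr log 2 y \<le> 2 powr real (K - 1)"
    unfolding K1 by (intro powr_mono) auto
  then show "y \<le> 2 ^ (K - 1)" unfolding pw y .
  have "2 powr real (K - 1) \<le> 2 powr (1 + log 2 y)"
    unfolding K1 by (intro powr_mono) linarith+
  then show "2 ^ (K - 1) \<le> 2 * y" unfolding pw powr_add y by simp
qed

section \<open>Real-valued objectives and the two tail events\<close>

context light_tailed_framework
begin

lemma gamma_nonneg: "0 \<le> \<gamma>"
proof -
  obtain \<omega> where \<omega>: "\<omega> \<in> space M" using not_empty by auto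
  obtain b :: 'a where b: "norm b = 1"
    using vector_choose_size[of 1] by auto
  have "0 \<le> norm (gradient (f 0 \<omega> b) 0 - gradient (f 0 \<omega> 0) 0)" by simp
  also have "\<dots> \<le> \<gamma> * norm (b - 0)"
    by (rule gradient_param_lipschitz[OF gamma_eq \<omega>])
  finally show ?thesis by (simp add: b)
qed

lemma mu_le_L: "\<mu> \<le> L"
proof -
  obtain \<omega> where \<omega>: "\<omega> \<in> space M" using not_empty by auto
  show ?thesis
    by (rule strong_convexity_le_smoothness[OF f_strongly_convex[OF \<omega>] f_smooth[OF \<omega>]])
qed

text \<open>Time 0 represents all times, the regularizer being constant in time; the conversion to
  reals is faithful on the effective domain.\<close>

definition rho :: "'w \<Rightarrow> 'a \<Rightarrow> real" where
  "rho \<omega> u = real_of_ereal (r 0 \<omega> u)"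

definition psi_real :: "nat \<Rightarrow> 'w \<Rightarrow> 'a \<Rightarrow> real" where
  "psi_real t \<omega> u = f t \<omega> (xbar t \<omega>) u + rho \<omega> u"

lemma psi_eq:
  assumes \<omega>: "\<omega> \<in> space M" and u: "u \<in> effective_domain (r 0 \<omega>)"
  shows "psi f r xbar t \<omega> u = ereal (psi_real t \<omega> u)"
  using proper_closed_convexD(1)[OF r_pcc[OF \<omega>] u] r_constant[OF \<omega>, of t 0]
  by (metis psi_def psi_real_def rho_def plus_ereal.simps(1))

lemma psi_infinite:
  assumes \<omega>: "\<omega> \<in> space M" and u: "u \<notin> effective_domain (r 0 \<omega>)"
  shows "psi f r xbar t \<omega> u = \<infinity>"
  using u r_constant[OF \<omega>, of t 0] by (simp add: psi_def effective_domain_def)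

lemma xbar_minimizer:
  assumes \<omega>: "\<omega> \<in> space M"
  shows "xbar t \<omega> \<in> effective_domain (r 0 \<omega>)"
    and "\<And>u. u \<in> effective_domain (r 0 \<omega>) \<Longrightarrow> psi_real t \<omega> (xbar t \<omega>) \<le> psi_real t \<omega> u"
proof -
  have min: "psi f r xbar t \<omega> (xbar t \<omega>) \<le> psi f r xbar t \<omega> u" for u
    using equilibrium[OF \<omega>, of t] by (simp add: is_arg_min_linorder)
  obtain u0 where u0: "u0 \<in> effective_domain (r 0 \<omega>)"
    using proper_closed_convexD(2)[OF r_pcc[OF \<omega>]] by auto
  show xb: "xbar t \<omega> \<in> effective_domain (r 0 \<omega>)"
  proof (rule ccontr)
    assume "xbar t \<omega> \<notin> effective_domain (r 0 \<omega>)"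
    then show False
      using min[of u0] psi_infinite[OF \<omega>] psi_eq[OF \<omega> u0] by simp
  qed
  show "psi_real t \<omega> (xbar t \<omega>) \<le> psi_real t \<omega> u" if "u \<in> effective_domain (r 0 \<omega>)" for u
    using min[of u] psi_eq[OF \<omega> xb] psi_eq[OF \<omega> that] by simp
qed

lemma psi_gap_eq:
  assumes \<omega>: "\<omega> \<in> space M" and u: "u \<in> effective_domain (r 0 \<omega>)"
  shows "psi_gap f r xbar t \<omega> u = ereal (psi_real t \<omega> u - psi_real t \<omega> (xbar t \<omega>))"
  unfolding psi_gap_def psi_eq[OF \<omega> u] psi_eq[OF \<omega> xbar_minimizer(1)[OF \<omega>]] by simp

lemma finite_gap_in_domain:
  assumes \<omega>: "\<omega> \<in> space M" and "psi_gap f r xbar t \<omega> u \<le> ereal D"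
  shows "u \<in> effective_domain (r 0 \<omega>)"
proof (rule ccontr)
  assume "u \<notin> effective_domain (r 0 \<omega>)"
  then show False
    using assms(2) psi_infinite[OF \<omega>] psi_eq[OF \<omega> xbar_minimizer(1)[OF \<omega>]] by (simp add: psi_gap_def)
qed

definition drift :: "nat \<Rightarrow> nat \<Rightarrow> 'w \<Rightarrow> real" where
  "drift N i \<omega> = real_of_ereal (gradient_drift f i N \<omega>)"

lemma drift_nonneg: "0 \<le> drift N i \<omega>"
proof -
  have "ereal (norm (gradient (f i \<omega> 0) 0 - gradient (f N \<omega> 0) 0)) \<le> gradient_drift f i N \<omega>"
    unfolding gradient_drift_def by (rule SUP_upper2[of "(0, 0)"]) auto
  then have "0 \<le> gradient_drift f i N \<omega>" by (rule order_trans[rotated]) simp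
  then show ?thesis unfolding drift_def by (rule real_of_ereal_pos)
qed

lemma gradient_difference:
  assumes \<omega>: "\<omega> \<in> space M" and "gradient_drift f i N \<omega> < \<infinity>"
  shows "norm (gradient (f i \<omega> y) u - gradient (f N \<omega> y') u) \<le> drift N i \<omega> + \<gamma> * norm (y - y')"
proof -
  have "norm (gradient (f i \<omega> y) u - gradient (f N \<omega> y') u)
    \<le> norm (gradient (f i \<omega> y) u - gradient (f N \<omega> y) u) + norm (gradient (f N \<omega> y) u - gradient (f N \<omega> y') u)"
    using norm_triangle_ineq[of "gradient (f i \<omega> y) u - gradient (f N \<omega> y) u"
        "gradient (f N \<omega> y) u - gradient (f N \<omega> y') u"] by simp
  also have "\<dots> \<le> drift N i \<omega> + \<gamma> * norm (y - y')"
    using gradient_le_drift[OF assms(2)] gradient_param_lipschitz[OF gamma_eq \<omega>]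
    by (intro add_mono) (auto simp: drift_def)
  finally show ?thesis .
qed

text \<open>The denominator \<mu> is weakened to that of the per-step drift, so that both drifts fit
  into one weighted sum.\<close>

lemma initial_gap:
  assumes \<omega>: "\<omega> \<in> space M" and fin: "gradient_drift f 0 N \<omega> < \<infinity>"
    and gap: "psi_gap f r xbar 0 \<omega> u \<le> ereal D"
  shows "psi_real N \<omega> u - psi_real N \<omega> (xbar N \<omega>) \<le> 2 * D + 6 * (drift N 0 \<omega>)\<^sup>2 / (\<mu> - 2 * \<gamma>)"
proof -
  have u: "u \<in> effective_domain (r 0 \<omega>)" by (rule finite_gap_in_domain[OF \<omega> gap])
  have "psi_real N \<omega> u - psi_real N \<omega> (xbar N \<omega>)
    \<le> 2 * (psi_real 0 \<omega> u - psi_real 0 \<omega> (xbar 0 \<omega>)) + 6 * (drift N 0 \<omega>)\<^sup>2 / \<mu>"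
    unfolding psi_real_def
  proof (rule gap_change_of_time[where \<gamma> = \<gamma> and S = "effective_domain (r 0 \<omega>)"])
    show "convex (effective_domain (r 0 \<omega>))" by (rule proper_closed_convexD(3)[OF r_pcc[OF \<omega>]])
    show "strongly_convex_on (effective_domain (r 0 \<omega>)) 0 (rho \<omega>)"
      using proper_closed_convexD(4)[OF r_pcc[OF \<omega>]] by (simp add: rho_def[abs_def])
    show "norm (gradient (f N \<omega> (xbar N \<omega>)) v - gradient (f 0 \<omega> (xbar 0 \<omega>)) v)
        \<le> drift N 0 \<omega> + \<gamma> * norm (xbar N \<omega> - xbar 0 \<omega>)" for v
      using gradient_difference[OF \<omega> fin, of "xbar 0 \<omega>" v "xbar N \<omega>"] by (simp add: norm_minus_commute)
  qed (use f_strongly_convex[OF \<omega>] f_smooth[OF \<omega>] xbar_minimizer[OF \<omega>] drift_nonneg gamma_nonneg gamma_less u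
      in \<open>auto simp: psi_real_def\<close>)
  also have "\<dots> \<le> 2 * D + 6 * (drift N 0 \<omega>)\<^sup>2 / (\<mu> - 2 * \<gamma>)"
  proof (intro add_mono mult_left_mono divide_left_mono)
    show "psi_real 0 \<omega> u - psi_real 0 \<omega> (xbar 0 \<omega>) \<le> D"
      using gap psi_gap_eq[OF \<omega> u] by simp
  qed (use gamma_nonneg gamma_less mu_pos in auto)
  finally show ?thesis .
qed

text \<open>The exponent of the supermartingale, with its two compensators, for the fixed target
  \<open>xbar N\<close>.\<close>

definition noise_exponent :: "nat \<Rightarrow> (nat \<Rightarrow> real) \<Rightarrow> (nat \<Rightarrow> real) \<Rightarrow> 'w \<Rightarrow> real" where
  "noise_exponent N a b \<omega> = (\<Sum>i<N. a i * (gradient_noise f x g i \<omega> \<bullet> (x i \<omega> - xbar N \<omega>))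
      + b i * (norm (gradient_noise f x g i \<omega>))\<^sup>2
      - 4 * (a i)\<^sup>2 * \<sigma>\<^sup>2 * (norm (x i \<omega> - xbar N \<omega>))\<^sup>2 - 2 * b i * \<sigma>\<^sup>2)"

text \<open>The noise of step \<open>i\<close> is known to \<open>F (Suc i)\<close>, hence to every
  later joined algebra, while \<open>x i - xbar N\<close> is known to the joined algebra at
  \<open>i\<close> itself; this is the measurability a supermartingale needs.\<close>

lemma noise_exponent_tail:
  assumes a: "\<And>i. i < N \<Longrightarrow> 0 \<le> a i" and b: "\<And>i. i < N \<Longrightarrow> 0 \<le> b i" "\<And>i. i < N \<Longrightarrow> b i * \<sigma>\<^sup>2 \<le> 1 / 2"
    and \<delta>: "0 < \<delta>"
  shows "noise_exponent N a b \<in> borel_measurable M"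
    and "1 - \<delta> \<le> prob {\<omega> \<in> space M. noise_exponent N a b \<omega> \<le> ln (1 / \<delta>)}"
proof -
  let ?G = "\<lambda>i. joined_algebra (F i) (xbar N)"
  have sp: "space (F i) = space M" for i using F_subalgebra[of i] by (simp add: subalgebra_def)
  have F_mono: "sets (F i) \<subseteq> sets (F j)" if "i \<le> j" for i j
    using filtration.sets_F_mono[OF F_filtration that] .
  have xbM: "xbar N \<in> borel_measurable M"
    by (rule measurable_from_subalg[OF F_subalgebra xbar_measurable])
  have zG: "gradient_noise f x g i \<in> borel_measurable (?G j)" if "i < j" for i j
  proof (rule measurable_joined_algebra(2))
    show "gradient_noise f x g i \<in> borel_measurable (F j)"
      using noise_measurable[of i] F_mono[of "Suc i" j] that by (auto simp: measurable_def sp)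
  qed
  have vG: "(\<lambda>\<omega>. x i \<omega> - xbar N \<omega>) \<in> borel_measurable (?G i)" for i
    using measurable_joined_algebra(2)[OF x_measurable] measurable_joined_algebra(1)
    by (intro borel_measurable_diff) auto
  have G_mono: "sets (?G i) \<subseteq> sets (?G j)" if "i \<le> j" for i j
    by (intro measurable_joined_algebra(3) F_mono that) (simp add: sp)
  have "(\<lambda>\<omega>. noise_exponent N a b \<omega>) \<in> borel_measurable M \<and>
      (\<integral>\<^sup>+ \<omega>. ennreal (exp (noise_exponent N a b \<omega>)) \<partial>M) \<le> 1"
    unfolding noise_exponent_def
    using noise_exp_supermartingale[where N = N and G = ?G and z = "gradient_noise f x g"
        and v = "\<lambda>i \<omega>. x i \<omega> - xbar N \<omega>" and a = a and b = b and \<sigma> = \<sigma>]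
      subalgebra_joined_algebra[OF F_subalgebra xbM] G_mono zG vG
      noise_joint_unbiased noise_light_tail sigma_pos a b
    by auto
  then show "noise_exponent N a b \<in> borel_measurable M"
    "1 - \<delta> \<le> prob {\<omega> \<in> space M. noise_exponent N a b \<omega> \<le> ln (1 / \<delta>)}"
    using exp_moment_tail[of "noise_exponent N a b" 1 \<delta>] \<delta> by auto
qed

text \<open>The squared drift is divided by \<open>(m i)\<^sup>2\<close>. At the endpoint
  \<open>1 / (m i)\<^sup>2\<close> of the admissible exponents its exponential moment is at most
  \<open>exp 1\<close>, uniformly in \<open>i\<close>, so the weighted mean inherits this
  bound.\<close>

lemma weighted_drift_tail:
  assumes I: "0 < N" and \<beta>: "\<And>i. i < N \<Longrightarrow> 0 \<le> \<beta> i"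
    "0 < (\<Sum>i<N. \<beta> i * (real N - real i)\<^sup>2)" and \<delta>: "0 < \<delta>"
  defines "B \<equiv> ((\<mu> - 2 * \<gamma>) * \<Delta>)\<^sup>2 * (\<Sum>i<N. \<beta> i * (real N - real i)\<^sup>2)"
  shows "(\<lambda>\<omega>. \<Sum>i<N. \<beta> i * (drift N i \<omega>)\<^sup>2) \<in> borel_measurable M"
    and "1 - \<delta> \<le> prob {\<omega> \<in> space M. (\<Sum>i<N. \<beta> i * (drift N i \<omega>)\<^sup>2) \<le> B * ln (exp 1 / \<delta>)}"
proof -
  define m where "m i = (\<mu> - 2 * \<gamma>) * \<Delta> * (real N - real i)" for i
  have m: "0 < m i" if "i < N" for i
    using that gamma_less Delta_pos by (auto simp: m_def)
  have dM: "drift N i \<in> borel_measurable M" if "i < N" for i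
    using drift_measurable[OF that] unfolding drift_def[abs_def] by measurable
  show "(\<lambda>\<omega>. \<Sum>i<N. \<beta> i * (drift N i \<omega>)\<^sup>2) \<in> borel_measurable M"
    using dM by (intro borel_measurable_sum borel_measurable_times borel_measurable_power) auto
  define b where "b i = \<beta> i * (m i)\<^sup>2" for i
  define H where "H i \<omega> = (drift N i \<omega>)\<^sup>2 / (m i)\<^sup>2" for i \<omega>
  have sumb: "sum b {..<N} = B"
    unfolding B_def b_def m_def sum_distrib_left by (intro sum.cong) (auto simp: power_mult_distrib)
  have B: "0 < B" unfolding B_def using \<beta>(2) gamma_less Delta_pos by simp
  have HM: "H i \<in> borel_measurable M" if "i < N" for i
    unfolding H_def[abs_def] using dM[OF that] by measurable
  have moment: "(\<integral>\<^sup>+ \<omega>. ennreal (exp (H i \<omega>)) \<partial>M) \<le> ennreal (exp 1)" if i: "i < N" for i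
  proof -
    have e: "(\<mu> - 2 * \<gamma>) * \<Delta> * \<bar>real i - real N\<bar> = m i" using i by (simp add: m_def)
    have "(\<integral>\<^sup>+ \<omega>. ennreal (exp (1 / (m i)\<^sup>2 * (real_of_ereal (gradient_drift f i N \<omega>))\<^sup>2)) \<partial>M)
        \<le> ennreal (exp (1 / (m i)\<^sup>2 * (m i)\<^sup>2))"
      using drift_exp_moment[OF i, of "1 / (m i)\<^sup>2"] unfolding e by simp
    then show ?thesis using m[OF i] by (simp add: H_def drift_def)
  qed
  have "(\<integral>\<^sup>+ \<omega>. ennreal (exp ((\<Sum>i\<in>{..<N}. b i * H i \<omega>) / sum b {..<N})) \<partial>M) \<le> ennreal (exp 1)"
  proof (rule weighted_exp_moment)
    show "0 < sum b {..<N}" unfolding sumb by (rule B)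
  qed (use \<beta>(1) HM moment in \<open>auto simp: b_def\<close>)
  moreover have "(\<lambda>\<omega>. (\<Sum>i\<in>{..<N}. b i * H i \<omega>) / sum b {..<N}) \<in> borel_measurable M"
    using HM by (intro borel_measurable_divide borel_measurable_sum borel_measurable_times) auto
  ultimately have "1 - \<delta> \<le> prob {\<omega> \<in> space M. (\<Sum>i\<in>{..<N}. b i * H i \<omega>) / sum b {..<N} \<le> ln (exp 1 / \<delta>)}"
    using \<delta> by (intro exp_moment_tail) auto
  moreover have "(\<Sum>i\<in>{..<N}. b i * H i \<omega>) = (\<Sum>i<N. \<beta> i * (drift N i \<omega>)\<^sup>2)" for \<omega>
    using m by (intro sum.cong) (auto simp: b_def H_def less_imp_neq[symmetric])
  ultimately show "1 - \<delta> \<le> prob {\<omega> \<in> space M. (\<Sum>i<N. \<beta> i * (drift N i \<omega>)\<^sup>2) \<le> B * ln (exp 1 / \<delta>)}"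
    using B by (simp add: sumb divide_le_eq mult.commute)
qed

end

section \<open>Combination of the pathwise recursion with the noise and drift events\<close>

theorem theorem41:
  fixes M :: "'w measure"
    and \<mu> L \<gamma> \<mu>hat \<Delta> \<sigma> \<eta>star Ghat D \<delta> c :: real
    and f :: "nat \<Rightarrow> 'w \<Rightarrow> 'a::euclidean_space \<Rightarrow> 'a \<Rightarrow> real"
    and r :: "nat \<Rightarrow> 'w \<Rightarrow> 'a \<Rightarrow> ereal"
    and xbar x g X :: "nat \<Rightarrow> 'w \<Rightarrow> 'a"
    and F :: "nat \<Rightarrow> 'w measure"
    and \<eta> :: "nat \<Rightarrow> real" and T start :: "nat \<Rightarrow> nat" and K horizon :: nat
  assumes c: "0 < c" "constant_step_bound TYPE('w) TYPE('a) c"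
    and framework: "light_tailed_framework M \<mu> L \<gamma> f r xbar F x g \<Delta> \<sigma>"
    and \<mu>hat: "\<mu>hat = \<mu> - 2 * \<gamma>"
    and low_drift: "\<Delta> / \<sigma> < sqrt (\<mu>hat / (16 * L ^ 3))"
    and \<eta>star: "\<eta>star = (2 * \<Delta>\<^sup>2 / (\<mu>hat * \<sigma>\<^sup>2)) powr (1 / 3)"
    and Ghat: "Ghat = \<mu>hat * (\<Delta> * \<sigma>\<^sup>2 / \<mu>hat\<^sup>2) powr (2 / 3)"
    and D: "0 < D" "\<forall>\<omega>\<in>space M. psi_gap f r xbar 0 \<omega> (x 0 \<omega>) \<le> ereal D"
    and \<delta>: "0 < \<delta>" "\<delta> < 1"
    and K: "K = nat (1 + \<lceil>log 2 (1 / L * (\<sigma>\<^sup>2 * \<mu>hat / \<Delta>\<^sup>2) powr (1 / 3))\<rceil>)"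
    and \<eta>_0: "\<eta> 0 = 1 / (2 * L)"
    and \<eta>_step: "\<forall>k\<ge>1. \<eta> k = (\<eta> (k - 1) + \<eta>star) / 2"
    and T_0: "T 0 = nat \<lceil>4 * L / \<mu>hat * max 0 (ln (L * D / \<sigma>\<^sup>2))\<rceil>"
    and T_step: "\<forall>k\<ge>1. T k = nat \<lceil>2 * max 0 (ln (4 * c * ln (exp 1 / \<delta>))) / (\<mu>hat * \<eta> k)\<rceil>"
    and start: "\<forall>k. start k = (\<Sum>i<k. T i)"
    and horizon: "horizon = start K"
    and X_0: "\<forall>\<omega>\<in>space M. X 0 \<omega> = x 0 \<omega>"
    and epoch_iterates: "\<forall>\<omega>\<in>space M. \<forall>k<K. \<forall>j<T k. x (start k + j) \<omega> =
          fst (avg_prox_run \<mu> \<gamma> (\<eta> k) (\<lambda>t. r t \<omega>) (\<lambda>t. g t \<omega>) (start k) (X k \<omega>) j)"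
    and epoch_output: "\<forall>\<omega>\<in>space M. \<forall>k<K. X (Suc k) \<omega> =
          snd (avg_prox_run \<mu> \<gamma> (\<eta> k) (\<lambda>t. r t \<omega>) (\<lambda>t. g t \<omega>) (start k) (X k \<omega>) (T k))"
    and gap_measurable: "(\<lambda>\<omega>. psi_gap f r xbar horizon \<omega> (X K \<omega>)) \<in> borel_measurable M"
  shows "real horizon \<le> absolute_factor c *
          (L / \<mu>hat * max 0 (ln (L * D / \<sigma>\<^sup>2))
            + \<sigma>\<^sup>2 / (\<mu>hat * Ghat) * max 1 (ln (ln (exp 1 / \<delta>))))
      \<and> L / \<mu>hat * max 0 (ln (L * D / \<sigma>\<^sup>2))
            + \<sigma>\<^sup>2 / (\<mu>hat * Ghat) * max 1 (ln (ln (exp 1 / \<delta>)))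
          \<le> L / \<mu>hat * max 0 (ln (D / Ghat))
            + \<sigma>\<^sup>2 / (\<mu>hat * Ghat) * max 1 (ln (ln (exp 1 / \<delta>)))
      \<and> measure M {\<omega> \<in> space M. psi_gap f r xbar horizon \<omega> (X K \<omega>)
            \<le> ereal (absolute_factor c * Ghat * ln (exp 1 / \<delta>))}
          \<ge> 1 - real K * \<delta>"
proof -
  interpret light_tailed_framework M \<mu> L \<gamma> f r xbar F x g \<Delta> \<sigma> by (rule framework)
  have mh_pos: "0 < \<mu>hat" using gamma_less \<mu>hat by simp
  have c9: "9 / 10 \<le> c" by (rule constant_step_bound_lower[OF c(2) prob_space_axioms])
  define s where "s = (\<Delta>\<^sup>2 / (\<mu>hat * \<sigma>\<^sup>2)) powr (1 / 3)"
  note sc = epoch_schedule_scale[OF mh_pos Delta_pos sigma_pos L_pos low_drift, folded s_def \<eta>star Ghat]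
  have Ls: "2 < 1 / (L * s)"
    using sc(1,8) L_pos by (simp add: less_divide_eq)
  have K_eq: "K = nat (1 + \<lceil>log 2 (1 / (L * s))\<rceil>)"
    using K unfolding sc(7) by simp
  interpret es: epoch_schedule \<mu> \<gamma> \<mu>hat L \<Delta> \<sigma> s \<eta>star D \<delta> c \<eta> T start K
  proof
    show "3 \<le> K" "1 / (L * s) \<le> 2 ^ (K - 1)" "2 ^ (K - 1) \<le> 2 / (L * s)"
      using ceiling_log2_bounds[OF Ls, folded K_eq] by simp_all
    show "\<eta> (Suc k) = (\<eta> k + \<eta>star) / 2" for k
      using \<eta>_step[rule_format, of "Suc k"] by simp
    show "T (Suc k) = nat \<lceil>2 * max 0 (ln (4 * c * ln (exp 1 / \<delta>))) / (\<mu>hat * \<eta> (Suc k))\<rceil>" for k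
      using T_step[rule_format, of "Suc k"] by simp
  qed (use mh_pos \<mu>hat gamma_nonneg mu_le_L sigma_pos Delta_pos D(1) \<delta> c9 sc \<eta>_0 T_0 start in auto)
  define l where "l = ln (exp 1 / \<delta>)"
  have l1: "1 \<le> l" unfolding l_def by (rule es.log_ge_1)
  have Gh: "Ghat = \<sigma>\<^sup>2 * s" by (rule sc(6))
  have Gh0: "0 < Ghat" using sigma_pos sc(1) by (simp add: Gh)
  have ratio: "\<sigma>\<^sup>2 / (\<mu>hat * Ghat) = 1 / (\<mu>hat * s)"
    using sigma_pos by (simp add: Gh)
  define A where "A = L / \<mu>hat * max 0 (ln (L * D / \<sigma>\<^sup>2))"
  define R where "R = \<sigma>\<^sup>2 / (\<mu>hat * Ghat) * max 1 (ln (ln (exp 1 / \<delta>)))"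
  have A0: "0 \<le> A" and R0: "0 \<le> R"
    using L_pos mh_pos Gh0 by (auto simp: A_def R_def)
  have "real horizon \<le> absolute_factor c * (A + R)"
  proof -
    have "real horizon \<le> 4 * A + (18 + 64 * c) * R"
      using es.horizon_bound unfolding horizon A_def R_def ratio .
    also have "\<dots> \<le> absolute_factor c * A + absolute_factor c * R"
      using A0 R0 c(1) by (intro add_mono mult_right_mono) (auto simp: absolute_factor_def)
    finally show ?thesis by (simp add: distrib_left)
  qed
  moreover have "A + R \<le> L / \<mu>hat * max 0 (ln (D / Ghat)) + R"
  proof -
    have "L * D / \<sigma>\<^sup>2 \<le> D / Ghat"
    proof -
      have "L * Ghat \<le> \<sigma>\<^sup>2"
        using sc(8) sigma_pos L_pos sc(1) mult_left_mono[of "L * s" 1 "\<sigma>\<^sup>2"] by (simp add: Gh mult_ac)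
      then show ?thesis
        using D(1) Gh0 sigma_pos by (simp add: field_simps)
    qed
    then have "ln (L * D / \<sigma>\<^sup>2) \<le> ln (D / Ghat)"
      using L_pos D(1) sigma_pos by (intro ln_mono) auto
    then show ?thesis
      unfolding A_def using L_pos mh_pos by (intro add_right_mono mult_left_mono) auto
  qed
  moreover have "1 - real K * \<delta> \<le> measure M {\<omega> \<in> space M. psi_gap f r xbar horizon \<omega> (X K \<omega>)
            \<le> ereal (absolute_factor c * Ghat * ln (exp 1 / \<delta>))}"
  proof -
    let ?N = "start K"
    define b where "b i = es.tw i * \<eta> (es.epoch_of i)" for i
    \<comment> \<open>The extra weight at time 0 carries the drift from \<open>initial_gap\<close>,
      so that a single drift event suffices.\<close>
    define \<beta> where "\<beta> i = es.tw i + (if i = 0 then 6 * es.sw 0 else 0)" for i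
    define W where "W = (\<Sum>i<?N. \<beta> i * (real ?N - real i)\<^sup>2)"
    define E1 where "E1 = {\<omega> \<in> space M. noise_exponent ?N es.tw b \<omega> \<le> ln (1 / \<delta>)}"
    define E2 where "E2 = {\<omega> \<in> space M. (\<Sum>i<?N. \<beta> i * (drift ?N i \<omega>)\<^sup>2) \<le> (\<mu>hat * \<Delta>)\<^sup>2 * W * l}"
    have tw0: "0 \<le> es.tw i" if "i < ?N" for i using es.tw_nonneg[OF that] .
    have sum\<beta>: "(\<Sum>i<?N. \<beta> i * q i) = (\<Sum>i<?N. es.tw i * q i) + 6 * es.sw 0 * q 0" for q :: "nat \<Rightarrow> real"
    proof -
      have "(\<Sum>i<?N. \<beta> i * q i) = (\<Sum>i<?N. es.tw i * q i + (if i = 0 then 6 * es.sw 0 * q 0 else 0))"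
        by (intro sum.cong) (auto simp: \<beta>_def distrib_right)
      then show ?thesis using es.start_K_pos by (simp add: sum.distrib)
    qed
    have W_le: "W \<le> 2560 * es.lam / (\<mu>hat * \<eta>star)\<^sup>2"
      using es.drift_weight unfolding W_def sum\<beta> by simp
    have W_pos: "0 < W"
    proof -
      have "0 \<le> (\<Sum>i<?N. es.tw i * (real ?N - real i)\<^sup>2)"
        using tw0 by (intro sum_nonneg mult_nonneg_nonneg) auto
      moreover have "0 < 6 * es.sw 0 * (real ?N - real 0)\<^sup>2"
        using es.sw_pos[of 0] es.start_K_pos by simp
      ultimately show ?thesis unfolding W_def sum\<beta> by linarith
    qed
    have b0: "0 \<le> b i" if "i < ?N" for i
      using tw0[OF that] es.eta_pos[of "es.epoch_of i"] by (simp add: b_def)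
    have b2: "b i * \<sigma>\<^sup>2 \<le> 1 / 2" if "i < ?N" for i
      using es.tw_eta_small[OF that] by (simp add: b_def)
    have \<beta>0: "0 \<le> \<beta> i" if "i < ?N" for i
      using tw0[OF that] es.sw_pos[of 0] by (simp add: \<beta>_def)
    note tail1 = noise_exponent_tail[of ?N es.tw b, OF tw0 b0 b2 \<delta>(1)]
    note tail2 = weighted_drift_tail[of ?N \<beta>, OF es.start_K_pos \<beta>0 W_pos[unfolded W_def] \<delta>(1),
        folded W_def \<mu>hat l_def]
    have E1: "E1 \<in> events" "1 - \<delta> \<le> prob E1"
      unfolding E1_def using tail1 by auto
    have E2: "E2 \<in> events" "1 - \<delta> \<le> prob E2"
      unfolding E2_def using tail2 by auto
    have drift_fin: "AE \<omega> in M. \<forall>i<?N. gradient_drift f i ?N \<omega> < \<infinity>"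
      using drift_finite by (intro AE_all_countable[THEN iffD2] allI) (auto intro: AE_impI)
    have path: "psi_gap f r xbar ?N \<omega> (X K \<omega>) \<le> ereal (absolute_factor c * Ghat * l)"
      if \<omega>: "\<omega> \<in> space M" and fin: "\<forall>i<?N. gradient_drift f i ?N \<omega> < \<infinity>"
        and e1: "\<omega> \<in> E1" and e2: "\<omega> \<in> E2" for \<omega>
    proof -
      let ?z = "\<lambda>i. gradient_noise f x g i \<omega>" and ?v = "\<lambda>i. x i \<omega> - xbar ?N \<omega>"
      let ?gap = "\<lambda>u. psi_real ?N \<omega> u - psi_real ?N \<omega> (xbar ?N \<omega>)"
      have r_eq: "(\<lambda>t. r t \<omega>) = (\<lambda>_. r 0 \<omega>)" using r_constant[OF \<omega>] by blast
      have X0: "X 0 \<omega> = x 0 \<omega>" using X_0 \<omega> by blast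
      have gap0: "psi_gap f r xbar 0 \<omega> (X 0 \<omega>) \<le> ereal D" using D(2) \<omega> X0 by simp
      have minimal: "f ?N \<omega> (xbar ?N \<omega>) (xbar ?N \<omega>) + real_of_ereal (r 0 \<omega> (xbar ?N \<omega>))
          \<le> f ?N \<omega> (xbar ?N \<omega>) u + real_of_ereal (r 0 \<omega> u)" if "u \<in> effective_domain (r 0 \<omega>)" for u
        using xbar_minimizer(2)[OF \<omega> that, of ?N] unfolding psi_real_def rho_def .
      have grad: "g i \<omega> = gradient (f ?N \<omega> (xbar ?N \<omega>)) (x i \<omega>)
          + (gradient (f i \<omega> (x i \<omega>)) (x i \<omega>) - gradient (f ?N \<omega> (xbar ?N \<omega>)) (x i \<omega>)) - ?z i" for i
        by (simp add: gradient_noise_def)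
      have bias: "norm (gradient (f i \<omega> (x i \<omega>)) (x i \<omega>) - gradient (f ?N \<omega> (xbar ?N \<omega>)) (x i \<omega>))
          \<le> drift ?N i \<omega> + \<gamma> * norm (?v i)" if "i < ?N" for i
        using gradient_difference[OF \<omega>] fin that by blast
      note det = es.tracking_deterministic[where X = "\<lambda>k. X k \<omega>", OF r_pcc[OF \<omega>] f_strongly_convex[OF \<omega>]
          f_smooth[OF \<omega>] xbar_minimizer(1)[OF \<omega>] minimal grad bias drift_nonneg finite_gap_in_domain[OF \<omega> gap0]
          epoch_iterates[rule_format, OF \<omega>, unfolded r_eq] epoch_output[rule_format, OF \<omega>, unfolded r_eq]]
      have XK: "X K \<omega> \<in> effective_domain (r 0 \<omega>)"
        using det(1) .
      have unrolled: "es.lam * ?gap (X K \<omega>) \<le> es.sw 0 * ?gap (X 0 \<omega>)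
          + (\<Sum>i<?N. es.tw i * (?z i \<bullet> ?v i + \<eta> (es.epoch_of i) * (norm (?z i))\<^sup>2)
            - 4 * (es.tw i)\<^sup>2 * \<sigma>\<^sup>2 * (norm (?v i))\<^sup>2 + es.tw i * ((drift ?N i \<omega>)\<^sup>2 / \<mu>hat))"
        using det(2) unfolding psi_real_def rho_def .
      have "(\<Sum>i<?N. es.tw i * (?z i \<bullet> ?v i + \<eta> (es.epoch_of i) * (norm (?z i))\<^sup>2)
            - 4 * (es.tw i)\<^sup>2 * \<sigma>\<^sup>2 * (norm (?v i))\<^sup>2 + es.tw i * ((drift ?N i \<omega>)\<^sup>2 / \<mu>hat))
          = noise_exponent ?N es.tw b \<omega> + (\<Sum>i<?N. es.tw i * (2 * \<eta> (es.epoch_of i) * \<sigma>\<^sup>2))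
            + (\<Sum>i<?N. es.tw i * (drift ?N i \<omega>)\<^sup>2) / \<mu>hat"
        unfolding noise_exponent_def sum_divide_distrib sum.distrib[symmetric]
        by (intro sum.cong) (auto simp: b_def algebra_simps)
      also have "\<dots> \<le> ln (1 / \<delta>) + 33 / 250 + (\<Sum>i<?N. es.tw i * (drift ?N i \<omega>)\<^sup>2) / \<mu>hat"
        using e1 es.sum_tw_eta unfolding E1_def by simp
      \<comment> \<open>The unit subtracted here absorbs the 33 / 250 of the noise compensators and
        the 33 / 1000 of the initial gap.\<close>
      also have "ln (1 / \<delta>) = l - 1" using \<delta> by (simp add: l_def ln_div)
      finally have noise: "(\<Sum>i<?N. es.tw i * (?z i \<bullet> ?v i + \<eta> (es.epoch_of i) * (norm (?z i))\<^sup>2)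
            - 4 * (es.tw i)\<^sup>2 * \<sigma>\<^sup>2 * (norm (?v i))\<^sup>2 + es.tw i * ((drift ?N i \<omega>)\<^sup>2 / \<mu>hat))
          \<le> l - 1 + 33 / 250 + (\<Sum>i<?N. es.tw i * (drift ?N i \<omega>)\<^sup>2) / \<mu>hat" .
      have "?gap (X 0 \<omega>) \<le> 2 * D + 6 * (drift ?N 0 \<omega>)\<^sup>2 / \<mu>hat"
        unfolding \<mu>hat using fin es.start_K_pos by (intro initial_gap[OF \<omega> _ gap0]) auto
      then have "es.sw 0 * ?gap (X 0 \<omega>) \<le> es.sw 0 * (2 * D + 6 * (drift ?N 0 \<omega>)\<^sup>2 / \<mu>hat)"
        using es.sw_pos[of 0] by (intro mult_left_mono) auto
      also have "\<dots> = es.sw 0 * (2 * D) + 6 * es.sw 0 * (drift ?N 0 \<omega>)\<^sup>2 / \<mu>hat"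
        by (simp add: distrib_left)
      finally have init: "es.sw 0 * ?gap (X 0 \<omega>) \<le> 33 / 1000 + 6 * es.sw 0 * (drift ?N 0 \<omega>)\<^sup>2 / \<mu>hat"
        using es.sw_initial by linarith
      have "(\<Sum>i<?N. es.tw i * (drift ?N i \<omega>)\<^sup>2) / \<mu>hat + 6 * es.sw 0 * (drift ?N 0 \<omega>)\<^sup>2 / \<mu>hat
          = (\<Sum>i<?N. \<beta> i * (drift ?N i \<omega>)\<^sup>2) / \<mu>hat"
        unfolding sum\<beta> by (simp add: add_divide_distrib)
      also have "\<dots> \<le> (\<mu>hat * \<Delta>)\<^sup>2 * W * l / \<mu>hat"
        using e2 mh_pos unfolding E2_def by (intro divide_right_mono) auto
      also have "\<dots> = \<mu>hat * \<Delta>\<^sup>2 * W * l"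
        using mh_pos by (simp add: power2_eq_square)
      also have "\<dots> \<le> \<mu>hat * \<Delta>\<^sup>2 * (2560 * es.lam / (\<mu>hat * \<eta>star)\<^sup>2) * l"
        using W_le mh_pos l1 by (intro mult_right_mono mult_left_mono) auto
      also have "\<dots> = 2560 * es.lam * (\<Delta>\<^sup>2 / (\<mu>hat * \<eta>star\<^sup>2)) * l"
        using mh_pos by (simp add: power_mult_distrib power2_eq_square mult_ac)
      also have "\<dots> \<le> 2560 * es.lam * Ghat * l"
      proof -
        \<comment> \<open>Since
          \<open>s ^ 3 = \<Delta>\<^sup>2 / (\<mu>hat * \<sigma>\<^sup>2)\<close>, the drift level
          at step size \<open>s\<close> equals the noise level \<open>\<sigma>\<^sup>2 * s\<close>,
          which is \<open>Ghat\<close>.\<close>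
        have "\<Delta>\<^sup>2 / (\<mu>hat * \<eta>star\<^sup>2) \<le> \<Delta>\<^sup>2 / (\<mu>hat * s\<^sup>2)"
          using mh_pos sc(1,3) by (intro divide_left_mono mult_left_mono power_mono mult_pos_pos) auto
        also have "\<dots> = s ^ 3 * \<sigma>\<^sup>2 / s\<^sup>2"
          using sc(2) sigma_pos by simp
        also have "\<dots> = Ghat"
          using sc(1) by (simp add: Gh power3_eq_cube power2_eq_square)
        finally show ?thesis
          using es.lam_pos l1 by (intro mult_right_mono mult_left_mono) auto
      qed
      finally have "es.lam * ?gap (X K \<omega>) \<le> l + 2560 * es.lam * Ghat * l"
        using unrolled noise init by linarith
      then have "?gap (X K \<omega>) \<le> (l + 2560 * es.lam * Ghat * l) / es.lam"
        using es.lam_pos by (simp add: pos_le_divide_eq mult.commute)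
      also have "\<dots> = l * (1 / es.lam) + 2560 * Ghat * l"
        using es.lam_pos by (simp add: add_divide_distrib)
      also have "\<dots> \<le> l * (800 * Ghat) + 2560 * Ghat * l"
      proof -
        \<comment> \<open>The last step size is at most \<open>2 * \<eta>star\<close>, hence at most
          \<open>4 * s\<close>.\<close>
        have "1 / es.lam = 200 * \<sigma>\<^sup>2 * \<eta> (K - 1)" by (simp add: es.lam_def)
        also have "\<dots> \<le> 200 * \<sigma>\<^sup>2 * (4 * s)"
          using es.eta_last sc(4) by (intro mult_left_mono) auto
        also have "\<dots> = 800 * Ghat" by (simp add: Gh)
        finally show ?thesis using l1 by (intro add_right_mono mult_left_mono) auto
      qed
      also have "\<dots> = 3360 * (Ghat * l)" by simp
      also have "\<dots> \<le> absolute_factor c * (Ghat * l)"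
        using c(1) Gh0 l1 by (intro mult_right_mono) (auto simp: absolute_factor_def)
      finally show ?thesis
        unfolding psi_gap_eq[OF \<omega> XK] by (simp add: mult.assoc)
    qed
    \<comment> \<open>Two exceptional events against an allowance of
      \<open>K \<ge> 3\<close>.\<close>
    have "1 - real K * \<delta> \<le> 1 - (\<delta> + \<delta>)"
      using es.K(1) \<delta>(1) mult_right_mono[of 2 "real K" \<delta>] by simp
    also have "\<dots> \<le> prob (E1 \<inter> E2)"
      by (rule prob_Int_ge[OF E1 E2])
    also have "\<dots> \<le> prob {\<omega> \<in> space M. psi_gap f r xbar horizon \<omega> (X K \<omega>)
            \<le> ereal (absolute_factor c * Ghat * ln (exp 1 / \<delta>))}"
    proof (rule finite_measure_mono_AE)
      show "AE \<omega> in M. \<omega> \<in> E1 \<inter> E2 \<longrightarrow> \<omega> \<in> {\<omega> \<in> space M. psi_gap f r xbar horizon \<omega> (X K \<omega>)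
            \<le> ereal (absolute_factor c * Ghat * ln (exp 1 / \<delta>))}"
        using drift_fin AE_space by eventually_elim (auto simp: horizon l_def[symmetric] intro: path)
      show "{\<omega> \<in> space M. psi_gap f r xbar horizon \<omega> (X K \<omega>)
            \<le> ereal (absolute_factor c * Ghat * ln (exp 1 / \<delta>))} \<in> events"
        using gap_measurable by measurable
    qed
    finally show ?thesis .
  qed
  ultimately show ?thesis
    unfolding A_def R_def by blast
qed

end
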